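(* Let $S$ be a smooth phase function on a neighborhood of the origin in $\mathbb{R}^2$ in superadapted coordinates with Newton distance $d=d(S)>1$, and let $\phi\in C_c^\infty(\mathbb{R}^2)$ be real-valued and supported in a sufficiently small neighborhood of the origin. Then there is a constant $C$ depending on $S$ and $\phi$ such that, as $\lambda\to\infty$ (i.e. for all sufficiently large $\lambda$): in Cases 1 and 3, $$|J_{S,\phi}(\lambda)|<C\lambda^{-1/d};$$ in Case 2, $$|J_{S,\phi}(\lambda)|<C\lambda^{-1/d}\ln(\lambda).$$
   Context: Standing assumptions: $S$ is real-valued, $S(0,0)=0$, $\nabla S(0,0)=0$, and the Taylor expansion $\sum_{a,b}s_{ab}x^ay^b$ of $S$ at the origin is not identically zero. Newton polygon: $N(S)$ is the convex hull of the union of the quadrants $\{(t_1,t_2): t_1\ge a,\ t_2\ge b\}$ over all $(a,b)$ with $s_{ab}\neq0$. Its boundary consists of finitely many (possibly zero) compact edges of negative slope together with an unbounded vertical ray and an unbounded horizontal ray. The Newton distance is $d(S)=\inf\{t:(t,t)\in N(S)\}$, and the bisectrix is the line $t_1=t_2$. "The bisectrix intersects $N(S)$" at/in a part of $N(S)$ means that the boundary point $(d(S),d(S))$ lies there. For a compact edge $e$ of $N(S)$ put $S_e(x,y)=\sum_{(a,b)\in e}s_{ab}x^ay^b$. $S$ is in superadapted coordinates if for every compact edge $e$ of $N(S)$ intersecting the bisectrix, neither $S_e(1,y)$ nor $S_e(-1,y)$ has a real zero of order $\ge d(S)$ other than possibly $y=0$. Case 1: the bisectrix intersects $N(S)$ in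 the interior of a compact edge. Case 2: it intersects $N(S)$ at a vertex $(d,d)$. Case 3: it intersects $N(S)$ in the interior of one of the unbounded rays. $J_{S,\phi}(\lambda)=\int_{\mathbb{R}^2}e^{i\lambda S(x,y)}\phi(x,y)\,dx\,dy$. *)

theory Defs
  imports "HOL-Analysis.Analysis" "HOL-Computational_Algebra.Polynomial"
begin

primrec Ck_on :: "nat \<Rightarrow> (real \<times> real) set \<Rightarrow> (real \<times> real \<Rightarrow> real) \<Rightarrow> bool" where
  "Ck_on 0 U f \<longleftrightarrow> continuous_on U f"
| "Ck_on (Suc k) U f \<longleftrightarrow>
     (\<forall>p\<in>U. f differentiable (at p)) \<and>
     (\<forall>v. Ck_on k U (\<lambda>p. frechet_derivative f (at p) v))"

text \<open>The notion is meant for open sets \<open>U\<close>.\<close>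

definition smooth_on :: "(real \<times> real) set \<Rightarrow> (real \<times> real \<Rightarrow> real) \<Rightarrow> bool" where
  "smooth_on U f \<longleftrightarrow> (\<forall>k. Ck_on k U f)"

definition partial_x :: "(real \<times> real \<Rightarrow> real) \<Rightarrow> real \<times> real \<Rightarrow> real" where
  "partial_x f p = frechet_derivative f (at p) (1, 0)"

definition partial_y :: "(real \<times> real \<Rightarrow> real) \<Rightarrow> real \<times> real \<Rightarrow> real" where
  "partial_y f p = frechet_derivative f (at p) (0, 1)"

definition taylor_coeff :: "(real \<times> real \<Rightarrow> real) \<Rightarrow> nat \<Rightarrow> nat \<Rightarrow> real" where
  "taylor_coeff S a b = (partial_x ^^ a) ((partial_y ^^ b) S) (0, 0) / (fact a * fact b)"

definition newton_polygon :: "(real \<times> real \<Rightarrow> real) \<Rightarrow> (real \<times> real) set" where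
  "newton_polygon S = convex hull
     (\<Union>(a, b) \<in> {(a, b). taylor_coeff S a b \<noteq> 0}. {(t1, t2). t1 \<ge> real a \<and> t2 \<ge> real b})"

definition newton_distance :: "(real \<times> real \<Rightarrow> real) \<Rightarrow> real" where
  "newton_distance S = Inf {t. (t, t) \<in> newton_polygon S}"

definition bisectrix_point :: "(real \<times> real \<Rightarrow> real) \<Rightarrow> real \<times> real" where
  "bisectrix_point S = (newton_distance S, newton_distance S)"

definition compact_edge :: "(real \<times> real \<Rightarrow> real) \<Rightarrow> (real \<times> real) set \<Rightarrow> bool" where
  "compact_edge S e \<longleftrightarrow> e edge_of newton_polygon S \<and> compact e"

definition unbounded_ray :: "(real \<times> real \<Rightarrow> real) \<Rightarrow> (real \<times> real) set \<Rightarrow> bool" where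
  "unbounded_ray S e \<longleftrightarrow> e edge_of newton_polygon S \<and> \<not> bounded e"

text \<open>The exponents lying on \<open>e\<close>; only used for compact \<open>e\<close>, where there are finitely many.\<close>

definition edge_exponents :: "(real \<times> real) set \<Rightarrow> (nat \<times> nat) set" where
  "edge_exponents e = {(a, b). (real a, real b) \<in> e}"

lemma finite_edge_exponents:
  assumes "bounded e"
  shows "finite (edge_exponents e)"
proof -
  obtain B where B: "norm p \<le> B" if "p \<in> e" for p
    using assms by (auto simp: bounded_iff)
  have "edge_exponents e \<subseteq> {..nat \<lceil>B\<rceil>} \<times> {..nat \<lceil>B\<rceil>}"
  proof
    fix q assume "q \<in> edge_exponents e"
    then obtain a b where q: "q = (a, b)" and ab: "(real a, real b) \<in> e"
      by (auto simp: edge_exponents_def)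
    have "real a \<le> B" "real b \<le> B"
      using B[OF ab] norm_fst_le[of "real a" "real b"] norm_snd_le[of "real b" "real a"]
      by auto
    then show "q \<in> {..nat \<lceil>B\<rceil>} \<times> {..nat \<lceil>B\<rceil>}"
      unfolding q by (auto; linarith)
  qed
  then show ?thesis
    by (rule finite_subset) auto
qed

definition edge_part :: "(real \<times> real \<Rightarrow> real) \<Rightarrow> (real \<times> real) set \<Rightarrow> real \<Rightarrow> real \<Rightarrow> real" where
  "edge_part S e x y = (\<Sum>(a, b)\<in>edge_exponents e. taylor_coeff S a b * x ^ a * y ^ b)"

text \<open>\<open>edge_part S e x\<close> as a formal polynomial in \<open>y\<close>, so that the order of a zero is \<open>order\<close>.\<close>

definition edge_poly :: "(real \<times> real \<Rightarrow> real) \<Rightarrow> (real \<times> real) set \<Rightarrow> real \<Rightarrow> real poly" where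
  "edge_poly S e x = (\<Sum>(a, b)\<in>edge_exponents e. monom (taylor_coeff S a b * x ^ a) b)"

lemma poly_edge_poly: "poly (edge_poly S e x) y = edge_part S e x y"
  by (simp add: edge_poly_def edge_part_def poly_sum poly_monom case_prod_beta)

definition superadapted :: "(real \<times> real \<Rightarrow> real) \<Rightarrow> bool" where
  "superadapted S \<longleftrightarrow>
     (\<forall>e. compact_edge S e \<and> bisectrix_point S \<in> e \<longrightarrow>
       (\<forall>x\<in>{1, -1}. \<not> (\<exists>y. y \<noteq> 0 \<and> poly (edge_poly S e x) y = 0 \<and>
          real (order y (edge_poly S e x)) \<ge> newton_distance S)))"

definition bisectrix_in_edge :: "(real \<times> real \<Rightarrow> real) \<Rightarrow> bool" where
  "bisectrix_in_edge S \<longleftrightarrow> (\<exists>e. compact_edge S e \<and> bisectrix_point S \<in> rel_interior e)"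

definition bisectrix_at_vertex :: "(real \<times> real \<Rightarrow> real) \<Rightarrow> bool" where
  "bisectrix_at_vertex S \<longleftrightarrow> bisectrix_point S extreme_point_of newton_polygon S"

definition bisectrix_in_ray :: "(real \<times> real \<Rightarrow> real) \<Rightarrow> bool" where
  "bisectrix_in_ray S \<longleftrightarrow> (\<exists>e. unbounded_ray S e \<and> bisectrix_point S \<in> rel_interior e)"

definition supp :: "(real \<times> real \<Rightarrow> real) \<Rightarrow> (real \<times> real) set" where
  "supp \<phi> = closure {p. \<phi> p \<noteq> 0}"

definition osc_integral ::
    "(real \<times> real \<Rightarrow> real) \<Rightarrow> (real \<times> real \<Rightarrow> real) \<Rightarrow> real \<Rightarrow> complex" where
  "osc_integral S \<phi> lam =
     (LINT p|lborel. exp (\<i> * of_real lam * of_real (S p)) * of_real (\<phi> p))"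

end

theory Submission
  imports Defs
begin

text \<open>
  Choose weights \<open>\<kappa>, \<nu> > 0\<close> such that the line \<open>\<kappa> a + \<nu> b = 1\<close> supports the Newton polygon, and let \<open>P\<close> be the
  part of the Taylor series of \<open>S\<close> on it. The dilates \<open>2\<^sup>j S (2 powr (- \<kappa> j) x, 2 powr (- \<nu> j) y)\<close> and all their
  pure derivatives converge to those of \<open>P\<close> uniformly on the unit square. If at every point other than the
  origin some pure derivative of \<open>P\<close> of order at most \<open>K\<close> is nonzero (order \<open>0\<close> reduces to order \<open>1\<close> by Euler's
  identity), then van der Corput's lemma on small rectangles bounds the integral over the \<open>j\<close>-th dyadic
  annulus by a multiple of \<open>2 powr (- (\<kappa> + \<nu>) j) (\<lambda> / 2\<^sup>j) powr (- 1 / K)\<close>; sharp cutoffs do no harm. It remains to sum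
  over \<open>2\<^sup>j \<le> \<lambda>\<close> and to bound the remaining box by its area.

  In the interior of a compact edge the weights are those of the edge, so \<open>\<kappa> + \<nu> = 1 / d\<close>, and superadaptedness
  gives \<open>K < d\<close>: the sum is geometric, dominated by \<open>2\<^sup>j \<approx> \<lambda>\<close>. At a vertex \<open>(d, d)\<close> a strictly supporting line makes
  \<open>P\<close> a multiple of \<open>x\<^sup>d y\<^sup>d\<close>, so \<open>K = d\<close> and every scale contributes the same amount, whence the logarithm. On a
  horizontal ray with left endpoint \<open>(a, d)\<close> one may take \<open>P\<close> to be a multiple of \<open>x\<^sup>a y\<^sup>d\<close>, so \<open>K = d\<close> but
  \<open>\<kappa> + \<nu> > 1 / d\<close>, and the sum is dominated by its first term.
\<close>

subsection \<open>Partial derivatives of smooth functions\<close>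

text \<open>Van der Corput's lemma works in one variable, so only derivatives along an axis are of
  use; the other variable is integrated trivially. Its bound does not ask the amplitude to vanish at
  the endpoints of the interval, and so the annuli can be cut into rectangles without a smooth
  partition of unity. What shapes the statements is the order of choices: the neighbourhood is fixed
  before the cutoff. Hence the threshold scale may depend on \<open>S\<close> alone, and a cutoff
  enters only through one number that bounds it and its first partial derivatives. The difference
  between \<open>S\<close> and its Taylor polynomial costs nothing, since it tends to 0 under the
  dilations. In the case of a compact edge, a point off the axes is moved by quasi-homogeneity to x
  = 1 or x = -1, where the order of vanishing in y is below d; for the points of the axes, an
  exponent of \<open>S\<close> on the edge on either side of the bisectrix is enough.\<close>

lemma smooth_on_continuous: "smooth_on U f \<Longrightarrow> continuous_on U f"
  unfolding smooth_on_def by (metis Ck_on.simps(1))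

lemma smooth_on_partial_x: "smooth_on U f \<Longrightarrow> smooth_on U (partial_x f)"
  unfolding smooth_on_def partial_x_def[abs_def] by (metis Ck_on.simps(2))

lemma smooth_on_partial_y: "smooth_on U f \<Longrightarrow> smooth_on U (partial_y f)"
  unfolding smooth_on_def partial_y_def[abs_def] by (metis Ck_on.simps(2))

lemma smooth_on_partial_x_pow: "smooth_on U f \<Longrightarrow> smooth_on U ((partial_x ^^ k) f)"
  by (induction k) (auto intro: smooth_on_partial_x)

lemma smooth_on_partial_y_pow: "smooth_on U f \<Longrightarrow> smooth_on U ((partial_y ^^ k) f)"
  by (induction k) (auto intro: smooth_on_partial_y)

lemma smooth_on_has_derivative:
  assumes "smooth_on U f" "p \<in> U"
  shows "(f has_derivative frechet_derivative f (at p)) (at p)"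
proof -
  have "Ck_on (Suc 0) U f" using assms by (simp only: smooth_on_def)
  then show ?thesis using assms(2) by (simp add: frechet_derivative_works)
qed

lemma partial_x_has_real_derivative:
  assumes "smooth_on U f" "(x, y) \<in> U"
  shows "((\<lambda>t. f (t, y)) has_real_derivative partial_x f (x, y)) (at x)"
proof -
  let ?D = "frechet_derivative f (at (x, y))"
  have D: "(f has_derivative ?D) (at (x, y))"
    by (rule smooth_on_has_derivative[OF assms])
  have lin: "linear ?D" using D has_derivative_linear by blast
  have "((\<lambda>t. f (t, y)) has_derivative (\<lambda>h. ?D (h, 0))) (at x)"
    by (rule has_derivative_compose[of "\<lambda>t. (t, y)" "\<lambda>h. (h, 0)" x UNIV f ?D, simplified])
       (auto intro!: derivative_eq_intros D)
  moreover have "(\<lambda>h. ?D (h, 0)) = (*) (partial_x f (x, y))"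
  proof
    fix h :: real
    have "?D (h, 0) = ?D (h *\<^sub>R (1, 0))" by simp
    also have "\<dots> = h *\<^sub>R ?D (1, 0)" using lin linear_scale by blast
    finally show "?D (h, 0) = partial_x f (x, y) * h" by (simp add: partial_x_def)
  qed
  ultimately show ?thesis by (simp add: has_field_derivative_def)
qed

lemma partial_y_has_real_derivative:
  assumes "smooth_on U f" "(x, y) \<in> U"
  shows "((\<lambda>t. f (x, t)) has_real_derivative partial_y f (x, y)) (at y)"
proof -
  let ?D = "frechet_derivative f (at (x, y))"
  have D: "(f has_derivative ?D) (at (x, y))"
    by (rule smooth_on_has_derivative[OF assms])
  have lin: "linear ?D" using D has_derivative_linear by blast
  have "((\<lambda>t. f (x, t)) has_derivative (\<lambda>h. ?D (0, h))) (at y)"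
    by (rule has_derivative_compose[of "\<lambda>t. (x, t)" "\<lambda>h. (0, h)" y UNIV f ?D, simplified])
       (auto intro!: derivative_eq_intros D)
  moreover have "(\<lambda>h. ?D (0, h)) = (*) (partial_y f (x, y))"
  proof
    fix h :: real
    have "?D (0, h) = ?D (h *\<^sub>R (0, 1))" by simp
    also have "\<dots> = h *\<^sub>R ?D (0, 1)" using lin linear_scale by blast
    finally show "?D (0, h) = partial_y f (x, y) * h" by (simp add: partial_y_def)
  qed
  ultimately show ?thesis by (simp add: has_field_derivative_def)
qed

text \<open>\<open>frechet_derivative\<close> is a choice among the maps D with
  \<open>has_derivative\<close>. Functions that agree near p have the same such maps, so the choices
  coincide even where no derivative exists.\<close>

lemma frechet_derivative_cong_open:
  assumes "open U" "p \<in> U" "\<And>q. q \<in> U \<Longrightarrow> f q = g q"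
  shows "frechet_derivative f (at p) = frechet_derivative g (at p)"
proof -
  have "(f has_derivative D) (at p) \<longleftrightarrow> (g has_derivative D) (at p)" for D
    using assms has_derivative_transform_within_open[OF _ assms(1,2), of _ D UNIV] by metis
  then show ?thesis by (simp add: frechet_derivative_def)
qed

lemma partial_x_cong:
  "open U \<Longrightarrow> (\<And>q. q \<in> U \<Longrightarrow> f q = g q) \<Longrightarrow> p \<in> U \<Longrightarrow> partial_x f p = partial_x g p"
  unfolding partial_x_def by (metis frechet_derivative_cong_open)

lemma partial_y_cong:
  "open U \<Longrightarrow> (\<And>q. q \<in> U \<Longrightarrow> f q = g q) \<Longrightarrow> p \<in> U \<Longrightarrow> partial_y f p = partial_y g p"
  unfolding partial_y_def by (metis frechet_derivative_cong_open)

section \<open>Symmetry of mixed partial derivatives\<close>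

lemma dist_pair_le: "dist (a, b) (x, y) \<le> \<bar>a - x\<bar> + \<bar>b - y\<bar>" for a b x y :: real
  by (simp add: dist_Pair_Pair dist_real_def sqrt_sum_squares_le_sum_abs)

text \<open>\<open>taylor_coeff\<close> applies the y-derivatives before the x-derivatives, whereas
  the Taylor coefficients of a pure x-derivative of \<open>S\<close> ask for the opposite order. The
  exchange follows from continuity of both mixed derivatives, which are compared on small
  squares.\<close>

lemma partial_commute:
  assumes U: "open U" and f: "smooth_on U f" and p: "(x, y) \<in> U"
  shows "partial_x (partial_y f) (x, y) = partial_y (partial_x f) (x, y)"
proof (rule ccontr)
  let ?A = "partial_x (partial_y f)" and ?B = "partial_y (partial_x f)"
  assume ne: "?A (x, y) \<noteq> ?B (x, y)"
  define e where "e = \<bar>?A (x, y) - ?B (x, y)\<bar> / 2"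
  have e: "e > 0" using ne by (simp add: e_def)
  note fx = smooth_on_partial_x[OF f] and fy = smooth_on_partial_y[OF f]
  have cA: "continuous (at (x, y)) ?A" and cB: "continuous (at (x, y)) ?B"
    using smooth_on_continuous[OF smooth_on_partial_x[OF fy]]
      smooth_on_continuous[OF smooth_on_partial_y[OF fx]] U p
    by (simp_all add: continuous_on_eq_continuous_at)
  obtain d1 where d1: "d1 > 0" "\<And>q. dist q (x, y) < d1 \<Longrightarrow> dist (?A q) (?A (x, y)) < e"
    using cA e by (auto simp: continuous_at_eps_delta)
  obtain d2 where d2: "d2 > 0" "\<And>q. dist q (x, y) < d2 \<Longrightarrow> dist (?B q) (?B (x, y)) < e"
    using cB e by (auto simp: continuous_at_eps_delta)
  obtain d3 where d3: "d3 > 0" "\<And>q. dist q (x, y) < d3 \<Longrightarrow> q \<in> U"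
    using U p by (auto simp: open_dist)
  \<comment> \<open>Every point of the square of side h with corner (x, y) is within 2 h of the
    corner, and 2 h < 3 h, the least of the three radii.\<close>
  define h where "h = min d1 (min d2 d3) / 3"
  have h: "h > 0" using d1(1) d2(1) d3(1) by (simp add: h_def)
  have near: "dist (a, b) (x, y) < d1 \<and> dist (a, b) (x, y) < d2 \<and> (a, b) \<in> U"
    if "a \<in> {x..x+h}" "b \<in> {y..y+h}" for a b
  proof -
    have "dist (a, b) (x, y) \<le> 2 * h" using dist_pair_le[of a b x y] that by auto
    also have "\<dots> < 3 * h" using h by simp
    also have "\<dots> = min d1 (min d2 d3)" by (simp add: h_def)
    finally show ?thesis using d3(2) by auto
  qed
  \<comment> \<open>The second difference over the square. Two applications of the mean value
    theorem, in either order of the variables, turn it into h^2 times either mixed derivative at a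
    point of the square.\<close>
  define D where "D = f (x+h, y+h) - f (x+h, y) - f (x, y+h) + f (x, y)"
  obtain a b where ab: "a \<in> {x..x+h}" "b \<in> {y..y+h}" "D = h * h * ?B (a, b)"
  proof -
    have "\<exists>a. x < a \<and> a < x+h \<and> (f (x+h, y+h) - f (x+h, y)) - (f (x, y+h) - f (x, y))
        = (x + h - x) * (partial_x f (a, y+h) - partial_x f (a, y))"
      using h near by (intro MVT2) (auto intro!: derivative_eq_intros partial_x_has_real_derivative[OF f])
    then obtain a where a: "x < a" "a < x+h" "D = h * (partial_x f (a, y+h) - partial_x f (a, y))"
      by (auto simp: D_def algebra_simps)
    have "\<exists>b. y < b \<and> b < y+h \<and> partial_x f (a, y+h) - partial_x f (a, y) = (y + h - y) * ?B (a, b)"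
      using h near a by (intro MVT2) (auto intro!: partial_y_has_real_derivative[OF fx])
    then obtain b where "y < b" "b < y+h" "partial_x f (a, y+h) - partial_x f (a, y) = h * ?B (a, b)" by auto
    then show ?thesis using a by (intro that[of a b]) auto
  qed
  obtain a' b' where ab': "a' \<in> {x..x+h}" "b' \<in> {y..y+h}" "D = h * h * ?A (a', b')"
  proof -
    have "\<exists>b. y < b \<and> b < y+h \<and> (f (x+h, y+h) - f (x, y+h)) - (f (x+h, y) - f (x, y))
        = (y + h - y) * (partial_y f (x+h, b) - partial_y f (x, b))"
      using h near by (intro MVT2) (auto intro!: derivative_eq_intros partial_y_has_real_derivative[OF f])
    then obtain b where b: "y < b" "b < y+h" "D = h * (partial_y f (x+h, b) - partial_y f (x, b))"
      by (auto simp: D_def algebra_simps)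
    have "\<exists>a. x < a \<and> a < x+h \<and> partial_y f (x+h, b) - partial_y f (x, b) = (x + h - x) * ?A (a, b)"
      using h near b by (intro MVT2) (auto intro!: partial_x_has_real_derivative[OF fy])
    then obtain a where "x < a" "a < x+h" "partial_y f (x+h, b) - partial_y f (x, b) = h * ?A (a, b)" by auto
    then show ?thesis using b by (intro that[of a b]) auto
  qed
  have "?A (a', b') = ?B (a, b)" using ab(3) ab'(3) h by simp
  moreover have "dist (?A (a', b')) (?A (x, y)) < e" "dist (?B (a, b)) (?B (x, y)) < e"
    using near ab ab' d1 d2 by blast+
  ultimately have "\<bar>?A (x, y) - ?B (x, y)\<bar> < 2 * e" by (simp add: dist_real_def)
  then show False by (simp add: e_def)
qed

lemma partial_y_partial_x_pow:
  assumes U: "open U" and f: "smooth_on U f" and p: "p \<in> U"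
  shows "partial_y ((partial_x ^^ k) f) p = (partial_x ^^ k) (partial_y f) p"
  using p
proof (induction k arbitrary: p)
  case (Suc k)
  have "partial_y ((partial_x ^^ Suc k) f) p = partial_x (partial_y ((partial_x ^^ k) f)) p"
    using partial_commute[OF U smooth_on_partial_x_pow[OF f, of k], of "fst p" "snd p"] Suc.prems by simp
  also have "\<dots> = partial_x ((partial_x ^^ k) (partial_y f)) p"
    by (rule partial_x_cong[OF U Suc.IH Suc.prems])
  finally show ?case by simp
qed simp

lemma partial_y_pow_partial_x_pow:
  assumes U: "open U" and f: "smooth_on U f" and p: "p \<in> U"
  shows "(partial_y ^^ b) ((partial_x ^^ k) f) p = (partial_x ^^ k) ((partial_y ^^ b) f) p"
  using p
proof (induction b arbitrary: p)
  case (Suc b)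
  have "(partial_y ^^ Suc b) ((partial_x ^^ k) f) p = partial_y ((partial_x ^^ k) ((partial_y ^^ b) f)) p"
    using partial_y_cong[OF U Suc.IH Suc.prems] by simp
  also have "\<dots> = (partial_x ^^ k) ((partial_y ^^ Suc b) f) p"
    using partial_y_partial_x_pow[OF U smooth_on_partial_y_pow[OF f, of b] Suc.prems] by simp
  finally show ?case .
qed simp

section \<open>Taylor coefficients of pure derivatives\<close>

lemma partial_x_pow_cong:
  assumes "open U" "\<And>q. q \<in> U \<Longrightarrow> f q = g q" "p \<in> U"
  shows "(partial_x ^^ a) f p = (partial_x ^^ a) g p"
  using assms(3)
proof (induction a arbitrary: p)
  case (Suc a)
  then show ?case using partial_x_cong[OF assms(1) Suc.IH Suc.prems] by simp
qed (use assms in simp)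

text \<open>The factor is (a + k)! / a!, split as k! times a binomial coefficient so that the k! can
  later be pulled out of the sum in \<open>principal_x\<close>. The x-derivatives must first be
  moved past the y-derivatives of \<open>taylor_coeff\<close>.\<close>

lemma taylor_coeff_partial_x_pow:
  assumes U: "open U" and f: "smooth_on U f" and p: "(0, 0) \<in> U"
  shows "taylor_coeff ((partial_x ^^ k) f) a b = fact k * real ((a + k) choose k) * taylor_coeff f (a + k) b"
proof -
  have "(partial_x ^^ a) ((partial_y ^^ b) ((partial_x ^^ k) f)) (0, 0)
      = (partial_x ^^ (a + k)) ((partial_y ^^ b) f) (0, 0)"
    using partial_x_pow_cong[OF U partial_y_pow_partial_x_pow[OF U f, of _ b k] p, where a=a]
    by (simp add: funpow_add)
  then show ?thesis
    by (simp add: taylor_coeff_def binomial_fact field_simps)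
qed

lemma taylor_coeff_partial_y_pow:
  "taylor_coeff ((partial_y ^^ k) f) a b = fact k * real ((b + k) choose k) * taylor_coeff f a (b + k)"
proof -
  have "(partial_y ^^ b) ((partial_y ^^ k) f) = (partial_y ^^ (b + k)) f"
    by (simp add: funpow_add)
  then show ?thesis
    by (simp add: taylor_coeff_def binomial_fact field_simps)
qed

subsection \<open>Van der Corput's lemma\<close>

text \<open>The index k itself is included, so \<open>g (Suc k)\<close> is the derivative of
  \<open>g k\<close>; for k = 1 it controls the variation of the first derivative. Derivatives
  within the interval make a chain restrict to every subinterval.\<close>

abbreviation derivative_chain :: "(nat \<Rightarrow> real \<Rightarrow> real) \<Rightarrow> nat \<Rightarrow> real \<Rightarrow> real \<Rightarrow> bool" where
  "derivative_chain g k a b \<equiv>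
     \<forall>i\<le>k. \<forall>t\<in>{a..b}. (g i has_real_derivative g (Suc i) t) (at t within {a..b})"

lemma cis_has_vector_derivative:
  assumes "(g has_real_derivative g') (at t within S)"
  shows "((\<lambda>t. cis (g t)) has_vector_derivative (\<i> * of_real g' * cis (g t))) (at t within S)"
proof -
  have 1: "((\<lambda>t. \<i> * complex_of_real (g t)) has_vector_derivative (\<i> * of_real g')) (at t within S)"
    using assms by (intro has_vector_derivative_mult_right has_vector_derivative_of_real)
       (simp add: has_real_derivative_iff_has_vector_derivative)
  have 2: "(exp has_field_derivative exp (\<i> * of_real (g t))) (at (\<i> * complex_of_real (g t)) within T)" for T
    by (auto intro!: derivative_eq_intros)
  show ?thesis
    using field_vector_diff_chain_within[OF 1 2] by (simp add: o_def cis_conv_exp)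
qed

text \<open>Integration by parts: the function e^(i g0) / g1 has derivative i e^(i g0) - e^(i g0) q,
  where -q is the derivative of 1 / g1. The boundary terms are at most 1 / A each. The third claim
  evaluates the integral of q, for the case that q has constant sign.\<close>

lemma vdC_first_order:
  fixes g0 g1 g2 :: "real \<Rightarrow> real"
  assumes ab: "a \<le> b"
    and g0: "\<And>t. t \<in> {a..b} \<Longrightarrow> (g0 has_real_derivative g1 t) (at t within {a..b})"
    and g1: "\<And>t. t \<in> {a..b} \<Longrightarrow> (g1 has_real_derivative g2 t) (at t within {a..b})"
    and A: "A > 0" "\<And>t. t \<in> {a..b} \<Longrightarrow> \<bar>g1 t\<bar> \<ge> A"
  defines "q \<equiv> \<lambda>t. g2 t / (g1 t)\<^sup>2"
  shows "(\<lambda>t. cis (g0 t) * of_real (q t)) integrable_on {a..b}"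
    and "norm (integral {a..b} (\<lambda>t. cis (g0 t))) \<le> 2 / A + norm (integral {a..b} (\<lambda>t. cis (g0 t) * of_real (q t)))"
    and "(q has_integral (1 / g1 a - 1 / g1 b)) {a..b}"
proof -
  have nz: "g1 t \<noteq> 0" if "t \<in> {a..b}" for t using A that by fastforce
  have inv: "((\<lambda>t. 1 / g1 t) has_real_derivative - q t) (at t within {a..b})" if "t \<in> {a..b}" for t
    using nz[OF that] by (auto intro!: derivative_eq_intros g1[OF that] simp: q_def power2_eq_square)
  have "((\<lambda>t. - q t) has_integral (1 / g1 b - 1 / g1 a)) {a..b}"
    using fundamental_theorem_of_calculus[OF ab, of "\<lambda>t. 1 / g1 t" "\<lambda>t. - q t"] inv
    by (simp add: has_real_derivative_iff_has_vector_derivative)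
  from has_integral_neg[OF this] show "(q has_integral (1 / g1 a - 1 / g1 b)) {a..b}" by simp
  define h where "h = (\<lambda>t. cis (g0 t) * complex_of_real (1 / g1 t))"
  have h': "(h has_vector_derivative (\<i> * cis (g0 t) - cis (g0 t) * of_real (q t))) (at t within {a..b})"
    if t: "t \<in> {a..b}" for t
  proof -
    have "((\<lambda>t. complex_of_real (1 / g1 t)) has_vector_derivative of_real (- q t)) (at t within {a..b})"
      using inv[OF t] by (intro has_vector_derivative_of_real)
        (simp add: has_real_derivative_iff_has_vector_derivative)
    from has_vector_derivative_mult[OF cis_has_vector_derivative[OF g0[OF t]] this]
    show ?thesis using nz[OF t] by (simp add: h_def field_simps)
  qed
  have H: "((\<lambda>t. \<i> * cis (g0 t) - cis (g0 t) * of_real (q t)) has_integral (h b - h a)) {a..b}"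
    using fundamental_theorem_of_calculus[OF ab h'] .
  have "continuous_on {a..b} g0"
    using g0 by (meson DERIV_continuous continuous_on_eq_continuous_within)
  then have "continuous_on {a..b} (\<lambda>t. cis (g0 t))" by (intro continuous_intros)
  then have I: "(\<lambda>t. cis (g0 t)) integrable_on {a..b}" by (rule integrable_continuous_real)
  then have iI: "((\<lambda>t. \<i> * cis (g0 t)) has_integral (\<i> * integral {a..b} (\<lambda>t. cis (g0 t)))) {a..b}"
    by (intro has_integral_mult_right integrable_integral)
  have Q: "((\<lambda>t. cis (g0 t) * of_real (q t)) has_integral
      (\<i> * integral {a..b} (\<lambda>t. cis (g0 t)) - (h b - h a))) {a..b}"
    using has_integral_diff[OF iI H] by simp
  then show "(\<lambda>t. cis (g0 t) * of_real (q t)) integrable_on {a..b}" by blast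
  have "norm (h t) \<le> 1 / A" if "t \<in> {a..b}" for t
    using A(2)[OF that] A(1) nz[OF that] by (simp add: h_def norm_mult norm_divide field_simps)
  then have hb: "norm (h b) \<le> 1 / A" "norm (h a) \<le> 1 / A" using ab by auto
  have "norm (integral {a..b} (\<lambda>t. cis (g0 t))) = norm (\<i> * integral {a..b} (\<lambda>t. cis (g0 t)))"
    by (simp add: norm_mult)
  also have "\<dots> = norm ((h b - h a) + integral {a..b} (\<lambda>t. cis (g0 t) * of_real (q t)))"
    using integral_unique[OF Q] by simp
  also have "\<dots> \<le> (norm (h b) + norm (h a)) + norm (integral {a..b} (\<lambda>t. cis (g0 t) * of_real (q t)))"
    by (intro norm_triangle_le add_right_mono norm_triangle_ineq4)
  finally show "norm (integral {a..b} (\<lambda>t. cis (g0 t)))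
      \<le> 2 / A + norm (integral {a..b} (\<lambda>t. cis (g0 t) * of_real (q t)))"
    using hb by simp
qed

lemma vdC_first_order_bounded:
  fixes g0 g1 g2 :: "real \<Rightarrow> real"
  assumes ab: "a \<le> b"
    and g0: "\<And>t. t \<in> {a..b} \<Longrightarrow> (g0 has_real_derivative g1 t) (at t within {a..b})"
    and g1: "\<And>t. t \<in> {a..b} \<Longrightarrow> (g1 has_real_derivative g2 t) (at t within {a..b})"
    and A: "A > 0" "\<And>t. t \<in> {a..b} \<Longrightarrow> \<bar>g1 t\<bar> \<ge> A"
    and B: "\<And>t. t \<in> {a..b} \<Longrightarrow> \<bar>g2 t\<bar> \<le> B"
  shows "norm (integral {a..b} (\<lambda>t. cis (g0 t))) \<le> 2 / A + B / A\<^sup>2 * (b - a)"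
proof -
  have "norm (integral {a..b} (\<lambda>t. cis (g0 t) * of_real (g2 t / (g1 t)\<^sup>2))) \<le> integral {a..b} (\<lambda>t. B / A\<^sup>2)"
  proof (rule integral_norm_bound_integral)
    fix t assume t: "t \<in> {a..b}"
    have "A\<^sup>2 \<le> (g1 t)\<^sup>2" using A(2)[OF t] A(1) by (metis abs_le_square_iff abs_of_pos)
    then have "\<bar>g2 t\<bar> / (g1 t)\<^sup>2 \<le> B / A\<^sup>2" using B[OF t] A(1) by (intro frac_le) auto
    then show "norm (cis (g0 t) * of_real (g2 t / (g1 t)\<^sup>2)) \<le> B / A\<^sup>2"
      by (simp add: norm_mult norm_divide norm_power)
  qed (use vdC_first_order(1)[OF ab g0 g1 A] in auto)
  also have "\<dots> = B / A\<^sup>2 * (b - a)" using ab by simp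
  finally show ?thesis using vdC_first_order(2)[OF ab g0 g1 A] by linarith
qed

text \<open>If g2 has constant sign, so has q, and the integral of |q| is a difference of two values
  of 1 / g1. So the bound does not involve the length of the interval.\<close>

lemma vdC_first_order_monotone:
  fixes g0 g1 g2 :: "real \<Rightarrow> real"
  assumes ab: "a \<le> b"
    and g0: "\<And>t. t \<in> {a..b} \<Longrightarrow> (g0 has_real_derivative g1 t) (at t within {a..b})"
    and g1: "\<And>t. t \<in> {a..b} \<Longrightarrow> (g1 has_real_derivative g2 t) (at t within {a..b})"
    and A: "A > 0" "\<And>t. t \<in> {a..b} \<Longrightarrow> \<bar>g1 t\<bar> \<ge> A"
    and sgn: "(\<forall>t\<in>{a..b}. g2 t \<ge> 0) \<or> (\<forall>t\<in>{a..b}. g2 t \<le> 0)"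
  shows "norm (integral {a..b} (\<lambda>t. cis (g0 t))) \<le> 4 / A"
proof -
  define q where "q = (\<lambda>t. g2 t / (g1 t)\<^sup>2)"
  have facts: "(\<lambda>t. cis (g0 t) * complex_of_real (q t)) integrable_on {a..b}"
    "norm (integral {a..b} (\<lambda>t. cis (g0 t))) \<le> 2 / A + norm (integral {a..b} (\<lambda>t. cis (g0 t) * of_real (q t)))"
    "(q has_integral (1 / g1 a - 1 / g1 b)) {a..b}"
    using vdC_first_order[OF ab g0 g1 A] by (simp_all add: q_def)
  obtain s :: real where s: "\<bar>s\<bar> = 1" "\<And>t. t \<in> {a..b} \<Longrightarrow> s * g2 t = \<bar>g2 t\<bar>"
    using sgn by (metis abs_minus abs_of_nonneg abs_of_nonpos abs_one mult_1 mult_minus1)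
  have sq: "s * q t = \<bar>q t\<bar>" if "t \<in> {a..b}" for t
    using s(2)[OF that] by (simp add: q_def abs_divide)
  have I: "((\<lambda>t. \<bar>q t\<bar>) has_integral (s * (1 / g1 a - 1 / g1 b))) {a..b}"
    using has_integral_mult_right[OF facts(3), of s] has_integral_cong[of "{a..b}" "\<lambda>t. s * q t" "\<lambda>t. \<bar>q t\<bar>"] sq by auto
  have "norm (integral {a..b} (\<lambda>t. cis (g0 t) * of_real (q t))) \<le> integral {a..b} (\<lambda>t. \<bar>q t\<bar>)"
  proof (rule integral_norm_bound_integral)
    show "(\<lambda>t. cis (g0 t) * complex_of_real (q t)) integrable_on {a..b}" by (fact facts(1))
  qed (use I in \<open>auto simp: norm_mult\<close>)
  also have "\<dots> = s * (1 / g1 a - 1 / g1 b)" using I by blast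
  also have "\<dots> \<le> \<bar>1 / g1 a - 1 / g1 b\<bar>"
    using s(1) by (metis abs_ge_self abs_mult mult_1)
  also have "\<dots> \<le> \<bar>1 / g1 a\<bar> + \<bar>1 / g1 b\<bar>" by (rule abs_triangle_ineq4)
  also have "\<dots> \<le> 1 / A + 1 / A"
    using A(2)[of a] A(2)[of b] A(1) ab by (intro add_mono) (auto simp: abs_divide intro!: divide_left_mono mult_pos_pos)
  finally show ?thesis using facts(2) by simp
qed

text \<open>In the induction step the interval is cut around a minimiser \<open>c\<close> of \<open>\<bar>g k\<bar>\<close>; since
  \<open>\<bar>g k t\<bar> \<ge> A \<bar>t - c\<bar> / 2\<close>, the cut at distance \<open>A powr (- 1 / (k + 1))\<close> balances the pieces.\<close>

lemma vdC_induct_step: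
  fixes g :: "nat \<Rightarrow> real \<Rightarrow> real"
  assumes k: "k \<ge> 1" and C: "C \<ge> 0"
    and IH: "\<And>a' b' A'. a \<le> a' \<Longrightarrow> a' \<le> b' \<Longrightarrow> b' \<le> b \<Longrightarrow> A' > 0 \<Longrightarrow>
        (\<And>t. t \<in> {a'..b'} \<Longrightarrow> \<bar>g k t\<bar> \<ge> A') \<Longrightarrow>
        norm (integral {a'..b'} (\<lambda>t. cis (g 0 t))) \<le> C * A' powr (- 1 / k)"
    and ab: "a \<le> b" and A: "A > 0"
    and g: "\<And>i t. i \<le> k \<Longrightarrow> t \<in> {a..b} \<Longrightarrow> (g i has_real_derivative g (Suc i) t) (at t within {a..b})"
    and low: "\<And>t. t \<in> {a..b} \<Longrightarrow> \<bar>g (Suc k) t\<bar> \<ge> A"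
  shows "norm (integral {a..b} (\<lambda>t. cis (g 0 t))) \<le> (4 * C + 2) * A powr (- 1 / Suc k)"
proof -
  have cont: "continuous_on {a..b} (g i)" if "i \<le> k" for i
    using g[OF that] by (meson DERIV_continuous continuous_on_eq_continuous_within)
  obtain c where c: "c \<in> {a..b}" "\<And>t. t \<in> {a..b} \<Longrightarrow> \<bar>g k c\<bar> \<le> \<bar>g k t\<bar>"
  proof -
    have "continuous_on {a..b} (\<lambda>t. \<bar>g k t\<bar>)" using cont[of k] by (intro continuous_intros) auto
    then show ?thesis using continuous_attains_inf[of "{a..b}" "\<lambda>t. \<bar>g k t\<bar>"] ab that by auto
  qed
  \<comment> \<open>A growth estimate without a zero of \<open>g k\<close>: since c minimises, |g k
    t - g k c| is at most 2 |g k t|, and the mean value theorem bounds the former from below. This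
    is the origin of the factor 1 / 2.\<close>
  have grow: "A * \<bar>t - c\<bar> / 2 \<le> \<bar>g k t\<bar>" if t: "t \<in> {a..b}" for t
  proof -
    have lip: "A * \<bar>v - u\<bar> \<le> \<bar>g k v - g k u\<bar>" if uv: "u \<in> {a..b}" "v \<in> {a..b}" "u < v" for u v
    proof -
      have "\<exists>x\<in>{u<..<v}. g k v - g k u = (v - u) * g (Suc k) x"
      proof -
        have "\<exists>x\<in>{u<..<v}. g k v - g k u = (\<lambda>h. g (Suc k) x * h) (v - u)"
        proof (rule mvt)
          show "continuous_on {u..v} (g k)" using cont[of k] uv by (auto intro: continuous_on_subset)
          fix x assume x: "u < x" "x < v"
          have "(g k has_real_derivative g (Suc k) x) (at x within {a..b})" using g[of k x] x uv by auto
          moreover have "at x within {a..b} = at x" using x uv by (intro at_within_interior) (auto simp: interior_atLeastAtMost_real)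
          ultimately show "(g k has_derivative (\<lambda>h. g (Suc k) x * h)) (at x)"
            by (simp add: has_field_derivative_def)
        qed (use uv in auto)
        then show ?thesis by (auto simp: mult.commute)
      qed
      then obtain x where x: "x \<in> {u<..<v}" "g k v - g k u = (v - u) * g (Suc k) x" by blast
      have "A \<le> \<bar>g (Suc k) x\<bar>" using low[of x] x uv by auto
      then show ?thesis using x uv by (simp add: abs_mult mult.commute mult_left_mono)
    qed
    have "A * \<bar>t - c\<bar> \<le> \<bar>g k t - g k c\<bar>"
      using lip[of t c] lip[of c t] c(1) t by (cases t c rule: linorder_cases) (auto simp: abs_minus_commute)
    also have "\<dots> \<le> 2 * \<bar>g k t\<bar>" using c(2)[OF t] by linarith
    finally show ?thesis by simp
  qed
  define \<delta> where "\<delta> = A powr (- 1 / Suc k)"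
  have \<delta>: "\<delta> > 0" using A by (simp add: \<delta>_def)
  \<comment> \<open>The equation that determines \<delta>: with A \<delta> as lower bound for the
    k-th derivative, an outer piece costs the same power of A as the length \<delta> of the middle
    piece.\<close>
  have "(A * \<delta>) powr (- 1 / k) = \<delta>"
  proof -
    have "A * \<delta> = A powr (1 + - 1 / Suc k)" using A powr_mult_base[of A "- 1 / Suc k"] by (simp add: \<delta>_def)
    moreover have "(1 + - 1 / Suc k) * (- 1 / k) = - 1 / Suc k" using k by (simp add: field_simps)
    ultimately show ?thesis using A by (simp add: powr_powr \<delta>_def del: of_nat_Suc)
  qed
  moreover have "(1 / 2) powr (- 1 / k) \<le> (2 :: real)"
  proof -
    have "(1 / 2 :: real) powr (- 1 / k) = 2 powr (1 / k)" by (simp add: powr_divide powr_minus_divide)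
    also have "\<dots> \<le> 2 powr 1" using k by (intro powr_mono) auto
    finally show ?thesis by simp
  qed
  ultimately have bal: "(A * \<delta> / 2) powr (- 1 / k) \<le> 2 * \<delta>"
    using A \<delta> powr_mult[of "A * \<delta>" "1/2" "- 1 / k"] by (simp add: mult.commute)
  let ?I = "\<lambda>u v. integral {u..v} (\<lambda>t. cis (g 0 t))"
  \<comment> \<open>If c is close to an endpoint of the interval, a piece shrinks to a point; the
    distance condition is therefore demanded only when u < v.\<close>
  have outer: "norm (?I u v) \<le> C * (2 * \<delta>)" if uv: "a \<le> u" "u \<le> v" "v \<le> b" and far: "u < v \<Longrightarrow> \<forall>t\<in>{u..v}. \<bar>t - c\<bar> \<ge> \<delta>" for u v
  proof (cases "u < v")
    case True
    have "\<bar>g k t\<bar> \<ge> A * \<delta> / 2" if t: "t \<in> {u..v}" for t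
    proof -
      have "A * \<delta> \<le> A * \<bar>t - c\<bar>" using far[OF True] t A by (intro mult_left_mono) auto
      then show ?thesis using grow[of t] t uv by auto
    qed
    then have "norm (?I u v) \<le> C * (A * \<delta> / 2) powr (- 1 / k)"
      using A \<delta> uv by (intro IH) auto
    also have "\<dots> \<le> C * (2 * \<delta>)" using bal C by (intro mult_left_mono)
    finally show ?thesis .
  next
    case False
    then have "u = v" using uv by simp
    then show ?thesis using C \<delta> by simp
  qed
  define l u where "l = max a (c - \<delta>)" and "u = min b (c + \<delta>)"
  have lu: "a \<le> l" "l \<le> u" "u \<le> b" "u - l \<le> 2 * \<delta>" using c(1) \<delta> ab by (auto simp: l_def u_def)
  have ci: "(\<lambda>t. cis (g 0 t)) integrable_on {u'..v'}" if "a \<le> u'" "v' \<le> b" for u' v'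
    using cont[of 0] that by (intro integrable_continuous_real continuous_intros) (auto intro: continuous_on_subset)
  have "norm (?I l u) \<le> integral {l..u} (\<lambda>t. 1)"
    using lu ci by (intro integral_norm_bound_integral) auto
  then have mid: "norm (?I l u) \<le> 2 * \<delta>" using lu by simp
  have "?I a b = ?I a l + (?I l u + ?I u b)"
    using Henstock_Kurzweil_Integration.integral_combine[of a l b "\<lambda>t. cis (g 0 t)"]
      Henstock_Kurzweil_Integration.integral_combine[of l u b "\<lambda>t. cis (g 0 t)"] lu ci by simp
  also have "norm \<dots> \<le> norm (?I a l) + (norm (?I l u) + norm (?I u b))"
    by (intro norm_triangle_le add_left_mono) auto
  also have "\<dots> \<le> C * (2 * \<delta>) + (2 * \<delta> + C * (2 * \<delta>))"
    using lu by (intro add_mono outer mid) (auto simp: l_def u_def split: if_splits)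
  finally show ?thesis by (simp add: \<delta>_def algebra_simps)
qed

text \<open>The constants start with 4 and obey C \<rightarrow> 4 C + 2: two outer pieces with 2 C
  \<delta> each and a middle piece of length at most 2 \<delta>. They depend on k alone.
  Monotonicity of the first derivative is demanded for k = 1 only.\<close>

lemma van_der_Corput:
  assumes "k \<ge> 1"
  shows "\<exists>C\<ge>0. \<forall>a b A (g :: nat \<Rightarrow> real \<Rightarrow> real).
    a \<le> b \<longrightarrow> A > 0 \<longrightarrow>
    derivative_chain g k a b \<longrightarrow>
    (\<forall>t\<in>{a..b}. \<bar>g k t\<bar> \<ge> A) \<longrightarrow>
    (k = 1 \<longrightarrow> (\<forall>t\<in>{a..b}. g 2 t \<ge> 0) \<or> (\<forall>t\<in>{a..b}. g 2 t \<le> 0)) \<longrightarrow>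
    norm (integral {a..b} (\<lambda>t. cis (g 0 t))) \<le> C * A powr (- 1 / k)"
  using assms
proof (induction k rule: dec_induct)
  case base
  show ?case
  proof (intro exI[of _ 4] conjI allI impI)
    fix a b A :: real and g :: "nat \<Rightarrow> real \<Rightarrow> real"
    assume *: "a \<le> b" "A > 0"
      "derivative_chain g 1 a b"
      "\<forall>t\<in>{a..b}. \<bar>g 1 t\<bar> \<ge> A"
      "1 = 1 \<longrightarrow> (\<forall>t\<in>{a..b}. g 2 t \<ge> 0) \<or> (\<forall>t\<in>{a..b}. g 2 t \<le> 0)"
    have "norm (integral {a..b} (\<lambda>t. cis (g 0 t))) \<le> 4 / A"
      using * by (intro vdC_first_order_monotone[where ?g1.0="g 1" and ?g2.0="g 2"]) (auto simp: numeral_2_eq_2)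
    then show "norm (integral {a..b} (\<lambda>t. cis (g 0 t))) \<le> 4 * A powr (- 1 / real 1)"
      using \<open>A > 0\<close> by (simp add: powr_minus_divide)
  qed simp
next
  case (step k)
  then obtain C where C: "C \<ge> 0" and IH: "\<And>a b A (g :: nat \<Rightarrow> real \<Rightarrow> real).
    a \<le> b \<Longrightarrow> A > 0 \<Longrightarrow>
    derivative_chain g k a b \<Longrightarrow>
    (\<forall>t\<in>{a..b}. \<bar>g k t\<bar> \<ge> A) \<Longrightarrow>
    (k = 1 \<longrightarrow> (\<forall>t\<in>{a..b}. g 2 t \<ge> 0) \<or> (\<forall>t\<in>{a..b}. g 2 t \<le> 0)) \<Longrightarrow>
    norm (integral {a..b} (\<lambda>t. cis (g 0 t))) \<le> C * A powr (- 1 / k)"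
    by blast
  show ?case
  proof (intro exI[of _ "4 * C + 2"] conjI allI impI)
    fix a b A :: real and g :: "nat \<Rightarrow> real \<Rightarrow> real"
    assume *: "a \<le> b" "A > 0"
      "derivative_chain g (Suc k) a b"
      "\<forall>t\<in>{a..b}. \<bar>g (Suc k) t\<bar> \<ge> A"
    have cont: "continuous_on {a..b} (g (Suc k))"
      using *(3) by (meson DERIV_continuous continuous_on_eq_continuous_within order_refl)
    \<comment> \<open>A continuous function bounded away from 0 has constant sign. In the step from
      k = 1 to k = 2 this supplies the monotonicity that the induction hypothesis demands.\<close>
    have sgn: "(\<forall>t\<in>{a..b}. g (Suc k) t \<ge> 0) \<or> (\<forall>t\<in>{a..b}. g (Suc k) t \<le> 0)"
    proof (rule ccontr)
      assume "\<not> ?thesis"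
      then obtain s t where st: "s \<in> {a..b}" "t \<in> {a..b}" "g (Suc k) s \<le> 0" "g (Suc k) t \<ge> 0" by force
      have "connected (g (Suc k) ` {a..b})" using cont by (intro connected_continuous_image) auto
      then have "0 \<in> g (Suc k) ` {a..b}" using st unfolding connected_iff_interval by blast
      then show False using *(2,4) by fastforce
    qed
    show "norm (integral {a..b} (\<lambda>t. cis (g 0 t))) \<le> (4 * C + 2) * A powr (- 1 / real (Suc k))"
    proof (rule vdC_induct_step)
      fix a' b' A' :: real
      assume h: "a \<le> a'" "a' \<le> b'" "b' \<le> b" "A' > 0" "\<And>t. t \<in> {a'..b'} \<Longrightarrow> \<bar>g k t\<bar> \<ge> A'"
      have sub: "{a'..b'} \<subseteq> {a..b}" using h by auto
      show "norm (integral {a'..b'} (\<lambda>t. cis (g 0 t))) \<le> C * A' powr (- 1 / k)"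
      proof (rule IH)
        show "derivative_chain g k a' b'"
        proof (intro allI impI ballI)
          fix i t assume it: "i \<le> k" "t \<in> {a'..b'}"
          then have "(g i has_real_derivative g (Suc i) t) (at t within {a..b})" using *(3) sub by auto
          then show "(g i has_real_derivative g (Suc i) t) (at t within {a'..b'})"
            using sub by (rule has_field_derivative_subset)
        qed
        show "k = 1 \<longrightarrow> (\<forall>t\<in>{a'..b'}. g 2 t \<ge> 0) \<or> (\<forall>t\<in>{a'..b'}. g 2 t \<le> 0)"
          using sgn sub by (auto simp: numeral_2_eq_2)
      qed (use h in auto)
    qed (use * C step in auto)
  qed (use C in auto)
qed

text \<open>Integration by parts against the primitive of E that vanishes at a, so D has to bound
  the integrals over all initial intervals. The 1 comes from the boundary term at b, the length from
  the integral with \<psi>'.\<close>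

lemma oscillatory_integral_amplitude:
  assumes ab: "a \<le> b" and D: "\<And>t. t \<in> {a..b} \<Longrightarrow> norm (integral {a..t} E) \<le> D"
    and E: "continuous_on {a..b} E"
    and \<psi>: "\<And>t. t \<in> {a..b} \<Longrightarrow> (\<psi> has_real_derivative \<psi>' t) (at t within {a..b})"
    and M: "\<And>t. t \<in> {a..b} \<Longrightarrow> \<bar>\<psi> t\<bar> \<le> M" "\<And>t. t \<in> {a..b} \<Longrightarrow> \<bar>\<psi>' t\<bar> \<le> M"
  shows "norm (integral {a..b} (\<lambda>t. E t * complex_of_real (\<psi> t))) \<le> D * M * (1 + (b - a))"
proof -
  define G where "G = (\<lambda>t. integral {a..t} E)"
  have D0: "D \<ge> 0" using D[of a] ab by simp
  have "((\<lambda>t. G t * complex_of_real (\<psi> t)) has_vector_derivative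
      (G t * of_real (\<psi>' t) + E t * of_real (\<psi> t))) (at t within {a..b})" if t: "t \<in> {a..b}" for t
    unfolding G_def using \<psi>[OF t]
    by (intro has_vector_derivative_mult integral_has_vector_derivative E t has_vector_derivative_of_real)
       (simp add: has_real_derivative_iff_has_vector_derivative)
  from fundamental_theorem_of_calculus[OF ab this]
  have H: "((\<lambda>t. G t * of_real (\<psi>' t) + E t * of_real (\<psi> t)) has_integral (G b * of_real (\<psi> b))) {a..b}"
    by (simp add: G_def)
  have "continuous_on {a..b} \<psi>"
    using \<psi> by (meson DERIV_continuous continuous_on_eq_continuous_within)
  then have I: "(\<lambda>t. E t * of_real (\<psi> t)) integrable_on {a..b}"
    using E by (intro integrable_continuous_real continuous_intros)
  have J: "((\<lambda>t. G t * of_real (\<psi>' t)) has_integral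
      (G b * of_real (\<psi> b) - integral {a..b} (\<lambda>t. E t * of_real (\<psi> t)))) {a..b}"
    using has_integral_diff[OF H integrable_integral[OF I]] by simp
  have "norm (integral {a..b} (\<lambda>t. G t * of_real (\<psi>' t))) \<le> integral {a..b} (\<lambda>t. D * M)"
    using J D M D0 by (intro integral_norm_bound_integral) (auto simp: norm_mult G_def intro!: mult_mono)
  moreover have "norm (G b * complex_of_real (\<psi> b)) \<le> D * M"
    using D[of b] M(1)[of b] ab D0 by (auto simp: norm_mult G_def intro!: mult_mono)
  moreover have "norm (integral {a..b} (\<lambda>t. E t * of_real (\<psi> t))) \<le> norm (G b * complex_of_real (\<psi> b))
      + norm (integral {a..b} (\<lambda>t. G t * of_real (\<psi>' t)))"
    using integral_unique[OF J] norm_triangle_ineq4[of "G b * complex_of_real (\<psi> b)" "integral {a..b} (\<lambda>t. G t * of_real (\<psi>' t))"] by simp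
  ultimately show ?thesis using ab by (simp add: algebra_simps)
qed

text \<open>The frequency \<mu> is separated from the phase, so that c and B, and with them C, can
  be chosen once for a whole family of phases. The intervals lie in [-1, 1] because all rectangles
  will lie in the unit square.\<close>

definition vdC_constant :: "nat \<Rightarrow> real \<Rightarrow> real \<Rightarrow> real \<Rightarrow> bool" where
  "vdC_constant k c B C \<longleftrightarrow> (\<forall>a b \<mu> M (g :: nat \<Rightarrow> real \<Rightarrow> real) \<psi> \<psi>'.
    -1 \<le> a \<longrightarrow> a \<le> b \<longrightarrow> b \<le> 1 \<longrightarrow> \<mu> > 0 \<longrightarrow>
    derivative_chain g k a b \<longrightarrow>
    (\<forall>t\<in>{a..b}. \<bar>g k t\<bar> \<ge> c) \<longrightarrow> (\<forall>t\<in>{a..b}. \<bar>g (Suc k) t\<bar> \<le> B) \<longrightarrow>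
    (\<forall>t\<in>{a..b}. (\<psi> has_real_derivative \<psi>' t) (at t within {a..b})) \<longrightarrow>
    (\<forall>t\<in>{a..b}. \<bar>\<psi> t\<bar> \<le> M \<and> \<bar>\<psi>' t\<bar> \<le> M) \<longrightarrow>
    norm (integral {a..b} (\<lambda>t. cis (\<mu> * g 0 t) * complex_of_real (\<psi> t))) \<le> C * M * \<mu> powr (- 1 / k))"

text \<open>For \<open>k = 1\<close> no monotonicity is available and the bound on the second derivative replaces it.\<close>

lemma vdC_with_amplitude:
  assumes k: "k \<ge> 1" and c: "c > 0"
  shows "\<exists>C\<ge>0. vdC_constant k c B C"
proof -
  have "\<exists>C\<ge>0. \<forall>a b \<mu> (g :: nat \<Rightarrow> real \<Rightarrow> real).
    -1 \<le> a \<longrightarrow> a \<le> b \<longrightarrow> b \<le> 1 \<longrightarrow> \<mu> > 0 \<longrightarrow>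
    derivative_chain g k a b \<longrightarrow>
    (\<forall>t\<in>{a..b}. \<bar>g k t\<bar> \<ge> c) \<longrightarrow> (\<forall>t\<in>{a..b}. \<bar>g (Suc k) t\<bar> \<le> B) \<longrightarrow>
    norm (integral {a..b} (\<lambda>t. cis (\<mu> * g 0 t))) \<le> C * \<mu> powr (- 1 / k)"
  proof (cases "k = 1")
    case True
    show ?thesis
    \<comment> \<open>The bound of \<open>vdC_first_order_bounded\<close> with A = \<mu> c and
      second derivative at most \<mu> |B|; the factor 2 is the greatest length of an interval in
      [-1, 1].\<close>
    proof (intro exI[of _ "2 / c + \<bar>B\<bar> / c\<^sup>2 * 2"] conjI allI impI)
      fix a b \<mu> :: real and g :: "nat \<Rightarrow> real \<Rightarrow> real"
      assume *: "-1 \<le> a" "a \<le> b" "b \<le> 1" "\<mu> > 0"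
        "derivative_chain g k a b"
        "\<forall>t\<in>{a..b}. \<bar>g k t\<bar> \<ge> c" "\<forall>t\<in>{a..b}. \<bar>g (Suc k) t\<bar> \<le> B"
      have "norm (integral {a..b} (\<lambda>t. cis (\<mu> * g 0 t))) \<le> 2 / (\<mu> * c) + (\<mu> * \<bar>B\<bar>) / (\<mu> * c)\<^sup>2 * (b - a)"
      proof (rule vdC_first_order_bounded[where ?g1.0="\<lambda>t. \<mu> * g 1 t" and ?g2.0="\<lambda>t. \<mu> * g 2 t"])
        fix t assume t: "t \<in> {a..b}"
        show "((\<lambda>t. \<mu> * g 0 t) has_real_derivative \<mu> * g 1 t) (at t within {a..b})"
          using *(5) t True by (auto intro!: DERIV_cmult)
        show "((\<lambda>t. \<mu> * g 1 t) has_real_derivative \<mu> * g 2 t) (at t within {a..b})"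
          using *(5) t True by (auto intro!: DERIV_cmult simp: numeral_2_eq_2)
        show "\<mu> * c \<le> \<bar>\<mu> * g 1 t\<bar>" using *(4,6) t True by (auto simp: abs_mult)
        have "\<bar>g 2 t\<bar> \<le> \<bar>B\<bar>" using *(7) t True abs_ge_self[of B] by (auto simp: numeral_2_eq_2 intro: order_trans)
        then show "\<bar>\<mu> * g 2 t\<bar> \<le> \<mu> * \<bar>B\<bar>" using *(4) by (auto simp: abs_mult)
      qed (use * c in auto)
      also have "\<dots> \<le> 2 / (\<mu> * c) + (\<mu> * \<bar>B\<bar>) / (\<mu> * c)\<^sup>2 * 2"
        using * by (intro add_left_mono mult_left_mono) auto
      also have "\<dots> = (2 / c + \<bar>B\<bar> / c\<^sup>2 * 2) * \<mu> powr (- 1 / k)"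
        using *(4) c True by (simp add: powr_minus_divide field_simps power2_eq_square)
      finally show "norm (integral {a..b} (\<lambda>t. cis (\<mu> * g 0 t))) \<le> (2 / c + \<bar>B\<bar> / c\<^sup>2 * 2) * \<mu> powr (- 1 / k)" .
    qed (use c in auto)
  next
    case False
    obtain C where C: "C \<ge> 0" and vdC: "\<And>a b A (g :: nat \<Rightarrow> real \<Rightarrow> real).
      a \<le> b \<Longrightarrow> A > 0 \<Longrightarrow>
      derivative_chain g k a b \<Longrightarrow>
      (\<forall>t\<in>{a..b}. \<bar>g k t\<bar> \<ge> A) \<Longrightarrow>
      norm (integral {a..b} (\<lambda>t. cis (g 0 t))) \<le> C * A powr (- 1 / k)"
      using van_der_Corput[OF k] False by auto
    show ?thesis
    proof (intro exI[of _ "C * c powr (- 1 / k)"] conjI allI impI)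
      fix a b \<mu> :: real and g :: "nat \<Rightarrow> real \<Rightarrow> real"
      assume *: "-1 \<le> a" "a \<le> b" "b \<le> 1" "\<mu> > 0"
        "derivative_chain g k a b"
        "\<forall>t\<in>{a..b}. \<bar>g k t\<bar> \<ge> c"
      have "norm (integral {a..b} (\<lambda>t. cis (\<mu> * g 0 t))) \<le> C * (\<mu> * c) powr (- 1 / k)"
        using * c by (intro vdC[where g="\<lambda>i t. \<mu> * g i t"]) (auto intro!: DERIV_cmult simp: abs_mult)
      then show "norm (integral {a..b} (\<lambda>t. cis (\<mu> * g 0 t))) \<le> C * c powr (- 1 / k) * \<mu> powr (- 1 / k)"
        using * c by (simp add: powr_mult mult_ac)
    qed (use C in auto)
  qed
  then obtain C where C: "C \<ge> 0" and bound: "\<And>a b \<mu> (g :: nat \<Rightarrow> real \<Rightarrow> real).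
    -1 \<le> a \<Longrightarrow> a \<le> b \<Longrightarrow> b \<le> 1 \<Longrightarrow> \<mu> > 0 \<Longrightarrow>
    derivative_chain g k a b \<Longrightarrow>
    (\<forall>t\<in>{a..b}. \<bar>g k t\<bar> \<ge> c) \<Longrightarrow> (\<forall>t\<in>{a..b}. \<bar>g (Suc k) t\<bar> \<le> B) \<Longrightarrow>
    norm (integral {a..b} (\<lambda>t. cis (\<mu> * g 0 t))) \<le> C * \<mu> powr (- 1 / k)"
    by blast
  show ?thesis
    unfolding vdC_constant_def
  \<comment> \<open>The factor 3 bounds 1 + (b - a) for an interval in [-1, 1].\<close>
  proof (intro exI[of _ "C * 3"] conjI allI impI)
    fix a b \<mu> M :: real and g :: "nat \<Rightarrow> real \<Rightarrow> real" and \<psi> \<psi>' :: "real \<Rightarrow> real"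
    assume *: "-1 \<le> a" "a \<le> b" "b \<le> 1" "\<mu> > 0"
      "derivative_chain g k a b"
      "\<forall>t\<in>{a..b}. \<bar>g k t\<bar> \<ge> c" "\<forall>t\<in>{a..b}. \<bar>g (Suc k) t\<bar> \<le> B"
      "\<forall>t\<in>{a..b}. (\<psi> has_real_derivative \<psi>' t) (at t within {a..b})"
      "\<forall>t\<in>{a..b}. \<bar>\<psi> t\<bar> \<le> M \<and> \<bar>\<psi>' t\<bar> \<le> M"
    have M: "M \<ge> 0" using *(2,9) abs_ge_zero[of "\<psi> a"] by (auto intro: order_trans)
    have g0: "continuous_on {a..b} (g 0)"
      using *(5) by (meson DERIV_continuous continuous_on_eq_continuous_within zero_le)
    have D: "norm (integral {a..t} (\<lambda>t. cis (\<mu> * g 0 t))) \<le> C * \<mu> powr (- 1 / k)" if t: "t \<in> {a..b}" for t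
    proof (rule bound)
      show "derivative_chain g k a t"
      proof (intro allI impI ballI)
        fix i s assume "i \<le> k" "s \<in> {a..t}"
        then have "(g i has_real_derivative g (Suc i) s) (at s within {a..b})" using *(5) t by auto
        then show "(g i has_real_derivative g (Suc i) s) (at s within {a..t})"
          using t by (rule_tac has_field_derivative_subset) auto
      qed
    qed (use * t in auto)
    have "norm (integral {a..b} (\<lambda>t. cis (\<mu> * g 0 t) * complex_of_real (\<psi> t)))
        \<le> (C * \<mu> powr (- 1 / k)) * M * (1 + (b - a))"
      using *(2,8,9) D g0 by (intro oscillatory_integral_amplitude[where \<psi>'=\<psi>']) (auto intro!: continuous_intros)
    also have "\<dots> \<le> (C * \<mu> powr (- 1 / k)) * M * 3"
      using * C M by (intro mult_left_mono) auto
    finally show "norm (integral {a..b} (\<lambda>t. cis (\<mu> * g 0 t) * complex_of_real (\<psi> t)))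
        \<le> C * 3 * M * \<mu> powr (- 1 / k)" by (simp add: mult_ac)
  qed (use C in auto)
qed

subsection \<open>Scaling limits of smooth functions\<close>

definition unit_square :: "(real \<times> real) set" where
  "unit_square = cbox (-1, -1) (1, 1)"

lemma mem_unit_square [simp]: "(x, y) \<in> unit_square \<longleftrightarrow> \<bar>x\<bar> \<le> 1 \<and> \<bar>y\<bar> \<le> 1"
  by (auto simp: unit_square_def cbox_Pair_eq)

lemma compact_unit_square: "compact unit_square"
  by (simp add: unit_square_def)

lemma open_contains_box:
  assumes "open U" "(0, 0) \<in> U"
  shows "\<exists>e>0. e \<le> 1 \<and> (\<forall>x y. \<bar>x\<bar> \<le> e \<longrightarrow> \<bar>y\<bar> \<le> e \<longrightarrow> (x, y) \<in> (U :: (real \<times> real) set))"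
proof -
  obtain d where d: "d > 0" "\<And>q. dist q (0, 0) < d \<Longrightarrow> q \<in> U"
    using assms by (auto simp: open_dist)
  have "(x, y) \<in> U" if "\<bar>x\<bar> \<le> min 1 (d / 3)" "\<bar>y\<bar> \<le> min 1 (d / 3)" for x y
    using that d dist_pair_le[of x y 0 0] by (intro d(2)) auto
  then show ?thesis using d(1) by (intro exI[of _ "min 1 (d / 3)"]) auto
qed

text \<open>Expansion in y first, then of each coefficient, a function on the line y = 0, in x; this
  is the order of derivatives in \<open>taylor_coeff\<close>. Truncating on the square a, b < M
  leaves a remainder with the pure powers |x|^M and |y|^M only, which is what dilations with two
  different rates can handle.\<close>

lemma taylor_square:
  assumes U: "open U" and p: "(0, 0) \<in> U" and g: "smooth_on U g"
  shows "\<exists>e>0. \<exists>C\<ge>0. \<forall>x y. \<bar>x\<bar> \<le> e \<longrightarrow> \<bar>y\<bar> \<le> e \<longrightarrow>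
    \<bar>g (x, y) - (\<Sum>b<M. \<Sum>a<M. taylor_coeff g a b * x ^ a * y ^ b)\<bar> \<le> C * (\<bar>x\<bar> ^ M + \<bar>y\<bar> ^ M)"
proof -
  obtain e where e: "e > 0" "e \<le> 1" and box: "\<And>x y. \<bar>x\<bar> \<le> e \<Longrightarrow> \<bar>y\<bar> \<le> e \<Longrightarrow> (x, y) \<in> U"
    using open_contains_box[OF U p] by blast
  have bounded: "\<exists>K\<ge>0. \<forall>x y. \<bar>x\<bar> \<le> e \<longrightarrow> \<bar>y\<bar> \<le> e \<longrightarrow> \<bar>h (x, y)\<bar> \<le> K" if "smooth_on U h" for h
  proof -
    have sub: "cbox (-e, -e) (e, e) \<subseteq> U" using box by (auto simp: cbox_Pair_eq)
    have "compact (h ` cbox (-e, -e) (e, e))"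
      using smooth_on_continuous[OF that] sub by (intro compact_continuous_image) (auto intro: continuous_on_subset)
    then obtain K where K: "K > 0" "\<And>v. v \<in> h ` cbox (-e, -e) (e, e) \<Longrightarrow> norm v \<le> K"
      using compact_imp_bounded bounded_pos by metis
    have "\<bar>h (x, y)\<bar> \<le> K" if "\<bar>x\<bar> \<le> e" "\<bar>y\<bar> \<le> e" for x y
    proof -
      have "(x, y) \<in> cbox (-e, -e) (e, e)" using that by (auto simp: cbox_Pair_eq)
      then show ?thesis using K(2)[of "h (x, y)"] by auto
    qed
    then show ?thesis using K(1) by (intro exI[of _ K]) auto
  qed
  let ?Y = "\<lambda>b. (partial_y ^^ b) g" and ?X = "\<lambda>a b. (partial_x ^^ a) ((partial_y ^^ b) g)"
  note sy = smooth_on_partial_y_pow[OF g]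
  note sx = smooth_on_partial_x_pow[OF sy]
  obtain K where K: "K \<ge> 0" "\<And>x y. \<bar>x\<bar> \<le> e \<Longrightarrow> \<bar>y\<bar> \<le> e \<Longrightarrow> \<bar>?Y M (x, y)\<bar> \<le> K"
    using bounded[OF sy] by blast
  have "\<forall>b. \<exists>K\<ge>0. \<forall>x y. \<bar>x\<bar> \<le> e \<longrightarrow> \<bar>y\<bar> \<le> e \<longrightarrow> \<bar>?X M b (x, y)\<bar> \<le> K"
    using bounded[OF sx] by blast
  then obtain L where L: "\<And>b. L b \<ge> 0" "\<And>b x y. \<bar>x\<bar> \<le> e \<Longrightarrow> \<bar>y\<bar> \<le> e \<Longrightarrow> \<bar>?X M b (x, y)\<bar> \<le> L b"
    by metis
  define C where "C = K + (\<Sum>b<M. L b)"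
  have "\<bar>g (x, y) - (\<Sum>b<M. \<Sum>a<M. taylor_coeff g a b * x ^ a * y ^ b)\<bar> \<le> C * (\<bar>x\<bar> ^ M + \<bar>y\<bar> ^ M)"
    if xy: "\<bar>x\<bar> \<le> e" "\<bar>y\<bar> \<le> e" for x y
  proof -
    have "\<exists>t. \<bar>t\<bar> \<le> \<bar>y\<bar> \<and> g (x, y) = (\<Sum>m<M. ?Y m (x, 0) / fact m * y ^ m) + ?Y M (x, t) / fact M * y ^ M"
    proof (rule Maclaurin_bi_le[where diff="\<lambda>m t. ?Y m (x, t)"])
      show "\<forall>m t. m < M \<and> \<bar>t\<bar> \<le> \<bar>y\<bar> \<longrightarrow> ((\<lambda>t. ?Y m (x, t)) has_real_derivative ?Y (Suc m) (x, t)) (at t)"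
        using xy box partial_y_has_real_derivative[OF sy] by auto
    qed auto
    then obtain t where t: "\<bar>t\<bar> \<le> \<bar>y\<bar>"
      and gt: "g (x, y) = (\<Sum>m<M. ?Y m (x, 0) / fact m * y ^ m) + ?Y M (x, t) / fact M * y ^ M" by blast
    have "\<forall>b. \<exists>s. \<bar>s\<bar> \<le> \<bar>x\<bar> \<and> ?Y b (x, 0) = (\<Sum>m<M. ?X m b (0, 0) / fact m * x ^ m) + ?X M b (s, 0) / fact M * x ^ M"
    proof
      fix b
      show "\<exists>s. \<bar>s\<bar> \<le> \<bar>x\<bar> \<and> ?Y b (x, 0) = (\<Sum>m<M. ?X m b (0, 0) / fact m * x ^ m) + ?X M b (s, 0) / fact M * x ^ M"
      proof (rule Maclaurin_bi_le[where diff="\<lambda>m t. ?X m b (t, 0)"])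
        show "\<forall>m t. m < M \<and> \<bar>t\<bar> \<le> \<bar>x\<bar> \<longrightarrow> ((\<lambda>t. ?X m b (t, 0)) has_real_derivative ?X (Suc m) b (t, 0)) (at t)"
          using xy e box partial_x_has_real_derivative[OF sx] by auto
      qed auto
    qed
    from choice[OF this] obtain s where sY: "\<forall>b. \<bar>s b\<bar> \<le> \<bar>x\<bar> \<and>
      ?Y b (x, 0) = (\<Sum>m<M. ?X m b (0, 0) / fact m * x ^ m) + ?X M b (s b, 0) / fact M * x ^ M" ..
    then have s: "\<bar>s b\<bar> \<le> \<bar>x\<bar>"
      and Ys: "?Y b (x, 0) = (\<Sum>m<M. ?X m b (0, 0) / fact m * x ^ m) + ?X M b (s b, 0) / fact M * x ^ M" for b
      by blast+
    have "g (x, y) - (\<Sum>b<M. \<Sum>a<M. taylor_coeff g a b * x ^ a * y ^ b)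
        = (\<Sum>b<M. ?X M b (s b, 0) / fact M * x ^ M / fact b * y ^ b) + ?Y M (x, t) / fact M * y ^ M"
    proof -
      have "?Y b (x, 0) / fact b * y ^ b = (\<Sum>a<M. taylor_coeff g a b * x ^ a * y ^ b)
          + ?X M b (s b, 0) / fact M * x ^ M / fact b * y ^ b" for b
        unfolding Ys by (simp only: add_divide_distrib distrib_right sum_divide_distrib sum_distrib_right)
          (simp add: taylor_coeff_def)
      then have "(\<Sum>b<M. ?Y b (x, 0) / fact b * y ^ b) = (\<Sum>b<M. \<Sum>a<M. taylor_coeff g a b * x ^ a * y ^ b)
          + (\<Sum>b<M. ?X M b (s b, 0) / fact M * x ^ M / fact b * y ^ b)"
        by (simp only: sum.distrib)
      then show ?thesis unfolding gt by linarith
    qed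
    also have "\<bar>\<dots>\<bar> \<le> (\<Sum>b<M. L b * \<bar>x\<bar> ^ M) + K * \<bar>y\<bar> ^ M"
    proof (rule order_trans[OF abs_triangle_ineq], rule add_mono)
      have "\<bar>\<Sum>b<M. ?X M b (s b, 0) / fact M * x ^ M / fact b * y ^ b\<bar>
          \<le> (\<Sum>b<M. \<bar>?X M b (s b, 0) / fact M * x ^ M / fact b * y ^ b\<bar>)" by (rule sum_abs)
      also have "\<dots> \<le> (\<Sum>b<M. L b * \<bar>x\<bar> ^ M)"
      proof (rule sum_mono)
        fix b
        have "\<bar>?X M b (s b, 0)\<bar> \<le> L b" using L(2) s[of b] xy e by auto
        moreover have "\<bar>y\<bar> ^ b \<le> 1" using xy e by (intro power_le_one) auto
        moreover have "1 \<le> (fact M * fact b :: real)" by (metis fact_ge_1 mult_ge1_I)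
        ultimately have "\<bar>?X M b (s b, 0)\<bar> * \<bar>y\<bar> ^ b / (fact M * fact b) \<le> L b * 1 / 1"
          using L(1) by (intro frac_le mult_mono) auto
        then have "\<bar>?X M b (s b, 0)\<bar> * \<bar>y\<bar> ^ b / (fact M * fact b) * \<bar>x\<bar> ^ M \<le> L b * 1 / 1 * \<bar>x\<bar> ^ M"
          by (intro mult_right_mono) auto
        then show "\<bar>?X M b (s b, 0) / fact M * x ^ M / fact b * y ^ b\<bar> \<le> L b * \<bar>x\<bar> ^ M"
          by (simp add: abs_mult power_abs mult_ac)
      qed
      finally show "\<bar>\<Sum>b<M. ?X M b (s b, 0) / fact M * x ^ M / fact b * y ^ b\<bar> \<le> (\<Sum>b<M. L b * \<bar>x\<bar> ^ M)" .
      have "\<bar>?Y M (x, t)\<bar> / fact M \<le> K / 1"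
        using K t xy fact_ge_1[of M, where 'a=real] by (intro frac_le) auto
      then have "\<bar>?Y M (x, t)\<bar> / fact M * \<bar>y\<bar> ^ M \<le> K / 1 * \<bar>y\<bar> ^ M" by (intro mult_right_mono) auto
      then show "\<bar>?Y M (x, t) / fact M * y ^ M\<bar> \<le> K * \<bar>y\<bar> ^ M" by (simp add: abs_mult power_abs)
    qed
    also have "\<dots> \<le> C * (\<bar>x\<bar> ^ M + \<bar>y\<bar> ^ M)"
    proof -
      have "(\<Sum>b<M. L b) \<ge> 0" using L(1) by (intro sum_nonneg) auto
      then show ?thesis using K(1) by (simp add: C_def sum_distrib_right[symmetric] algebra_simps)
    qed
    finally show ?thesis .
  qed
  moreover have "C \<ge> 0" using K(1) L(1) by (auto simp: C_def intro!: add_nonneg_nonneg sum_nonneg)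
  ultimately show ?thesis using e(1) by blast
qed

text \<open>Under the dilation the monomial x^a y^b acquires the factor (\<rho> \<alpha>^a
  \<beta>^b)^j. Where the base is below 1 the term dies, where it is 1 the term survives, and the
  hypothesis on the coefficients excludes larger values. A free \<rho> allows the same statement to
  serve all pure derivatives.\<close>

lemma scaling_limit:
  fixes \<alpha> \<beta> \<rho> :: real
  assumes U: "open U" and p: "(0, 0) \<in> U" and g: "smooth_on U g"
    and \<alpha>: "0 < \<alpha>" "\<alpha> < 1" and \<beta>: "0 < \<beta>" "\<beta> < 1" and \<rho>: "\<rho> > 0"
    and le1: "\<And>a b. taylor_coeff g a b \<noteq> 0 \<Longrightarrow> \<rho> * \<alpha> ^ a * \<beta> ^ b \<le> 1"
  shows "uniform_limit unit_square (\<lambda>j (x, y). \<rho> ^ j * g (\<alpha> ^ j * x, \<beta> ^ j * y))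
    (\<lambda>(x, y). \<Sum>(a, b) | \<rho> * \<alpha> ^ a * \<beta> ^ b = 1. taylor_coeff g a b * x ^ a * y ^ b) sequentially"
proof -
  \<comment> \<open>M is so large that the Taylor remainder dies as well. It then follows that every
    exponent of weight 1 lies in the truncation square.\<close>
  obtain M where M: "\<rho> * \<alpha> ^ M < 1" "\<rho> * \<beta> ^ M < 1"
  proof -
    have "eventually (\<lambda>n. \<alpha> ^ n < 1 / \<rho>) sequentially" "eventually (\<lambda>n. \<beta> ^ n < 1 / \<rho>) sequentially"
      using order_tendstoD(2)[OF LIMSEQ_power_zero[of \<alpha>], of "1 / \<rho>"] order_tendstoD(2)[OF LIMSEQ_power_zero[of \<beta>], of "1 / \<rho>"]
        \<alpha> \<beta> \<rho> by auto
    then have "eventually (\<lambda>n. \<alpha> ^ n < 1 / \<rho> \<and> \<beta> ^ n < 1 / \<rho>) sequentially" by (rule eventually_conj)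
    then obtain n where "\<alpha> ^ n < 1 / \<rho>" "\<beta> ^ n < 1 / \<rho>" by (auto simp: eventually_sequentially)
    then show ?thesis using \<rho> by (intro that[of n]) (auto simp: field_simps)
  qed
  obtain e C where e: "e > 0" and C: "C \<ge> 0" and T: "\<And>x y. \<bar>x\<bar> \<le> e \<Longrightarrow> \<bar>y\<bar> \<le> e \<Longrightarrow>
    \<bar>g (x, y) - (\<Sum>b<M. \<Sum>a<M. taylor_coeff g a b * x ^ a * y ^ b)\<bar> \<le> C * (\<bar>x\<bar> ^ M + \<bar>y\<bar> ^ M)"
    using taylor_square[OF U p g, of M] by blast
  define w where "w = (\<lambda>a b. \<rho> * \<alpha> ^ a * \<beta> ^ b)"
  define i where "i = (\<lambda>a b. if w a b = 1 then 1 else 0 :: real)"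
  have w0: "w a b > 0" for a b using \<alpha> \<beta> \<rho> by (simp add: w_def)
  define err where "err = (\<lambda>j. C * ((\<rho> * \<alpha> ^ M) ^ j + (\<rho> * \<beta> ^ M) ^ j)
      + (\<Sum>b<M. \<Sum>a<M. \<bar>taylor_coeff g a b\<bar> * \<bar>w a b ^ j - i a b\<bar>))"
  have term0: "(\<lambda>j. \<bar>taylor_coeff g a b\<bar> * \<bar>w a b ^ j - i a b\<bar>) \<longlonglongrightarrow> 0" for a b
  proof (cases "taylor_coeff g a b = 0 \<or> w a b = 1")
    case False
    then have "w a b < 1" using le1[of a b] by (auto simp: w_def)
    then have "(\<lambda>j. w a b ^ j) \<longlonglongrightarrow> 0" using w0[of a b] by (intro LIMSEQ_power_zero) auto
    from tendsto_mult[OF tendsto_const tendsto_rabs[OF tendsto_diff[OF this tendsto_const]]]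
    have "(\<lambda>j. \<bar>taylor_coeff g a b\<bar> * \<bar>w a b ^ j - i a b\<bar>) \<longlonglongrightarrow> \<bar>taylor_coeff g a b\<bar> * \<bar>0 - i a b\<bar>" .
    then show ?thesis using False by (simp add: i_def)
  qed (auto simp: i_def)
  have "err \<longlonglongrightarrow> C * (0 + 0) + (\<Sum>b<M. \<Sum>a<M. 0)"
    unfolding err_def using M \<alpha> \<beta> \<rho>
    by (intro tendsto_add tendsto_mult tendsto_const tendsto_sum LIMSEQ_power_zero term0) auto
  then have err0: "err \<longlonglongrightarrow> 0" by simp
  have lim: "(\<Sum>(a, b) | \<rho> * \<alpha> ^ a * \<beta> ^ b = 1. taylor_coeff g a b * x ^ a * y ^ b)
      = (\<Sum>b<M. \<Sum>a<M. taylor_coeff g a b * i a b * x ^ a * y ^ b)" for x y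
  proof -
    have sub: "{(a, b). w a b = 1} \<subseteq> {..<M} \<times> {..<M}"
    proof clarify
      fix a b assume w1: "w a b = 1"
      have "a < M"
      proof (rule ccontr)
        assume "\<not> a < M"
        then have "\<alpha> ^ a * \<beta> ^ b \<le> \<alpha> ^ M * 1" using \<alpha> \<beta> by (intro mult_mono power_decreasing power_le_one) auto
        then have "w a b \<le> \<rho> * \<alpha> ^ M" using \<rho> by (simp add: w_def mult.assoc)
        then show False using M w1 by simp
      qed
      moreover have "b < M"
      proof (rule ccontr)
        assume "\<not> b < M"
        then have "\<alpha> ^ a * \<beta> ^ b \<le> 1 * \<beta> ^ M" using \<alpha> \<beta> by (intro mult_mono power_decreasing power_le_one) auto
        then have "w a b \<le> \<rho> * \<beta> ^ M" using \<rho> by (simp add: w_def mult.assoc)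
        then show False using M w1 by simp
      qed
      ultimately show "a \<in> {..<M} \<and> b \<in> {..<M}" by simp
    qed
    have "(\<Sum>(a, b) | w a b = 1. taylor_coeff g a b * x ^ a * y ^ b)
        = (\<Sum>(a, b) \<in> {..<M} \<times> {..<M}. taylor_coeff g a b * i a b * x ^ a * y ^ b)"
      using sub by (intro sum.mono_neutral_cong_left) (auto simp: i_def)
    also have "\<dots> = (\<Sum>a<M. \<Sum>b<M. taylor_coeff g a b * i a b * x ^ a * y ^ b)"
      by (simp add: sum.cartesian_product)
    also have "\<dots> = (\<Sum>b<M. \<Sum>a<M. taylor_coeff g a b * i a b * x ^ a * y ^ b)"
      by (rule sum.swap)
    finally show ?thesis by (simp add: w_def)
  qed
  have "eventually (\<lambda>n. \<alpha> ^ n < e) sequentially" "eventually (\<lambda>n. \<beta> ^ n < e) sequentially"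
    using order_tendstoD(2)[OF LIMSEQ_power_zero[of \<alpha>] e] order_tendstoD(2)[OF LIMSEQ_power_zero[of \<beta>] e] \<alpha> \<beta> by auto
  then have ev: "eventually (\<lambda>j. \<forall>(x, y) \<in> unit_square.
      \<bar>\<rho> ^ j * g (\<alpha> ^ j * x, \<beta> ^ j * y) - (\<Sum>(a, b) | \<rho> * \<alpha> ^ a * \<beta> ^ b = 1. taylor_coeff g a b * x ^ a * y ^ b)\<bar> \<le> err j) sequentially"
  proof eventually_elim
    case (elim j)
    show ?case
    proof clarify
      fix x y :: real assume xy: "(x, y) \<in> unit_square"
      then have x: "\<bar>x\<bar> \<le> 1" and y: "\<bar>y\<bar> \<le> 1" by auto
      have "\<alpha> ^ j * \<bar>x\<bar> \<le> \<alpha> ^ j * 1" "\<beta> ^ j * \<bar>y\<bar> \<le> \<beta> ^ j * 1" using x y \<alpha> \<beta> by (intro mult_left_mono; simp)+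
      then have b: "\<bar>\<alpha> ^ j * x\<bar> \<le> \<alpha> ^ j" "\<bar>\<beta> ^ j * y\<bar> \<le> \<beta> ^ j" using \<alpha> \<beta> by (auto simp: abs_mult power_abs)
      let ?T = "\<Sum>b<M. \<Sum>a<M. taylor_coeff g a b * (\<alpha> ^ j * x) ^ a * (\<beta> ^ j * y) ^ b"
      let ?L = "\<Sum>b<M. \<Sum>a<M. taylor_coeff g a b * i a b * x ^ a * y ^ b"
      have "\<bar>g (\<alpha> ^ j * x, \<beta> ^ j * y) - ?T\<bar> \<le> C * (\<bar>\<alpha> ^ j * x\<bar> ^ M + \<bar>\<beta> ^ j * y\<bar> ^ M)"
        using b elim by (intro T) auto
      also have "\<dots> \<le> C * ((\<alpha> ^ j) ^ M + (\<beta> ^ j) ^ M)"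
        using b C by (intro mult_left_mono add_mono power_mono) auto
      finally have "\<rho> ^ j * \<bar>g (\<alpha> ^ j * x, \<beta> ^ j * y) - ?T\<bar> \<le> \<rho> ^ j * (C * ((\<alpha> ^ j) ^ M + (\<beta> ^ j) ^ M))"
        using \<rho> by (intro mult_left_mono) auto
      also have "\<dots> = C * ((\<rho> * \<alpha> ^ M) ^ j + (\<rho> * \<beta> ^ M) ^ j)"
        by (simp add: power_mult_distrib power_mult[symmetric] algebra_simps)
      finally have 1: "\<bar>\<rho> ^ j * g (\<alpha> ^ j * x, \<beta> ^ j * y) - \<rho> ^ j * ?T\<bar> \<le> C * ((\<rho> * \<alpha> ^ M) ^ j + (\<rho> * \<beta> ^ M) ^ j)"
        using \<rho> by (simp add: abs_mult right_diff_distrib[symmetric])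
      have "\<rho> ^ j * ?T - ?L = (\<Sum>b<M. \<Sum>a<M. (taylor_coeff g a b * (w a b ^ j - i a b)) * (x ^ a * y ^ b))"
      proof -
        have "\<rho> ^ j * (taylor_coeff g a b * (\<alpha> ^ j * x) ^ a * (\<beta> ^ j * y) ^ b)
            = taylor_coeff g a b * w a b ^ j * (x ^ a * y ^ b)" for a b
          by (simp add: w_def power_mult_distrib power_mult[symmetric] mult_ac)
        then have "\<rho> ^ j * ?T = (\<Sum>b<M. \<Sum>a<M. taylor_coeff g a b * w a b ^ j * (x ^ a * y ^ b))"
          by (simp only: sum_distrib_left)
        then show ?thesis by (simp add: sum_subtractf[symmetric] algebra_simps)
      qed
      also have "\<bar>\<dots>\<bar> \<le> (\<Sum>b<M. \<Sum>a<M. \<bar>taylor_coeff g a b\<bar> * \<bar>w a b ^ j - i a b\<bar>)"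
      proof (rule order_trans[OF sum_abs], rule sum_mono, rule order_trans[OF sum_abs], rule sum_mono)
        fix a b
        have "\<bar>x ^ a * y ^ b\<bar> \<le> 1 * 1" unfolding abs_mult power_abs using x y by (intro mult_mono power_le_one) auto
        then have "\<bar>taylor_coeff g a b * (w a b ^ j - i a b)\<bar> * \<bar>x ^ a * y ^ b\<bar>
            \<le> \<bar>taylor_coeff g a b * (w a b ^ j - i a b)\<bar> * 1"
          by (intro mult_left_mono) auto
        then show "\<bar>taylor_coeff g a b * (w a b ^ j - i a b) * (x ^ a * y ^ b)\<bar>
            \<le> \<bar>taylor_coeff g a b\<bar> * \<bar>w a b ^ j - i a b\<bar>"
          by (simp add: abs_mult)
      qed
      finally show "\<bar>\<rho> ^ j * g (\<alpha> ^ j * x, \<beta> ^ j * y) - (\<Sum>(a, b) | \<rho> * \<alpha> ^ a * \<beta> ^ b = 1. taylor_coeff g a b * x ^ a * y ^ b)\<bar> \<le> err j"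
        using 1 unfolding lim err_def by linarith
    qed
  qed
  show ?thesis
  proof (rule uniform_limitI)
    fix \<epsilon> :: real assume "\<epsilon> > 0"
    then have "eventually (\<lambda>j. err j < \<epsilon>) sequentially" using order_tendstoD(2)[OF err0] by auto
    with ev show "eventually (\<lambda>j. \<forall>q\<in>unit_square. dist
       (case q of (x, y) \<Rightarrow> \<rho> ^ j * g (\<alpha> ^ j * x, \<beta> ^ j * y))
       (case q of (x, y) \<Rightarrow> \<Sum>(a, b) | \<rho> * \<alpha> ^ a * \<beta> ^ b = 1. taylor_coeff g a b * x ^ a * y ^ b) < \<epsilon>) sequentially"
      by eventually_elim (force simp: dist_real_def)
  qed
qed

subsection \<open>The principal part of a phase\<close>

definition weight_line :: "real \<Rightarrow> real \<Rightarrow> (nat \<times> nat) set" where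
  "weight_line \<kappa> \<nu> = {(a, b). \<kappa> * real a + \<nu> * real b = 1}"

text \<open>\<open>principal_x \<kappa> \<nu> S k\<close> and \<open>principal_y \<kappa> \<nu> S k\<close> are the \<open>k\<close>-th pure derivatives, divided by \<open>k!\<close>,
  of the quasi-homogeneous part \<open>\<Sum>s\<^sub>a\<^sub>b x\<^sup>a y\<^sup>b\<close> of \<open>S\<close> over the line \<open>\<kappa> a + \<nu> b = 1\<close>.\<close>

definition principal_x :: "real \<Rightarrow> real \<Rightarrow> (real \<times> real \<Rightarrow> real) \<Rightarrow> nat \<Rightarrow> real \<Rightarrow> real \<Rightarrow> real" where
  "principal_x \<kappa> \<nu> S k x y =
     (\<Sum>(a, b)\<in>weight_line \<kappa> \<nu>. taylor_coeff S a b * real (a choose k) * x ^ (a - k) * y ^ b)"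

definition principal_y :: "real \<Rightarrow> real \<Rightarrow> (real \<times> real \<Rightarrow> real) \<Rightarrow> nat \<Rightarrow> real \<Rightarrow> real \<Rightarrow> real" where
  "principal_y \<kappa> \<nu> S k x y =
     (\<Sum>(a, b)\<in>weight_line \<kappa> \<nu>. taylor_coeff S a b * real (b choose k) * x ^ a * y ^ (b - k))"

lemma finite_weight_line:
  assumes "\<kappa> > 0" "\<nu> > 0"
  shows "finite (weight_line \<kappa> \<nu>)"
proof (rule finite_subset)
  show "weight_line \<kappa> \<nu> \<subseteq> {..nat \<lceil>1 / \<kappa>\<rceil>} \<times> {..nat \<lceil>1 / \<nu>\<rceil>}"
  proof clarify
    fix a b assume "(a, b) \<in> weight_line \<kappa> \<nu>"
    then have *: "\<kappa> * real a + \<nu> * real b = 1" by (simp add: weight_line_def)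
    moreover have "\<kappa> * real a \<ge> 0" "\<nu> * real b \<ge> 0" using assms by auto
    ultimately have "\<kappa> * real a \<le> 1" "\<nu> * real b \<le> 1" by linarith+
    then have "real a \<le> 1 / \<kappa>" "real b \<le> 1 / \<nu>" using assms by (auto simp: field_simps)
    then show "a \<in> {..nat \<lceil>1 / \<kappa>\<rceil>} \<and> b \<in> {..nat \<lceil>1 / \<nu>\<rceil>}" by (simp; linarith)
  qed
qed auto

text \<open>With \<rho> = 2 the multiplicative weight in the scaling limit becomes a power of 2, so
  weight 1 means lying on the line and weight at most 1 lying on or above it.\<close>

lemma dyadic_weight:
  "2 * (2 powr - \<kappa>) ^ a * (2 powr - \<nu>) ^ b = (2 :: real) powr (1 - (\<kappa> * real a + \<nu> * real b))"
proof -
  have "(2 powr - \<kappa>) ^ a = 2 powr (- \<kappa> * real a)" "(2 powr - \<nu>) ^ b = 2 powr (- \<nu> * real b)"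
    by (simp_all add: powr_realpow[symmetric] powr_powr)
  then show ?thesis by (simp add: powr_add[symmetric] powr_mult_base algebra_simps)
qed

text \<open>A k-th x-derivative of the dilate carries 2^j \<alpha>^(k j), hence \<rho> = 2
  \<alpha>^k. Its exponent (a, b) stems from (a + k, b) in \<open>S\<close>, and both have the same
  weight, so the surviving terms are those of the line, differentiated.\<close>

lemma principal_scaling_limit:
  fixes \<kappa> \<nu> :: real
  assumes U: "open U" and p: "(0, 0) \<in> U" and S: "smooth_on U S"
    and \<kappa>: "\<kappa> > 0" and \<nu>: "\<nu> > 0"
    and supp: "\<And>a b. taylor_coeff S a b \<noteq> 0 \<Longrightarrow> \<kappa> * real a + \<nu> * real b \<ge> 1"
  defines "\<alpha> \<equiv> 2 powr - \<kappa>" and "\<beta> \<equiv> 2 powr - \<nu>"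
  shows "uniform_limit unit_square
      (\<lambda>j (x, y). (2 * \<alpha> ^ k) ^ j * (partial_x ^^ k) S (\<alpha> ^ j * x, \<beta> ^ j * y))
      (\<lambda>(x, y). fact k * principal_x \<kappa> \<nu> S k x y) sequentially" (is ?X)
    and "uniform_limit unit_square
      (\<lambda>j (x, y). (2 * \<beta> ^ k) ^ j * (partial_y ^^ k) S (\<alpha> ^ j * x, \<beta> ^ j * y))
      (\<lambda>(x, y). fact k * principal_y \<kappa> \<nu> S k x y) sequentially" (is ?Y)
proof -
  have \<alpha>: "0 < \<alpha>" "\<alpha> < 1" and \<beta>: "0 < \<beta>" "\<beta> < 1" using \<kappa> \<nu> by (auto simp: \<alpha>_def \<beta>_def powr_less_one)
  note fin = finite_weight_line[OF \<kappa> \<nu>]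
  have w: "2 * \<alpha> ^ a * \<beta> ^ b = 1 \<longleftrightarrow> (a, b) \<in> weight_line \<kappa> \<nu>" for a b
    using powr_inj[of 2 "1 - (\<kappa> * real a + \<nu> * real b)" 0]
    by (simp add: \<alpha>_def \<beta>_def dyadic_weight weight_line_def)
  have le: "2 * \<alpha> ^ a * \<beta> ^ b \<le> 1" if "taylor_coeff S a b \<noteq> 0" for a b
    using supp[OF that] powr_mono[of "1 - (\<kappa> * real a + \<nu> * real b)" 0 2]
    by (simp add: \<alpha>_def \<beta>_def dyadic_weight)
  show ?X
  proof -
    have "(\<Sum>(a, b) | (2 * \<alpha> ^ k) * \<alpha> ^ a * \<beta> ^ b = 1. taylor_coeff ((partial_x ^^ k) S) a b * x ^ a * y ^ b)
        = fact k * principal_x \<kappa> \<nu> S k x y" for x y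
    proof -
      have "(\<Sum>(a, b) | (2 * \<alpha> ^ k) * \<alpha> ^ a * \<beta> ^ b = 1. taylor_coeff ((partial_x ^^ k) S) a b * x ^ a * y ^ b)
          = (\<Sum>(a, b) | (a + k, b) \<in> weight_line \<kappa> \<nu>. fact k * (taylor_coeff S (a + k) b * real ((a + k) choose k) * x ^ a * y ^ b))"
        by (intro sum.cong) (auto simp: w[symmetric] power_add mult_ac taylor_coeff_partial_x_pow[OF U S p])
      also have "\<dots> = (\<Sum>(a, b) \<in> {(a, b) \<in> weight_line \<kappa> \<nu>. k \<le> a}. fact k * (taylor_coeff S a b * real (a choose k) * x ^ (a - k) * y ^ b))"
        by (rule sum.reindex_bij_witness[of _ "\<lambda>(a, b). (a - k, b)" "\<lambda>(a, b). (a + k, b)"]) auto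
      \<comment> \<open>Exponents with a < k may be added since \<open>a choose k\<close> is then 0;
        the truncated difference a - k does no harm.\<close>
      also have "\<dots> = (\<Sum>(a, b) \<in> weight_line \<kappa> \<nu>. fact k * (taylor_coeff S a b * real (a choose k) * x ^ (a - k) * y ^ b))"
        using fin by (intro sum.mono_neutral_left) (auto simp: not_le)
      finally show ?thesis by (simp add: principal_x_def sum_distrib_left case_prod_beta)
    qed
    moreover have "2 * \<alpha> ^ k * \<alpha> ^ a * \<beta> ^ b \<le> 1" if "taylor_coeff ((partial_x ^^ k) S) a b \<noteq> 0" for a b
      using that le[of "a + k" b] by (auto simp: power_add mult_ac taylor_coeff_partial_x_pow[OF U S p])
    ultimately show ?thesis
      using scaling_limit[OF U p smooth_on_partial_x_pow[OF S, of k] \<alpha> \<beta>, of "2 * \<alpha> ^ k"] \<alpha> by simp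
  qed
  show ?Y
  proof -
    have "(\<Sum>(a, b) | (2 * \<beta> ^ k) * \<alpha> ^ a * \<beta> ^ b = 1. taylor_coeff ((partial_y ^^ k) S) a b * x ^ a * y ^ b)
        = fact k * principal_y \<kappa> \<nu> S k x y" for x y
    proof -
      have "(\<Sum>(a, b) | (2 * \<beta> ^ k) * \<alpha> ^ a * \<beta> ^ b = 1. taylor_coeff ((partial_y ^^ k) S) a b * x ^ a * y ^ b)
          = (\<Sum>(a, b) | (a, b + k) \<in> weight_line \<kappa> \<nu>. fact k * (taylor_coeff S a (b + k) * real ((b + k) choose k) * x ^ a * y ^ b))"
        by (intro sum.cong) (auto simp: w[symmetric] power_add mult_ac taylor_coeff_partial_y_pow)
      also have "\<dots> = (\<Sum>(a, b) \<in> {(a, b) \<in> weight_line \<kappa> \<nu>. k \<le> b}. fact k * (taylor_coeff S a b * real (b choose k) * x ^ a * y ^ (b - k)))"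
        by (rule sum.reindex_bij_witness[of _ "\<lambda>(a, b). (a, b - k)" "\<lambda>(a, b). (a, b + k)"]) auto
      also have "\<dots> = (\<Sum>(a, b) \<in> weight_line \<kappa> \<nu>. fact k * (taylor_coeff S a b * real (b choose k) * x ^ a * y ^ (b - k)))"
        using fin by (intro sum.mono_neutral_left) (auto simp: not_le)
      finally show ?thesis by (simp add: principal_y_def sum_distrib_left case_prod_beta)
    qed
    moreover have "2 * \<beta> ^ k * \<alpha> ^ a * \<beta> ^ b \<le> 1" if "taylor_coeff ((partial_y ^^ k) S) a b \<noteq> 0" for a b
      using that le[of a "b + k"] by (auto simp: power_add mult_ac taylor_coeff_partial_y_pow)
    ultimately show ?thesis
      using scaling_limit[OF U p smooth_on_partial_y_pow[OF S, of k] \<alpha> \<beta>, of "2 * \<beta> ^ k"] \<beta> by simp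
  qed
qed

subsection \<open>Integrals over rectangles\<close>

text \<open>A non-integrable function has integral 0 by convention, so the estimate holds in any
  case. Inner integrals can thus be bounded pointwise without asking how they depend on the outer
  variable.\<close>

lemma norm_integral_le:
  fixes h :: "real \<Rightarrow> complex"
  assumes "a \<le> b" "\<And>t. t \<in> {a..b} \<Longrightarrow> norm (h t) \<le> D"
  shows "norm (integral {a..b} h) \<le> D * (b - a)"
proof (cases "h integrable_on {a..b}")
  case True
  then have "norm (integral {a..b} h) \<le> integral {a..b} (\<lambda>t. D)"
    using assms by (intro integral_norm_bound_integral) auto
  then show ?thesis using assms(1) by (simp add: mult.commute)
next
  case False
  have "0 \<le> D" using assms(1) order_trans[OF norm_ge_zero assms(2)[of a]] by simp
  then show ?thesis using False assms(1) by (simp add: not_integrable_integral)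
qed

lemma integral_rectangle_yx:
  fixes F :: "real \<times> real \<Rightarrow> complex"
  assumes "continuous_on (cbox (a, c) (b, d)) F"
  shows "integral (cbox (a, c) (b, d)) F = integral {a..b} (\<lambda>x. integral {c..d} (\<lambda>y. F (x, y)))"
  using integral_prod_continuous[OF assms] by simp

lemma integral_rectangle_xy:
  fixes F :: "real \<times> real \<Rightarrow> complex"
  assumes "continuous_on (cbox (a, c) (b, d)) F"
  shows "integral (cbox (a, c) (b, d)) F = integral {c..d} (\<lambda>y. integral {a..b} (\<lambda>x. F (x, y)))"
  using integral_prod_continuous[OF assms] integral_swap_continuous[of a c b d "\<lambda>x y. F (x, y)"] assms by simp

lemma integral_rectangle_split_x:
  fixes F :: "real \<times> real \<Rightarrow> complex"
  assumes F: "continuous_on (cbox (a, c) (b, d)) F" and m: "a \<le> m" "m \<le> b"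
  shows "integral (cbox (a, c) (b, d)) F = integral (cbox (a, c) (m, d)) F + integral (cbox (m, c) (b, d)) F"
proof -
  have F1: "continuous_on (cbox (a, c) (m, d)) F" and F2: "continuous_on (cbox (m, c) (b, d)) F"
    by (rule continuous_on_subset[OF F]; use m in \<open>auto simp: cbox_Pair_eq\<close>)+
  have "continuous_on (cbox a b) (\<lambda>x. integral (cbox c d) (\<lambda>y. F (x, y)))"
    using F by (intro integral_continuous_on_param) (simp add: cbox_Pair_eq case_prod_beta)
  then have "(\<lambda>x. integral {c..d} (\<lambda>y. F (x, y))) integrable_on {a..b}"
    using integrable_continuous_real by simp
  then show ?thesis
    unfolding integral_rectangle_yx[OF F] integral_rectangle_yx[OF F1] integral_rectangle_yx[OF F2]
    using m by (simp add: Henstock_Kurzweil_Integration.integral_combine)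
qed

lemma integral_rectangle_split_y:
  fixes F :: "real \<times> real \<Rightarrow> complex"
  assumes F: "continuous_on (cbox (a, c) (b, d)) F" and m: "c \<le> m" "m \<le> d"
  shows "integral (cbox (a, c) (b, d)) F = integral (cbox (a, c) (b, m)) F + integral (cbox (a, m) (b, d)) F"
proof -
  have F1: "continuous_on (cbox (a, c) (b, m)) F" and F2: "continuous_on (cbox (a, m) (b, d)) F"
    by (rule continuous_on_subset[OF F]; use m in \<open>auto simp: cbox_Pair_eq\<close>)+
  have "continuous_on (cbox c d \<times> cbox a b) (\<lambda>(y, x). F (x, y))"
    unfolding case_prod_beta
    by (rule continuous_on_compose2[OF F]) (auto intro!: continuous_intros simp: cbox_Pair_eq)
  then have "continuous_on (cbox c d) (\<lambda>y. integral (cbox a b) (\<lambda>x. F (x, y)))"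
    by (rule integral_continuous_on_param)
  then have "(\<lambda>y. integral {a..b} (\<lambda>x. F (x, y))) integrable_on {c..d}"
    using integrable_continuous_real by simp
  then show ?thesis
    unfolding integral_rectangle_xy[OF F] integral_rectangle_xy[OF F1] integral_rectangle_xy[OF F2]
    using m by (simp add: Henstock_Kurzweil_Integration.integral_combine)
qed

lemma integral_stretch_symmetric:
  fixes f :: "real \<Rightarrow> complex"
  assumes a: "a > 0" and r: "r \<ge> 0" and f: "continuous_on {- (a * r)..a * r} f"
  shows "integral {- (a * r)..a * r} f = of_real a * integral {-r..r} (\<lambda>t. f (a * t))"
proof -
  have "(f has_integral integral {- (a * r)..a * r} f) {- (a * r)..a * r}"
    using integrable_continuous_real[OF f] by (rule integrable_integral)
  from has_integral_stretch_real[OF this, of a] a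
  have "((\<lambda>x. f (a * x)) has_integral (1 / a) *\<^sub>R integral {- (a * r)..a * r} f) ((\<lambda>x. x / a) ` {- (a * r)..a * r})"
    by simp
  moreover have "(\<lambda>x. x / a) ` {- (a * r)..a * r} = {-r..r}"
  proof -
    have "x \<in> (\<lambda>x. x / a) ` {- (a * r)..a * r}" if "x \<in> {-r..r}" for x
      using that a mult_left_mono[of "-r" x a] by (intro image_eqI[of _ _ "a * x"]) (auto intro: mult_left_mono)
    then show ?thesis using a by (auto simp: field_simps)
  qed
  ultimately have "integral {-r..r} (\<lambda>t. f (a * t)) = (1 / a) *\<^sub>R integral {- (a * r)..a * r} f"
    by (simp add: integral_unique)
  then show ?thesis using a by (simp add: scaleR_conv_of_real)
qed

lemma integral_rectangle_stretch:
  fixes F :: "real \<times> real \<Rightarrow> complex"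
  assumes F: "continuous_on UNIV F" and ab: "a > 0" "b > 0" and rs: "r \<ge> 0" "s \<ge> 0"
  shows "integral (cbox (- (a * r), - (b * s)) (a * r, b * s)) F
    = of_real (a * b) * integral (cbox (-r, -s) (r, s)) (\<lambda>(x, y). F (a * x, b * y))"
proof -
  have F': "continuous_on A (\<lambda>q. F (h q))" if "continuous_on A h" for h :: "'z::topological_space \<Rightarrow> real \<times> real" and A
    using continuous_on_compose2[OF F that] by simp
  have "integral (cbox (- (a * r), - (b * s)) (a * r, b * s)) F
      = integral {- (a * r)..a * r} (\<lambda>x. integral {- (b * s)..b * s} (\<lambda>y. F (x, y)))"
    by (rule integral_rectangle_yx[OF continuous_on_subset[OF F]]) simp
  also have "\<dots> = integral {- (a * r)..a * r} (\<lambda>x. of_real b * integral {-s..s} (\<lambda>y. F (x, b * y)))"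
    using ab rs by (subst integral_stretch_symmetric) (auto intro!: F' continuous_intros)
  also have "\<dots> = of_real a * integral {-r..r} (\<lambda>x. of_real b * integral {-s..s} (\<lambda>y. F (a * x, b * y)))"
  proof (rule integral_stretch_symmetric[OF ab(1) rs(1)])
    have "continuous_on {- (a * r)..a * r} (\<lambda>x. integral (cbox (-s) s) (\<lambda>y. F (x, b * y)))"
      by (rule integral_continuous_on_param) (auto intro!: F' continuous_intros simp: case_prod_beta)
    then show "continuous_on {- (a * r)..a * r} (\<lambda>x. of_real b * integral {-s..s} (\<lambda>y. F (x, b * y)))"
      by (intro continuous_intros) simp
  qed
  also have "\<dots> = of_real (a * b) * integral {-r..r} (\<lambda>x. integral {-s..s} (\<lambda>y. F (a * x, b * y)))"
    by simp
  also have "integral {-r..r} (\<lambda>x. integral {-s..s} (\<lambda>y. F (a * x, b * y)))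
      = integral (cbox (-r, -s) (r, s)) (\<lambda>(x, y). F (a * x, b * y))"
    by (subst integral_rectangle_yx) (auto intro!: F' continuous_intros simp: case_prod_beta)
  finally show ?thesis .
qed

subsection \<open>Uniform decay for convergent families of phases\<close>

text \<open>One number bounds the function and both first partial derivatives, which is all that the
  estimate with amplitude uses in either direction. The derivatives are two-sided also on the
  boundary of the square; dilated cutoffs are defined on the whole plane.\<close>

definition amplitude :: "real \<Rightarrow> (real \<times> real \<Rightarrow> real) \<Rightarrow> bool" where
  "amplitude M \<psi> \<longleftrightarrow> continuous_on unit_square \<psi> \<and>
     (\<exists>\<psi>x \<psi>y. \<forall>x y. (x, y) \<in> unit_square \<longrightarrow>
        \<bar>\<psi> (x, y)\<bar> \<le> M \<and> \<bar>\<psi>x (x, y)\<bar> \<le> M \<and> \<bar>\<psi>y (x, y)\<bar> \<le> M \<and>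
        ((\<lambda>t. \<psi> (t, y)) has_real_derivative \<psi>x (x, y)) (at x) \<and>
        ((\<lambda>t. \<psi> (x, t)) has_real_derivative \<psi>y (x, y)) (at y))"

text \<open>The bound must be uniform in the amplitude: the neighbourhood in the main theorem
  is chosen before the cutoff function.\<close>

definition decay_bound :: "real \<Rightarrow> nat \<Rightarrow> (real \<times> real \<Rightarrow> real) \<Rightarrow> (real \<times> real) set \<Rightarrow> bool" where
  "decay_bound C K f Q \<longleftrightarrow> (\<forall>M \<psi> \<mu>. amplitude M \<psi> \<longrightarrow> \<mu> \<ge> 1 \<longrightarrow>
     norm (integral Q (\<lambda>p. cis (\<mu> * f p) * complex_of_real (\<psi> p))) \<le> C * M * \<mu> powr (- 1 / K))"

text \<open>The constant is the same for all large j. The finitely many omitted scales are avoided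
  by shrinking the neighbourhood of the origin.\<close>

definition decays :: "(nat \<Rightarrow> real \<times> real \<Rightarrow> real) \<Rightarrow> nat \<Rightarrow> (real \<times> real) set \<Rightarrow> bool" where
  "decays f K Q \<longleftrightarrow> (\<exists>C\<ge>0. \<forall>\<^sub>F j in sequentially. decay_bound C K (f j) Q)"

lemma amplitude_nonneg: "amplitude M \<psi> \<Longrightarrow> M \<ge> 0"
proof -
  assume "amplitude M \<psi>"
  then have "\<bar>\<psi> (0, 0)\<bar> \<le> M" unfolding amplitude_def by force
  then show ?thesis by linarith
qed

text \<open>In \<open>Fx j k\<close> the index j is the scale and k the order of the derivative.
  Convergence is demanded for each order separately: a nonzero limit at one order gives the lower
  bound, the limit at the next order the upper bound, that van der Corput's lemma needs for all
  large j.\<close>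

locale phase_family =
  fixes f :: "nat \<Rightarrow> real \<times> real \<Rightarrow> real"
    and Fx Fy :: "nat \<Rightarrow> nat \<Rightarrow> real \<times> real \<Rightarrow> real"
    and Hx Hy :: "nat \<Rightarrow> real \<times> real \<Rightarrow> real"
  assumes Fx0: "\<And>j. Fx j 0 = f j" and Fy0: "\<And>j. Fy j 0 = f j"
    and cont: "\<forall>\<^sub>F j in sequentially. continuous_on unit_square (f j)"
    and Fx_deriv: "\<forall>\<^sub>F j in sequentially. \<forall>k x y. (x, y) \<in> unit_square \<longrightarrow>
          ((\<lambda>t. Fx j k (t, y)) has_real_derivative Fx j (Suc k) (x, y)) (at x)"
    and Fy_deriv: "\<forall>\<^sub>F j in sequentially. \<forall>k x y. (x, y) \<in> unit_square \<longrightarrow>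
          ((\<lambda>t. Fy j k (x, t)) has_real_derivative Fy j (Suc k) (x, y)) (at y)"
    and Fx_lim: "\<And>k. uniform_limit unit_square (\<lambda>j. Fx j k) (Hx k) sequentially"
    and Fy_lim: "\<And>k. uniform_limit unit_square (\<lambda>j. Fy j k) (Hy k) sequentially"
    and Hx_cont: "\<And>k. continuous_on unit_square (Hx k)"
    and Hy_cont: "\<And>k. continuous_on unit_square (Hy k)"
begin

lemma uniform_bounds_near:
  fixes G :: "nat \<Rightarrow> nat \<Rightarrow> real \<times> real \<Rightarrow> real" and H :: "nat \<Rightarrow> real \<times> real \<Rightarrow> real"
  assumes lim: "\<And>k. uniform_limit unit_square (\<lambda>j. G j k) (H k) sequentially"
    and H: "\<And>k. continuous_on unit_square (H k)"
    and p: "p \<in> unit_square" "H k p \<noteq> 0"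
  shows "\<exists>e>0. \<exists>c>0. \<exists>B. \<forall>\<^sub>F j in sequentially. \<forall>q\<in>unit_square \<inter> ball p e.
    c \<le> \<bar>G j k q\<bar> \<and> \<bar>G j (Suc k) q\<bar> \<le> B"
proof -
  \<comment> \<open>One third of |H k p| is lost on the way from p to q, another on the way from H
    to \<open>G j\<close>, and the last remains as the lower bound.\<close>
  define c where "c = \<bar>H k p\<bar> / 3"
  have c: "c > 0" using p by (simp add: c_def)
  obtain e where e: "e > 0" "\<And>q. q \<in> unit_square \<Longrightarrow> dist q p < e \<Longrightarrow> dist (H k q) (H k p) < c"
    using H[of k] p(1) c unfolding continuous_on_iff by meson
  have "compact (H (Suc k) ` unit_square)"
    using H compact_unit_square by (rule compact_continuous_image)
  then obtain B where B: "\<And>q. q \<in> unit_square \<Longrightarrow> \<bar>H (Suc k) q\<bar> \<le> B"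
    using compact_imp_bounded bounded_iff by (metis image_eqI real_norm_def)
  have "\<forall>\<^sub>F j in sequentially. \<forall>q\<in>unit_square. dist (G j k q) (H k q) < c"
    "\<forall>\<^sub>F j in sequentially. \<forall>q\<in>unit_square. dist (G j (Suc k) q) (H (Suc k) q) < 1"
    using lim c by (auto simp: uniform_limit_iff)
  then have "\<forall>\<^sub>F j in sequentially. \<forall>q\<in>unit_square \<inter> ball p e. c \<le> \<bar>G j k q\<bar> \<and> \<bar>G j (Suc k) q\<bar> \<le> B + 1"
  proof eventually_elim
    case (elim j)
    show ?case
    proof
      fix q assume q: "q \<in> unit_square \<inter> ball p e"
      have "dist (G j k q) (H k q) < c" "dist (H k q) (H k p) < c"
        "dist (G j (Suc k) q) (H (Suc k) q) < 1" "\<bar>H (Suc k) q\<bar> \<le> B"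
        using q elim e(2)[of q] B by (auto simp: dist_commute)
      moreover have "\<bar>H k p\<bar> = 3 * c" by (simp add: c_def)
      ultimately show "c \<le> \<bar>G j k q\<bar> \<and> \<bar>G j (Suc k) q\<bar> \<le> B + 1"
        unfolding dist_real_def by linarith
    qed
  qed
  then show ?thesis using e(1) c by blast
qed

text \<open>The map \<open>emb\<close> selects which of the two coordinates is integrated first.\<close>

lemma decays_near_aux:
  fixes G :: "nat \<Rightarrow> nat \<Rightarrow> real \<times> real \<Rightarrow> real" and H :: "nat \<Rightarrow> real \<times> real \<Rightarrow> real"
    and emb :: "real \<Rightarrow> real \<Rightarrow> real \<times> real"
  assumes emb: "emb = (\<lambda>s t. (s, t)) \<or> emb = (\<lambda>s t. (t, s))"
    and G0: "\<And>j. G j 0 = f j"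
    and deriv: "\<forall>\<^sub>F j in sequentially. \<forall>k s t. emb s t \<in> unit_square \<longrightarrow>
          ((\<lambda>t. G j k (emb s t)) has_real_derivative G j (Suc k) (emb s t)) (at t)"
    and lim: "\<And>k. uniform_limit unit_square (\<lambda>j. G j k) (H k) sequentially"
    and H: "\<And>k. continuous_on unit_square (H k)"
    and p: "p \<in> unit_square" and k: "1 \<le> k" "k \<le> K" and nz: "H k p \<noteq> 0"
  shows "\<exists>e>0. \<forall>u v. cbox u v \<subseteq> unit_square \<inter> ball p e \<longrightarrow> decays f K (cbox u v)"
proof -
  obtain e c0 B where e: "e > 0" and c0: "c0 > 0" and ev: "\<forall>\<^sub>F j in sequentially. \<forall>q\<in>unit_square \<inter> ball p e.
      c0 \<le> \<bar>G j k q\<bar> \<and> \<bar>G j (Suc k) q\<bar> \<le> B"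
    using uniform_bounds_near[where G=G and H=H, OF lim H p nz] by blast
  obtain C where C: "C \<ge> 0" and "vdC_constant k c0 B C"
    using vdC_with_amplitude[OF k(1) c0, of B] by blast
  note vdC = this(2)[unfolded vdC_constant_def, rule_format (no_asm)]
  have "decays f K (cbox u v)" if sub: "cbox u v \<subseteq> unit_square \<inter> ball p e" for u v
  proof (cases "cbox u v = {}")
    case True
    then show ?thesis using C amplitude_nonneg by (auto simp: decays_def decay_bound_def intro!: exI[of _ C])
  next
    case False
    obtain a b c d where uv: "u = emb a c" "v = emb b d"
      using emb by (metis surj_pair)
    have ab: "a \<le> b" and cd: "c \<le> d" using False emb by (auto simp: uv cbox_Pair_eq)
    have inQ: "emb s t \<in> unit_square \<inter> ball p e" if "s \<in> {a..b}" "t \<in> {c..d}" for s t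
      using subsetD[OF sub, of "emb s t"] that emb by (auto simp: uv cbox_Pair_eq)
    have bounds: "-1 \<le> a" "b \<le> 1" "-1 \<le> c" "d \<le> 1"
      using inQ[of a c] inQ[of b d] ab cd emb by auto
    from ev cont deriv
    have "\<forall>\<^sub>F j in sequentially. decay_bound (2 * C) K (f j) (cbox u v)"
    proof eventually_elim
      case (elim j)
      show ?case
        unfolding decay_bound_def
      proof (intro allI impI)
        fix M \<psi> and \<mu> :: real assume amp: "amplitude M \<psi>" and \<mu>: "\<mu> \<ge> 1"
        have \<psi>c: "continuous_on unit_square \<psi>" using amp by (simp add: amplitude_def)
        obtain \<psi>' where \<psi>: "\<And>s t. emb s t \<in> unit_square \<Longrightarrow> \<bar>\<psi> (emb s t)\<bar> \<le> M \<and> \<bar>\<psi>' (emb s t)\<bar> \<le> M \<and>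
           ((\<lambda>t. \<psi> (emb s t)) has_real_derivative \<psi>' (emb s t)) (at t)"
          using amp emb unfolding amplitude_def by blast
        let ?F = "\<lambda>p. cis (\<mu> * f j p) * complex_of_real (\<psi> p)"
        have Fc: "continuous_on (cbox u v) ?F"
          using elim(2) \<psi>c sub by (intro continuous_intros) (auto intro: continuous_on_subset)
        have inner: "norm (integral {c..d} (\<lambda>t. ?F (emb s t))) \<le> C * M * \<mu> powr (- 1 / K)" if s: "s \<in> {a..b}" for s
        proof -
          have "norm (integral {c..d} (\<lambda>t. cis (\<mu> * G j 0 (emb s t)) * complex_of_real (\<psi> (emb s t))))
              \<le> C * M * \<mu> powr (- 1 / k)"
          proof (rule vdC[where g="\<lambda>i t. G j i (emb s t)" and \<psi>'="\<lambda>t. \<psi>' (emb s t)"])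
            show "\<forall>i\<le>k. \<forall>t\<in>{c..d}. ((\<lambda>t. G j i (emb s t)) has_real_derivative G j (Suc i) (emb s t)) (at t within {c..d})"
              using elim(3) inQ[OF s] by (meson IntD1 has_field_derivative_at_within)
            show "\<forall>t\<in>{c..d}. ((\<lambda>t. \<psi> (emb s t)) has_real_derivative \<psi>' (emb s t)) (at t within {c..d})"
              using \<psi> inQ[OF s] by (meson IntD1 has_field_derivative_at_within)
            show "\<forall>t\<in>{c..d}. c0 \<le> \<bar>G j k (emb s t)\<bar>" "\<forall>t\<in>{c..d}. \<bar>G j (Suc k) (emb s t)\<bar> \<le> B"
              using elim(1) inQ[OF s] by blast+
            show "\<forall>t\<in>{c..d}. \<bar>\<psi> (emb s t)\<bar> \<le> M \<and> \<bar>\<psi>' (emb s t)\<bar> \<le> M"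
              using \<psi> inQ[OF s] by blast
          qed (use bounds cd \<mu> in auto)
          \<comment> \<open>For \<mu> \<ge> 1 the decay of order k may be weakened to the common
            order K \<ge> k, so different points may use different k.\<close>
          also have "\<dots> \<le> C * M * \<mu> powr (- 1 / K)"
            using C amplitude_nonneg[OF amp] \<mu> k by (intro mult_left_mono powr_mono) (auto simp: field_simps)
          finally show ?thesis by (simp add: G0)
        qed
        have "integral (cbox u v) ?F = integral {a..b} (\<lambda>s. integral {c..d} (\<lambda>t. ?F (emb s t)))"
          using emb Fc integral_rectangle_yx[of a c b d ?F] integral_rectangle_xy[of c a d b ?F] unfolding uv by auto
        also have "norm \<dots> \<le> (C * M * \<mu> powr (- 1 / K)) * (b - a)"
          by (rule norm_integral_le[OF ab inner])
        also have "\<dots> \<le> (C * M * \<mu> powr (- 1 / K)) * 2"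
          using bounds C amplitude_nonneg[OF amp] by (intro mult_left_mono) auto
        finally show "norm (integral (cbox u v) ?F) \<le> 2 * C * M * \<mu> powr (- 1 / K)" by (simp add: mult_ac)
      qed
    qed
    then show ?thesis using C unfolding decays_def by (intro exI[of _ "2 * C"]) auto
  qed
  then show ?thesis using e by blast
qed

lemma decays_near:
  assumes p: "p \<in> unit_square" and k: "1 \<le> k" "k \<le> K" and nz: "Hx k p \<noteq> 0 \<or> Hy k p \<noteq> 0"
  shows "\<exists>e>0. \<forall>u v. cbox u v \<subseteq> unit_square \<inter> ball p e \<longrightarrow> decays f K (cbox u v)"
  using nz
proof
  assume *: "Hx k p \<noteq> 0"
  show ?thesis
    by (rule decays_near_aux[where emb="\<lambda>s t. (t, s)" and G=Fx and H=Hx, OF _ Fx0 _ Fx_lim Hx_cont p k *])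
      (use Fx_deriv in \<open>auto elim: eventually_mono\<close>)
next
  assume *: "Hy k p \<noteq> 0"
  show ?thesis
    by (rule decays_near_aux[where emb="\<lambda>s t. (s, t)" and G=Fy and H=Hy, OF _ Fy0 _ Fy_lim Hy_cont p k *])
      (use Fy_deriv in \<open>auto elim: eventually_mono\<close>)
qed

text \<open>Cousin's lemma turns the local decay into decay on the whole rectangle.\<close>

lemma decays_rectangle:
  assumes sub: "cbox u v \<subseteq> unit_square"
    and nz: "\<And>p. p \<in> cbox u v \<Longrightarrow> \<exists>k. 1 \<le> k \<and> k \<le> K \<and> (Hx k p \<noteq> 0 \<or> Hy k p \<noteq> 0)"
  shows "decays f K (cbox u v)"
proof -
  \<comment> \<open>A gauge must be defined at every point of the plane; outside the rectangle the
    radius is arbitrary.\<close>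
  have "\<forall>p. \<exists>e>0. p \<in> cbox u v \<longrightarrow> (\<forall>u' v'. cbox u' v' \<subseteq> unit_square \<inter> ball p e \<longrightarrow> decays f K (cbox u' v'))"
  proof
    fix p
    show "\<exists>e>0. p \<in> cbox u v \<longrightarrow> (\<forall>u' v'. cbox u' v' \<subseteq> unit_square \<inter> ball p e \<longrightarrow> decays f K (cbox u' v'))"
    proof (cases "p \<in> cbox u v")
      case True
      then show ?thesis using nz[OF True] sub decays_near[of p _ K] by blast
    qed (auto intro: exI[of _ 1])
  qed
  then obtain e where e: "\<And>p. e p > 0" and loc: "\<And>p u' v'. p \<in> cbox u v \<Longrightarrow>
      cbox u' v' \<subseteq> unit_square \<inter> ball p (e p) \<Longrightarrow> decays f K (cbox u' v')"
    by metis
  have "gauge (\<lambda>p. ball p (e p))" using e by (intro gauge_ball_dependent) auto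
  then obtain T where T: "T tagged_division_of cbox u v" "(\<lambda>p. ball p (e p)) fine T"
    by (rule fine_division_exists)
  define \<D> where "\<D> = snd ` T"
  have \<D>: "\<D> division_of cbox u v" unfolding \<D>_def using T(1) by (rule division_of_tagged_division)
  have "\<forall>Q\<in>\<D>. decays f K Q"
  proof
    fix Q assume "Q \<in> \<D>"
    then obtain p where pQ: "(p, Q) \<in> T" by (auto simp: \<D>_def)
    obtain u' v' where Q: "Q = cbox u' v'"
      using tagged_division_ofD(4)[OF T(1) pQ] by blast
    have "p \<in> cbox u v" "Q \<subseteq> cbox u v" "Q \<subseteq> ball p (e p)"
      using tagged_division_ofD(2,3)[OF T(1) pQ] T(2) pQ by (auto simp: fine_def)
    then show "decays f K Q" using loc[of p u' v'] sub Q by blast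
  qed
  then have "\<forall>Q\<in>\<D>. \<exists>C. C \<ge> 0 \<and> (\<forall>\<^sub>F j in sequentially. decay_bound C K (f j) Q)"
    by (auto simp: decays_def)
  from bchoice[OF this] obtain C where C: "\<And>Q. Q \<in> \<D> \<Longrightarrow> C Q \<ge> 0"
    and ev: "\<forall>Q\<in>\<D>. \<forall>\<^sub>F j in sequentially. decay_bound (C Q) K (f j) Q"
    by blast
  have fin: "finite \<D>" using \<D> by (rule division_of_finite)
  \<comment> \<open>The division is finite, so a common threshold for j exists and the constants add
    up.\<close>
  have "\<forall>\<^sub>F j in sequentially. decay_bound (\<Sum>Q\<in>\<D>. C Q) K (f j) (cbox u v)"
    using eventually_ball_finite[OF fin ev] cont
  proof eventually_elim
    case (elim j)
    show ?case
      unfolding decay_bound_def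
    proof (intro allI impI)
      fix M \<psi> and \<mu> :: real assume amp: "amplitude M \<psi>" and \<mu>: "\<mu> \<ge> 1"
      let ?F = "\<lambda>p. cis (\<mu> * f j p) * complex_of_real (\<psi> p)"
      have "continuous_on unit_square \<psi>" using amp by (simp add: amplitude_def)
      then have "continuous_on (cbox u v) ?F"
        using elim(2) sub by (intro continuous_intros) (auto intro: continuous_on_subset)
      then have "?F integrable_on cbox u v" by (rule integrable_continuous)
      then have "integral (cbox u v) ?F = (\<Sum>Q\<in>\<D>. integral Q ?F)"
        by (rule integral_combine_division_topdown[OF _ \<D>])
      also have "norm \<dots> \<le> (\<Sum>Q\<in>\<D>. C Q * M * \<mu> powr (- 1 / K))"
        using elim(1) amp \<mu> by (intro sum_norm_le) (auto simp: decay_bound_def)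
      finally show "norm (integral (cbox u v) ?F) \<le> (\<Sum>Q\<in>\<D>. C Q) * M * \<mu> powr (- 1 / K)"
        by (simp add: sum_distrib_right)
    qed
  qed
  then show ?thesis using C unfolding decays_def by (intro exI[of _ "\<Sum>Q\<in>\<D>. C Q"]) (auto intro: sum_nonneg)
qed

end

subsection \<open>Dyadic decomposition\<close>

text \<open>Two full-height strips at the sides and two shorter rectangles above and below the inner
  box. None of the four contains the origin, the one point at which no derivative of the principal
  part is assumed to be nonzero.\<close>

lemma integral_unit_square_annulus:
  fixes G :: "real \<times> real \<Rightarrow> complex"
  assumes G: "continuous_on unit_square G" and \<alpha>: "0 < \<alpha>" "\<alpha> < 1" and \<beta>: "0 < \<beta>" "\<beta> < 1"
  shows "integral unit_square G = integral (cbox (-\<alpha>, -\<beta>) (\<alpha>, \<beta>)) G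
    + (integral (cbox (-1, -1) (-\<alpha>, 1)) G + integral (cbox (\<alpha>, -1) (1, 1)) G
       + integral (cbox (-\<alpha>, -1) (\<alpha>, -\<beta>)) G + integral (cbox (-\<alpha>, \<beta>) (\<alpha>, 1)) G)"
proof -
  have c: "continuous_on (cbox (a, c) (b, d)) G" if "-1 \<le> a" "b \<le> 1" "-1 \<le> c" "d \<le> 1" for a b c d
    by (rule continuous_on_subset[OF G]) (use that in \<open>auto simp: unit_square_def cbox_Pair_eq\<close>)
  have "integral unit_square G = integral (cbox (-1, -1) (-\<alpha>, 1)) G + integral (cbox (-\<alpha>, -1) (1, 1)) G"
    unfolding unit_square_def using \<alpha> by (intro integral_rectangle_split_x c) auto
  also have "integral (cbox (-\<alpha>, -1) (1, 1)) G = integral (cbox (-\<alpha>, -1) (\<alpha>, 1)) G + integral (cbox (\<alpha>, -1) (1, 1)) G"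
    using \<alpha> by (intro integral_rectangle_split_x c) auto
  also have "integral (cbox (-\<alpha>, -1) (\<alpha>, 1)) G = integral (cbox (-\<alpha>, -1) (\<alpha>, -\<beta>)) G + integral (cbox (-\<alpha>, -\<beta>) (\<alpha>, 1)) G"
    using \<alpha> \<beta> by (intro integral_rectangle_split_y c) auto
  also have "integral (cbox (-\<alpha>, -\<beta>) (\<alpha>, 1)) G = integral (cbox (-\<alpha>, -\<beta>) (\<alpha>, \<beta>)) G + integral (cbox (-\<alpha>, \<beta>) (\<alpha>, 1)) G"
    using \<alpha> \<beta> by (intro integral_rectangle_split_y c) auto
  finally show ?thesis by (simp add: algebra_simps)
qed

lemma principal_euler:
  "\<kappa> * x * principal_x \<kappa> \<nu> S 1 x y + \<nu> * y * principal_y \<kappa> \<nu> S 1 x y = principal_x \<kappa> \<nu> S 0 x y"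
proof -
  have "\<kappa> * x * (taylor_coeff S a b * real (a choose 1) * x ^ (a - 1) * y ^ b)
      + \<nu> * y * (taylor_coeff S a b * real (b choose 1) * x ^ a * y ^ (b - 1))
      = taylor_coeff S a b * real (a choose 0) * x ^ (a - 0) * y ^ b" if "(a, b) \<in> weight_line \<kappa> \<nu>" for a b
  proof -
    have 1: "x * (real a * x ^ (a - 1)) = real a * x ^ a" by (cases a) auto
    have 2: "y * (real b * y ^ (b - 1)) = real b * y ^ b" by (cases b) auto
    have "\<kappa> * x * (taylor_coeff S a b * real (a choose 1) * x ^ (a - 1) * y ^ b)
      + \<nu> * y * (taylor_coeff S a b * real (b choose 1) * x ^ a * y ^ (b - 1))
      = \<kappa> * taylor_coeff S a b * (x * (real a * x ^ (a - 1))) * y ^ b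
        + \<nu> * taylor_coeff S a b * x ^ a * (y * (real b * y ^ (b - 1)))"
      by (simp add: algebra_simps)
    also have "\<dots> = (\<kappa> * real a + \<nu> * real b) * (taylor_coeff S a b * x ^ a * y ^ b)"
      unfolding 1 2 by (simp add: algebra_simps)
    finally show ?thesis using that by (simp add: weight_line_def)
  qed
  then show ?thesis
    unfolding principal_x_def principal_y_def sum_distrib_left sum.distrib[symmetric]
    by (intro sum.cong) auto
qed

lemma principal_0: "principal_y \<kappa> \<nu> S 0 x y = principal_x \<kappa> \<nu> S 0 x y"
  by (simp add: principal_x_def principal_y_def)

lemma principal_derivative_pos_order:
  assumes K: "K \<ge> 1" and k: "k \<le> K" "principal_x \<kappa> \<nu> S k x y \<noteq> 0 \<or> principal_y \<kappa> \<nu> S k x y \<noteq> 0"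
  shows "\<exists>k. 1 \<le> k \<and> k \<le> K \<and> (principal_x \<kappa> \<nu> S k x y \<noteq> 0 \<or> principal_y \<kappa> \<nu> S k x y \<noteq> 0)"
proof (cases "k = 0")
  case True
  then have "principal_x \<kappa> \<nu> S 0 x y \<noteq> 0" using k(2) by (auto simp: principal_0)
  then have "principal_x \<kappa> \<nu> S 1 x y \<noteq> 0 \<or> principal_y \<kappa> \<nu> S 1 x y \<noteq> 0"
    using principal_euler[of \<kappa> x \<nu> S y] by auto
  then show ?thesis using K by blast
next
  case False
  then show ?thesis using k by (intro exI[of _ k]) auto
qed

lemma phase_family_dilations:
  fixes \<kappa> \<nu> :: real
  assumes U: "open U" and p: "(0, 0) \<in> U" and S: "smooth_on U S"
    and \<kappa>: "\<kappa> > 0" and \<nu>: "\<nu> > 0"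
    and supp: "\<And>a b. taylor_coeff S a b \<noteq> 0 \<Longrightarrow> \<kappa> * real a + \<nu> * real b \<ge> 1"
  defines "\<alpha> \<equiv> 2 powr - \<kappa>" and "\<beta> \<equiv> 2 powr - \<nu>"
  shows "phase_family (\<lambda>j (x, y). 2 ^ j * S (\<alpha> ^ j * x, \<beta> ^ j * y))
    (\<lambda>j k (x, y). (2 * \<alpha> ^ k) ^ j * (partial_x ^^ k) S (\<alpha> ^ j * x, \<beta> ^ j * y))
    (\<lambda>j k (x, y). (2 * \<beta> ^ k) ^ j * (partial_y ^^ k) S (\<alpha> ^ j * x, \<beta> ^ j * y))
    (\<lambda>k (x, y). fact k * principal_x \<kappa> \<nu> S k x y)
    (\<lambda>k (x, y). fact k * principal_y \<kappa> \<nu> S k x y)" (is ?family)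
    and "\<forall>\<^sub>F j in sequentially. \<forall>x y. \<bar>x\<bar> \<le> \<alpha> ^ j \<longrightarrow> \<bar>y\<bar> \<le> \<beta> ^ j \<longrightarrow> (x, y) \<in> U"
proof -
  have \<alpha>: "0 < \<alpha>" "\<alpha> < 1" and \<beta>: "0 < \<beta>" "\<beta> < 1" using \<kappa> \<nu> by (auto simp: \<alpha>_def \<beta>_def powr_less_one)
  obtain e where e: "e > 0" and box: "\<And>x y. \<bar>x\<bar> \<le> e \<Longrightarrow> \<bar>y\<bar> \<le> e \<Longrightarrow> (x, y) \<in> U"
    using open_contains_box[OF U p] by blast
  have "eventually (\<lambda>n. \<alpha> ^ n < e) sequentially" "eventually (\<lambda>n. \<beta> ^ n < e) sequentially"
    using order_tendstoD(2)[OF LIMSEQ_power_zero[of \<alpha>] e] order_tendstoD(2)[OF LIMSEQ_power_zero[of \<beta>] e] \<alpha> \<beta> by auto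
  then show small: "\<forall>\<^sub>F j in sequentially. \<forall>x y. \<bar>x\<bar> \<le> \<alpha> ^ j \<longrightarrow> \<bar>y\<bar> \<le> \<beta> ^ j \<longrightarrow> (x, y) \<in> U"
    by eventually_elim (auto intro: box)
  have inU: "(\<alpha> ^ j * x, \<beta> ^ j * y) \<in> U"
    if "\<forall>x y. \<bar>x\<bar> \<le> \<alpha> ^ j \<longrightarrow> \<bar>y\<bar> \<le> \<beta> ^ j \<longrightarrow> (x, y) \<in> U" "(x, y) \<in> unit_square" for j x y
  proof -
    have "\<alpha> ^ j * \<bar>x\<bar> \<le> \<alpha> ^ j * 1" "\<beta> ^ j * \<bar>y\<bar> \<le> \<beta> ^ j * 1"
      using that(2) \<alpha> \<beta> by (intro mult_left_mono; simp)+
    then show ?thesis using that(1) \<alpha> \<beta> by (simp add: abs_mult)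
  qed
  show ?family
  proof
    show "\<forall>\<^sub>F j in sequentially. continuous_on unit_square (\<lambda>(x, y). 2 ^ j * S (\<alpha> ^ j * x, \<beta> ^ j * y))"
      using small
    proof eventually_elim
      case (elim j)
      have "continuous_on unit_square (\<lambda>p. S (\<alpha> ^ j * fst p, \<beta> ^ j * snd p))"
        using inU[OF elim] by (intro continuous_on_compose2[OF smooth_on_continuous[OF S]])
          (auto intro!: continuous_intros)
      then show ?case by (auto simp: case_prod_beta intro!: continuous_intros)
    qed
    show "\<forall>\<^sub>F j in sequentially. \<forall>k x y. (x, y) \<in> unit_square \<longrightarrow>
      ((\<lambda>t. case (t, y) of (x, y) \<Rightarrow> (2 * \<alpha> ^ k) ^ j * (partial_x ^^ k) S (\<alpha> ^ j * x, \<beta> ^ j * y)) has_real_derivative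
       (case (x, y) of (x, y) \<Rightarrow> (2 * \<alpha> ^ Suc k) ^ j * (partial_x ^^ Suc k) S (\<alpha> ^ j * x, \<beta> ^ j * y))) (at x)"
      using small
    proof eventually_elim
      case (elim j)
      show ?case
      proof (intro allI impI, goal_cases)
        case xy: (1 k x y)
        have "((\<lambda>t. (partial_x ^^ k) S (t, \<beta> ^ j * y)) has_real_derivative (partial_x ^^ Suc k) S (\<alpha> ^ j * x, \<beta> ^ j * y)) (at (\<alpha> ^ j * x))"
          using partial_x_has_real_derivative[OF smooth_on_partial_x_pow[OF S] inU[OF elim xy]] by simp
        from DERIV_cmult[OF DERIV_chain2[OF this DERIV_cmult_Id], of "(2 * \<alpha> ^ k) ^ j"]
        show ?case
          by (simp add: power_mult_distrib mult_ac)
      qed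
    qed
    show "\<forall>\<^sub>F j in sequentially. \<forall>k x y. (x, y) \<in> unit_square \<longrightarrow>
      ((\<lambda>t. case (x, t) of (x, y) \<Rightarrow> (2 * \<beta> ^ k) ^ j * (partial_y ^^ k) S (\<alpha> ^ j * x, \<beta> ^ j * y)) has_real_derivative
       (case (x, y) of (x, y) \<Rightarrow> (2 * \<beta> ^ Suc k) ^ j * (partial_y ^^ Suc k) S (\<alpha> ^ j * x, \<beta> ^ j * y))) (at y)"
      using small
    proof eventually_elim
      case (elim j)
      show ?case
      proof (intro allI impI, goal_cases)
        case xy: (1 k x y)
        have "((\<lambda>t. (partial_y ^^ k) S (\<alpha> ^ j * x, t)) has_real_derivative (partial_y ^^ Suc k) S (\<alpha> ^ j * x, \<beta> ^ j * y)) (at (\<beta> ^ j * y))"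
          using partial_y_has_real_derivative[OF smooth_on_partial_y_pow[OF S] inU[OF elim xy]] by simp
        from DERIV_cmult[OF DERIV_chain2[OF this DERIV_cmult_Id], of "(2 * \<beta> ^ k) ^ j"]
        show ?case
          by (simp add: power_mult_distrib mult_ac)
      qed
    qed
    show "uniform_limit unit_square (\<lambda>j (x, y). (2 * \<alpha> ^ k) ^ j * (partial_x ^^ k) S (\<alpha> ^ j * x, \<beta> ^ j * y))
      (\<lambda>(x, y). fact k * principal_x \<kappa> \<nu> S k x y) sequentially" for k
      unfolding \<alpha>_def \<beta>_def by (rule principal_scaling_limit(1)[OF U p S \<kappa> \<nu> supp])
    show "uniform_limit unit_square (\<lambda>j (x, y). (2 * \<beta> ^ k) ^ j * (partial_y ^^ k) S (\<alpha> ^ j * x, \<beta> ^ j * y))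
      (\<lambda>(x, y). fact k * principal_y \<kappa> \<nu> S k x y) sequentially" for k
      unfolding \<alpha>_def \<beta>_def by (rule principal_scaling_limit(2)[OF U p S \<kappa> \<nu> supp])
    show "continuous_on unit_square (\<lambda>(x, y). fact k * principal_x \<kappa> \<nu> S k x y)" for k
      unfolding principal_x_def case_prod_beta by (intro continuous_intros)
    show "continuous_on unit_square (\<lambda>(x, y). fact k * principal_y \<kappa> \<nu> S k x y)" for k
      unfolding principal_y_def case_prod_beta by (intro continuous_intros)
  qed (auto simp: fun_eq_iff)
qed

section \<open>Cutoff functions and the two notions of integral\<close>

lemma smooth_bounded_unit_square:
  assumes "smooth_on UNIV \<phi>"
  shows "\<exists>M. \<forall>q\<in>unit_square. \<bar>\<phi> q\<bar> \<le> M"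
proof -
  have "compact (\<phi> ` unit_square)"
    using smooth_on_continuous[OF assms] compact_unit_square
    by (intro compact_continuous_image) (auto intro: continuous_on_subset)
  then show ?thesis using compact_imp_bounded bounded_iff by (metis image_eqI real_norm_def)
qed

text \<open>Dilation by factors at most 1 only decreases the bounds on the first partial derivatives
  and keeps points in the unit square, so a single M serves all scales.\<close>

lemma amplitude_dilation:
  assumes \<phi>: "smooth_on UNIV \<phi>"
  shows "\<exists>M\<ge>0. (\<forall>q\<in>unit_square. \<bar>\<phi> q\<bar> \<le> M) \<and> (\<forall>a b. 0 \<le> a \<longrightarrow> a \<le> 1 \<longrightarrow> 0 \<le> b \<longrightarrow> b \<le> 1 \<longrightarrow>
    amplitude M (\<lambda>(x, y). \<phi> (a * x, b * y)))"
proof -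
  note dx = smooth_on_partial_x[OF \<phi>] and dy = smooth_on_partial_y[OF \<phi>]
  obtain M0 M1 M2 where M0: "\<And>q. q \<in> unit_square \<Longrightarrow> \<bar>\<phi> q\<bar> \<le> M0"
    and M1: "\<And>q. q \<in> unit_square \<Longrightarrow> \<bar>partial_x \<phi> q\<bar> \<le> M1"
    and M2: "\<And>q. q \<in> unit_square \<Longrightarrow> \<bar>partial_y \<phi> q\<bar> \<le> M2"
    using smooth_bounded_unit_square[OF \<phi>] smooth_bounded_unit_square[OF dx] smooth_bounded_unit_square[OF dy] by blast
  define M where "M = max M0 (max M1 M2)"
  have M: "\<bar>\<phi> q\<bar> \<le> M" "\<bar>partial_x \<phi> q\<bar> \<le> M" "\<bar>partial_y \<phi> q\<bar> \<le> M" if "q \<in> unit_square" for q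
    using M0[OF that] M1[OF that] M2[OF that] by (auto simp: M_def)
  have "M \<ge> 0" using M(1)[of "(0, 0)"] by auto
  moreover have "amplitude M (\<lambda>(x, y). \<phi> (a * x, b * y))" if ab: "0 \<le> a" "a \<le> 1" "0 \<le> b" "b \<le> 1" for a b
    unfolding amplitude_def
  proof (intro conjI exI allI impI)
    show "continuous_on unit_square (\<lambda>(x, y). \<phi> (a * x, b * y))"
      unfolding case_prod_beta
      by (rule continuous_on_compose2[OF smooth_on_continuous[OF \<phi>]]) (auto intro!: continuous_intros)
    fix x y assume xy: "(x, y) \<in> unit_square"
    have "a * \<bar>x\<bar> \<le> 1" "b * \<bar>y\<bar> \<le> 1" using xy ab by (auto intro: mult_le_one)
    then have in': "(a * x, b * y) \<in> unit_square" using ab by (simp add: abs_mult)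
    show "\<bar>case (x, y) of (x, y) \<Rightarrow> \<phi> (a * x, b * y)\<bar> \<le> M" using M[OF in'] by simp
    have "\<bar>partial_x \<phi> (a * x, b * y)\<bar> * a \<le> M * 1" using M[OF in'] ab by (intro mult_mono) auto
    then show "\<bar>(\<lambda>(x, y). partial_x \<phi> (a * x, b * y) * a) (x, y)\<bar> \<le> M" using ab by (simp add: abs_mult)
    have "\<bar>partial_y \<phi> (a * x, b * y)\<bar> * b \<le> M * 1" using M[OF in'] ab by (intro mult_mono) auto
    then show "\<bar>(\<lambda>(x, y). partial_y \<phi> (a * x, b * y) * b) (x, y)\<bar> \<le> M" using ab by (simp add: abs_mult)
    have "((\<lambda>t. \<phi> (t, b * y)) has_real_derivative partial_x \<phi> (a * x, b * y)) (at (a * x))"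
      using partial_x_has_real_derivative[OF \<phi>] by simp
    from DERIV_chain2[OF this DERIV_cmult_Id]
    show "((\<lambda>t. case (t, y) of (x, y) \<Rightarrow> \<phi> (a * x, b * y)) has_real_derivative
        (\<lambda>(x, y). partial_x \<phi> (a * x, b * y) * a) (x, y)) (at x)" by simp
    have "((\<lambda>t. \<phi> (a * x, t)) has_real_derivative partial_y \<phi> (a * x, b * y)) (at (b * y))"
      using partial_y_has_real_derivative[OF \<phi>] by simp
    from DERIV_chain2[OF this DERIV_cmult_Id]
    show "((\<lambda>t. case (x, t) of (x, y) \<Rightarrow> \<phi> (a * x, b * y)) has_real_derivative
        (\<lambda>(x, y). partial_y \<phi> (a * x, b * y) * b) (x, y)) (at y)" by simp
  qed
  ultimately show ?thesis using M(1) by blast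
qed

text \<open>Outside U nothing is known about \<open>S\<close>, but there the integrand is 0. The
  open sets U and the complement of \<open>supp \<phi>\<close> cover the plane, and continuity holds
  on each.\<close>

lemma osc_integrand_continuous:
  assumes U: "open U" and S: "smooth_on U S" and \<phi>: "smooth_on UNIV \<phi>" and sub: "supp \<phi> \<subseteq> U"
  shows "continuous_on UNIV (\<lambda>p. cis (lam * S p) * complex_of_real (\<phi> p))"
proof -
  have 1: "continuous_on U (\<lambda>p. cis (lam * S p) * complex_of_real (\<phi> p))"
    using smooth_on_continuous[OF S] smooth_on_continuous[OF \<phi>]
    by (intro continuous_intros) (auto intro: continuous_on_subset)
  have "continuous_on (- supp \<phi>) (\<lambda>p. 0 :: complex)" by simp
  moreover have "cis (lam * S p) * complex_of_real (\<phi> p) = 0" if "p \<in> - supp \<phi>" for p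
    using that closure_subset[of "{p. \<phi> p \<noteq> 0}"] by (auto simp: supp_def)
  ultimately have 2: "continuous_on (- supp \<phi>) (\<lambda>p. cis (lam * S p) * complex_of_real (\<phi> p))"
    by (metis (no_types, lifting) continuous_on_cong)
  have "U \<union> - supp \<phi> = UNIV" using sub by auto
  then show ?thesis using continuous_on_open_Un[OF U _ 1 2] by (simp add: supp_def open_Compl)
qed

text \<open>Passage from the Lebesgue integral in \<open>osc_integral\<close> to the gauge integral
  over a rectangle, for which the cutting and the one-dimensional estimates are stated.\<close>

lemma osc_integral_eq_integral:
  assumes F: "continuous_on UNIV (\<lambda>p. cis (lam * S p) * complex_of_real (\<phi> p))"
    and sub: "supp \<phi> \<subseteq> cbox u v"
  shows "osc_integral S \<phi> lam = integral (cbox u v) (\<lambda>p. cis (lam * S p) * complex_of_real (\<phi> p))"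
proof -
  let ?F = "\<lambda>p. cis (lam * S p) * complex_of_real (\<phi> p)"
  have zero: "\<phi> p = 0" if "p \<notin> cbox u v" for p
    using that sub closure_subset[of "{p. \<phi> p \<noteq> 0}"] by (auto simp: supp_def)
  have "set_integrable lborel (cbox u v) ?F"
    unfolding set_integrable_def by (intro borel_integrable_compact continuous_on_subset[OF F]) auto
  then have "(LINT p:cbox u v|lborel. ?F p) = integral (cbox u v) ?F"
    by (rule set_borel_integral_eq_integral(2))
  moreover have "(LINT p:cbox u v|lborel. ?F p) = (LINT p|lborel. ?F p)"
    unfolding set_lebesgue_integral_def using zero
    by (intro Bochner_Integration.integral_cong) (auto simp: indicator_def)
  moreover have "osc_integral S \<phi> lam = (LINT p|lborel. ?F p)"
    unfolding osc_integral_def by (simp add: cis_conv_exp mult.assoc)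
  ultimately show ?thesis by simp
qed

text \<open>A recursion in the scale: with I_j the integral over the unit square of the integrand
  dilated j times, I_j is the annulus part, which has frequency lam / 2^j, plus \<alpha> \<beta>
  I_(j+1). It is followed for j \<le> n, where the frequency is at least 1; then I_(n+1) is bounded
  trivially.\<close>

lemma dyadic_estimate:
  fixes \<kappa> \<nu> :: real and K :: nat
  assumes U: "open U" and p: "(0, 0) \<in> U" and S: "smooth_on U S"
    and \<kappa>: "\<kappa> > 0" and \<nu>: "\<nu> > 0"
    and supp: "\<And>a b. taylor_coeff S a b \<noteq> 0 \<Longrightarrow> \<kappa> * real a + \<nu> * real b \<ge> 1"
    and K: "K \<ge> 1"
    and nondeg: "\<And>x y. (x, y) \<noteq> (0, 0) \<Longrightarrow>
        \<exists>k\<le>K. principal_x \<kappa> \<nu> S k x y \<noteq> 0 \<or> principal_y \<kappa> \<nu> S k x y \<noteq> 0"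
  shows "\<exists>V. open V \<and> (0, 0) \<in> V \<and> V \<subseteq> U \<and> (\<forall>\<phi>. smooth_on UNIV \<phi> \<and> supp \<phi> \<subseteq> V \<longrightarrow>
    (\<exists>C\<ge>0. \<exists>j0. \<forall>n\<ge>j0. \<forall>lam\<ge>2 ^ n. norm (osc_integral S \<phi> lam)
       \<le> C * ((\<Sum>j\<le>n. (2 powr - (\<kappa> + \<nu>)) ^ j * (lam / 2 ^ j) powr (- 1 / K)) + (2 powr - (\<kappa> + \<nu>)) ^ Suc n)))"
proof -
  define \<alpha> \<beta> :: real where "\<alpha> = 2 powr - \<kappa>" and "\<beta> = 2 powr - \<nu>"
  have \<alpha>: "0 < \<alpha>" "\<alpha> < 1" and \<beta>: "0 < \<beta>" "\<beta> < 1" using \<kappa> \<nu> by (auto simp: \<alpha>_def \<beta>_def powr_less_one)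
  have \<alpha>\<beta>: "2 powr - (\<kappa> + \<nu>) = \<alpha> * \<beta>" by (simp add: \<alpha>_def \<beta>_def powr_add[symmetric])
  define f where "f = (\<lambda>j (x, y). 2 ^ j * S (\<alpha> ^ j * x, \<beta> ^ j * y))"
  interpret P: phase_family f
    "\<lambda>j k (x, y). (2 * \<alpha> ^ k) ^ j * (partial_x ^^ k) S (\<alpha> ^ j * x, \<beta> ^ j * y)"
    "\<lambda>j k (x, y). (2 * \<beta> ^ k) ^ j * (partial_y ^^ k) S (\<alpha> ^ j * x, \<beta> ^ j * y)"
    "\<lambda>k (x, y). fact k * principal_x \<kappa> \<nu> S k x y"
    "\<lambda>k (x, y). fact k * principal_y \<kappa> \<nu> S k x y"
    unfolding f_def \<alpha>_def \<beta>_def by (rule phase_family_dilations(1)[OF U p S \<kappa> \<nu> supp])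
  have dec: "decays f K (cbox u v)" if sub: "cbox u v \<subseteq> unit_square" and 0: "(0, 0) \<notin> cbox u v" for u v
  proof (rule P.decays_rectangle[OF sub])
    fix q assume q: "q \<in> cbox u v"
    obtain x y where xy: "q = (x, y)" by (cases q)
    then have "(x, y) \<noteq> (0, 0)" using q 0 by auto
    from nondeg[OF this] obtain k where "k \<le> K" "principal_x \<kappa> \<nu> S k x y \<noteq> 0 \<or> principal_y \<kappa> \<nu> S k x y \<noteq> 0" by blast
    from principal_derivative_pos_order[OF K this]
    show "\<exists>k. 1 \<le> k \<and> k \<le> K \<and> ((case q of (x, y) \<Rightarrow> fact k * principal_x \<kappa> \<nu> S k x y) \<noteq> 0
        \<or> (case q of (x, y) \<Rightarrow> fact k * principal_y \<kappa> \<nu> S k x y) \<noteq> 0)"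
      by (simp add: xy)
  qed
  have "decays f K (cbox (-1, -1) (-\<alpha>, 1))" "decays f K (cbox (\<alpha>, -1) (1, 1))"
    "decays f K (cbox (-\<alpha>, -1) (\<alpha>, -\<beta>))" "decays f K (cbox (-\<alpha>, \<beta>) (\<alpha>, 1))"
    by (intro dec; use \<alpha> \<beta> in \<open>auto simp: cbox_Pair_eq unit_square_def\<close>)+
  then obtain C1 C2 C3 C4 where C0: "C1 \<ge> 0" "C2 \<ge> 0" "C3 \<ge> 0" "C4 \<ge> 0" and ev:
    "\<forall>\<^sub>F j in sequentially. decay_bound C1 K (f j) (cbox (-1, -1) (-\<alpha>, 1))"
    "\<forall>\<^sub>F j in sequentially. decay_bound C2 K (f j) (cbox (\<alpha>, -1) (1, 1))"
    "\<forall>\<^sub>F j in sequentially. decay_bound C3 K (f j) (cbox (-\<alpha>, -1) (\<alpha>, -\<beta>))"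
    "\<forall>\<^sub>F j in sequentially. decay_bound C4 K (f j) (cbox (-\<alpha>, \<beta>) (\<alpha>, 1))"
    unfolding decays_def by blast
  define C where "C = C1 + C2 + C3 + C4"
  have C: "C \<ge> 0" using C0 by (simp add: C_def)
  define good where "good = (\<lambda>j. \<forall>M \<psi> \<mu>. amplitude M \<psi> \<longrightarrow> \<mu> \<ge> 1 \<longrightarrow>
     norm (integral unit_square (\<lambda>p. cis (\<mu> * f j p) * complex_of_real (\<psi> p))
       - integral (cbox (-\<alpha>, -\<beta>) (\<alpha>, \<beta>)) (\<lambda>p. cis (\<mu> * f j p) * complex_of_real (\<psi> p))) \<le> C * M * \<mu> powr (- 1 / K))"
  have "eventually good sequentially"
    using ev P.cont
  proof eventually_elim
    case (elim j)
    show ?case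
      unfolding good_def
    proof (intro allI impI)
      fix M \<psi> and \<mu> :: real assume amp: "amplitude M \<psi>" and \<mu>: "\<mu> \<ge> 1"
      let ?F = "\<lambda>p. cis (\<mu> * f j p) * complex_of_real (\<psi> p)"
      have Fc: "continuous_on unit_square ?F"
        using elim(5) amp by (auto simp: amplitude_def intro!: continuous_intros)
      have "norm (integral unit_square ?F - integral (cbox (-\<alpha>, -\<beta>) (\<alpha>, \<beta>)) ?F)
        = norm (integral (cbox (-1, -1) (-\<alpha>, 1)) ?F + integral (cbox (\<alpha>, -1) (1, 1)) ?F
       + integral (cbox (-\<alpha>, -1) (\<alpha>, -\<beta>)) ?F + integral (cbox (-\<alpha>, \<beta>) (\<alpha>, 1)) ?F)"
        unfolding integral_unit_square_annulus[OF Fc \<alpha> \<beta>] by simp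
      also have "\<dots> \<le> C1 * M * \<mu> powr (- 1 / K) + C2 * M * \<mu> powr (- 1 / K) + C3 * M * \<mu> powr (- 1 / K) + C4 * M * \<mu> powr (- 1 / K)"
        using elim(1-4) amp \<mu> by (intro norm_triangle_mono) (auto simp: decay_bound_def)
      also have "\<dots> = C * M * \<mu> powr (- 1 / K)" by (simp add: C_def algebra_simps)
      finally show "norm (integral unit_square ?F - integral (cbox (-\<alpha>, -\<beta>) (\<alpha>, \<beta>)) ?F) \<le> C * M * \<mu> powr (- 1 / K)" .
    qed
  qed
  moreover have "\<forall>\<^sub>F j in sequentially. \<forall>x y. \<bar>x\<bar> \<le> \<alpha> ^ j \<longrightarrow> \<bar>y\<bar> \<le> \<beta> ^ j \<longrightarrow> (x, y) \<in> U"
    unfolding \<alpha>_def \<beta>_def by (rule phase_family_dilations(2)[OF U p S \<kappa> \<nu> supp])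
  ultimately have "\<forall>\<^sub>F j in sequentially. good j \<and> (\<forall>x y. \<bar>x\<bar> \<le> \<alpha> ^ j \<longrightarrow> \<bar>y\<bar> \<le> \<beta> ^ j \<longrightarrow> (x, y) \<in> U)"
    by (rule eventually_conj)
  then obtain j0 where j0: "\<forall>j\<ge>j0. good j \<and> (\<forall>x y. \<bar>x\<bar> \<le> \<alpha> ^ j \<longrightarrow> \<bar>y\<bar> \<le> \<beta> ^ j \<longrightarrow> (x, y) \<in> U)"
    unfolding eventually_sequentially ..
  note annulus = j0[rule_format, THEN conjunct1, unfolded good_def, rule_format]
  have inU: "\<And>x y. \<bar>x\<bar> \<le> \<alpha> ^ j0 \<Longrightarrow> \<bar>y\<bar> \<le> \<beta> ^ j0 \<Longrightarrow> (x, y) \<in> U"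
    using j0 by blast
  \<comment> \<open>The box at scale j0. Since j0 stems from \<open>S\<close> and the weights alone,
    V is fixed before \<phi> is given.\<close>
  define V where "V = box (- (\<alpha> ^ j0), - (\<beta> ^ j0)) (\<alpha> ^ j0, \<beta> ^ j0)"
  have V_cbox: "V \<subseteq> cbox (- (\<alpha> ^ j0), - (\<beta> ^ j0)) (\<alpha> ^ j0, \<beta> ^ j0)" by (simp add: V_def box_subset_cbox)
  have V_U: "V \<subseteq> U"
  proof
    fix q assume q: "q \<in> V"
    obtain x y where xy: "q = (x, y)" by (cases q)
    have "q \<in> cbox (- (\<alpha> ^ j0), - (\<beta> ^ j0)) (\<alpha> ^ j0, \<beta> ^ j0)" using V_cbox q by blast
    then show "q \<in> U" using inU[of x y] by (auto simp: xy cbox_Pair_eq)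
  qed
  have V0: "(0, 0) \<in> V" using \<alpha> \<beta> by (auto simp: V_def box_def Basis_prod_def)
  have main: "\<exists>C\<ge>0. \<exists>j0. \<forall>n\<ge>j0. \<forall>lam\<ge>2 ^ n. norm (osc_integral S \<phi> lam)
       \<le> C * ((\<Sum>j\<le>n. (\<alpha> * \<beta>) ^ j * (lam / 2 ^ j) powr (- 1 / K)) + (\<alpha> * \<beta>) ^ Suc n)"
    if \<phi>: "smooth_on UNIV \<phi>" and supp\<phi>: "supp \<phi> \<subseteq> V" for \<phi>
  proof -
    obtain M where M: "M \<ge> 0" "\<And>q. q \<in> unit_square \<Longrightarrow> \<bar>\<phi> q\<bar> \<le> M"
      and amp: "\<And>a b. 0 \<le> a \<Longrightarrow> a \<le> 1 \<Longrightarrow> 0 \<le> b \<Longrightarrow> b \<le> 1 \<Longrightarrow> amplitude M (\<lambda>(x, y). \<phi> (a * x, b * y))"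
      using amplitude_dilation[OF \<phi>] by blast
    show ?thesis
    \<comment> \<open>C M is the constant for the annuli, and 4 M bounds the last integral, over a
      square of area 4.\<close>
    proof (intro exI[of _ "C * M + 4 * M"] conjI exI[of _ j0] allI impI)
      fix n and lam :: real assume n: "j0 \<le> n" and lam: "2 ^ n \<le> lam"
      define F where "F = (\<lambda>p. cis (lam * S p) * complex_of_real (\<phi> p))"
      have Fc: "continuous_on UNIV F"
        unfolding F_def using supp\<phi> V_U by (intro osc_integrand_continuous[OF U S \<phi>]) auto
      define I where "I = (\<lambda>j. integral unit_square (\<lambda>(x, y). F (\<alpha> ^ j * x, \<beta> ^ j * y)))"
      have Fjc: "continuous_on UNIV (\<lambda>(x, y). F (\<alpha> ^ j * x, \<beta> ^ j * y))" for j
        unfolding case_prod_beta by (rule continuous_on_compose2[OF Fc]) (auto intro!: continuous_intros)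
      have J: "osc_integral S \<phi> lam = of_real ((\<alpha> * \<beta>) ^ j0) * I j0"
      proof -
        have "osc_integral S \<phi> lam = integral (cbox (- (\<alpha> ^ j0 * 1), - (\<beta> ^ j0 * 1)) (\<alpha> ^ j0 * 1, \<beta> ^ j0 * 1)) F"
          unfolding F_def using supp\<phi> V_cbox by (intro osc_integral_eq_integral Fc[unfolded F_def]) auto
        also have "\<dots> = of_real (\<alpha> ^ j0 * \<beta> ^ j0) * integral (cbox (-1, -1) (1, 1)) (\<lambda>(x, y). F (\<alpha> ^ j0 * x, \<beta> ^ j0 * y))"
          using \<alpha> \<beta> by (intro integral_rectangle_stretch Fc) auto
        finally show ?thesis by (simp add: I_def unit_square_def power_mult_distrib)
      qed
      have step_le: "norm (I j) \<le> C * M * (lam / 2 ^ j) powr (- 1 / K) + \<alpha> * \<beta> * norm (I (Suc j))" if j: "j0 \<le> j" "j \<le> n" for j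
      proof -
        let ?G = "\<lambda>(x, y). F (\<alpha> ^ j * x, \<beta> ^ j * y)"
        have "(2 :: real) ^ j \<le> lam" by (rule order_trans[OF power_increasing[OF j(2)] lam]) simp
        then have \<mu>: "lam / 2 ^ j \<ge> 1" using lam by (simp add: field_simps)
        \<comment> \<open>The factor 2^j in \<open>f j\<close> is compensated by the frequency: lam
          times \<open>S\<close> at the dilated point is lam / 2^j times \<open>f j\<close>.\<close>
        have G: "(\<lambda>q. cis (lam / 2 ^ j * f j q) * complex_of_real ((\<lambda>(x, y). \<phi> (\<alpha> ^ j * x, \<beta> ^ j * y)) q)) = ?G"
          by (auto simp: F_def f_def)
        have "amplitude M (\<lambda>(x, y). \<phi> (\<alpha> ^ j * x, \<beta> ^ j * y))"
          using \<alpha> \<beta> by (intro amp power_le_one) auto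
        from annulus[OF j(1) this \<mu>]
        have 1: "norm (I j - integral (cbox (-\<alpha>, -\<beta>) (\<alpha>, \<beta>)) ?G) \<le> C * M * (lam / 2 ^ j) powr (- 1 / K)"
          unfolding G I_def .
        have "integral (cbox (- (\<alpha> * 1), - (\<beta> * 1)) (\<alpha> * 1, \<beta> * 1)) ?G
            = of_real (\<alpha> * \<beta>) * integral (cbox (-1, -1) (1, 1)) (\<lambda>(x, y). ?G (\<alpha> * x, \<beta> * y))"
          using \<alpha> \<beta> by (intro integral_rectangle_stretch Fjc) auto
        then have 2: "integral (cbox (-\<alpha>, -\<beta>) (\<alpha>, \<beta>)) ?G = of_real (\<alpha> * \<beta>) * I (Suc j)"
          by (simp add: I_def unit_square_def mult_ac)
        have "norm (I j) \<le> norm (I j - of_real (\<alpha> * \<beta>) * I (Suc j)) + norm (of_real (\<alpha> * \<beta>) * I (Suc j))"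
          using norm_triangle_sub[of "I j" "of_real (\<alpha> * \<beta>) * I (Suc j)"] by simp
        also have "\<dots> \<le> C * M * (lam / 2 ^ j) powr (- 1 / K) + \<alpha> * \<beta> * norm (I (Suc j))"
          using 1 \<alpha> \<beta> unfolding 2 by (simp add: norm_mult)
        finally show ?thesis .
      qed
      have iter: "(\<alpha> * \<beta>) ^ j0 * norm (I j0) \<le> (\<Sum>j\<in>{j0..<m}. (\<alpha> * \<beta>) ^ j * (C * M * (lam / 2 ^ j) powr (- 1 / K)))
          + (\<alpha> * \<beta>) ^ m * norm (I m)" if "j0 \<le> m" "m \<le> Suc n" for m
        using that
      proof (induction m rule: dec_induct)
        case (step m)
        have "(\<alpha> * \<beta>) ^ m * norm (I m) \<le> (\<alpha> * \<beta>) ^ m * (C * M * (lam / 2 ^ m) powr (- 1 / K) + \<alpha> * \<beta> * norm (I (Suc m)))"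
          using step_le[of m] step \<alpha> \<beta> by (intro mult_left_mono) auto
        then show ?case using step by (simp add: algebra_simps)
      qed simp
      have I_bound: "norm (I j) \<le> 4 * M" for j
      proof -
        have inner: "norm (integral {-1..1} (\<lambda>y. F (\<alpha> ^ j * x, \<beta> ^ j * y))) \<le> M * (1 - (-1))" if x: "x \<in> {-1..1}" for x
        proof (rule norm_integral_le)
          fix y :: real assume y: "y \<in> {-1..1}"
          have "\<alpha> ^ j * \<bar>x\<bar> \<le> 1" "\<beta> ^ j * \<bar>y\<bar> \<le> 1" using x y \<alpha> \<beta> by (auto intro!: mult_le_one power_le_one)
          then have "(\<alpha> ^ j * x, \<beta> ^ j * y) \<in> unit_square" using \<alpha> \<beta> by (simp add: abs_mult)
          then show "norm (F (\<alpha> ^ j * x, \<beta> ^ j * y)) \<le> M" using M(2) by (simp add: F_def norm_mult)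
        qed simp
        have "norm (integral {-1..1} (\<lambda>x. integral {-1..1} (\<lambda>y. F (\<alpha> ^ j * x, \<beta> ^ j * y)))) \<le> (M * (1 - (-1))) * (1 - (-1))"
          by (rule norm_integral_le[OF _ inner]) auto
        moreover have "I j = integral {-1..1} (\<lambda>x. integral {-1..1} (\<lambda>y. F (\<alpha> ^ j * x, \<beta> ^ j * y)))"
          unfolding I_def unit_square_def
          by (subst integral_rectangle_yx[OF continuous_on_subset[OF Fjc]]) auto
        ultimately show ?thesis by simp
      qed
      have "norm (osc_integral S \<phi> lam) = (\<alpha> * \<beta>) ^ j0 * norm (I j0)"
        using \<alpha> \<beta> by (simp add: J norm_mult norm_power)
      also have "\<dots> \<le> (\<Sum>j\<in>{j0..<Suc n}. (\<alpha> * \<beta>) ^ j * (C * M * (lam / 2 ^ j) powr (- 1 / K))) + (\<alpha> * \<beta>) ^ Suc n * norm (I (Suc n))"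
        using n by (intro iter) auto
      also have "\<dots> \<le> (\<Sum>j\<le>n. (\<alpha> * \<beta>) ^ j * (C * M * (lam / 2 ^ j) powr (- 1 / K))) + (\<alpha> * \<beta>) ^ Suc n * (4 * M)"
        using \<alpha> \<beta> C M(1) I_bound by (intro add_mono sum_mono2 mult_left_mono) auto
      also have "\<dots> = C * M * (\<Sum>j\<le>n. (\<alpha> * \<beta>) ^ j * (lam / 2 ^ j) powr (- 1 / K)) + 4 * M * (\<alpha> * \<beta>) ^ Suc n"
        by (simp add: sum_distrib_left mult_ac)
      also have "\<dots> \<le> (C * M + 4 * M) * (\<Sum>j\<le>n. (\<alpha> * \<beta>) ^ j * (lam / 2 ^ j) powr (- 1 / K)) + (C * M + 4 * M) * (\<alpha> * \<beta>) ^ Suc n"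
        using \<alpha> \<beta> C M(1) by (intro add_mono mult_right_mono sum_nonneg) auto
      finally show "norm (osc_integral S \<phi> lam)
         \<le> (C * M + 4 * M) * ((\<Sum>j\<le>n. (\<alpha> * \<beta>) ^ j * (lam / 2 ^ j) powr (- 1 / K)) + (\<alpha> * \<beta>) ^ Suc n)"
        by (simp only: distrib_left)
    qed (use C M in auto)
  qed
  show ?thesis unfolding \<alpha>\<beta>
    using main V0 V_U by (intro exI[of _ V]) (auto simp: V_def open_box)
qed

subsection \<open>Summation over the dyadic scales\<close>

lemma dyadic_tail_le:
  fixes \<tau> lam :: real
  assumes \<tau>: "\<tau> > 0" and lam: "0 < lam" "lam < 2 ^ Suc n"
  shows "(2 powr - \<tau>) ^ Suc n \<le> lam powr - \<tau>"
proof -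
  have "(2 powr - \<tau>) ^ Suc n = (2 ^ Suc n) powr - \<tau>"
    by (simp only: powr_realpow[symmetric] zero_less_numeral powr_gt_zero powr_powr mult.commute)
  also have "\<dots> \<le> lam powr - \<tau>" using lam \<tau> by (intro powr_mono2') auto
  finally show ?thesis .
qed

text \<open>Here \<tau> = \<kappa> + \<nu> measures the area of the boxes and \<sigma> = 1 / K the
  decay on an annulus. The sum is geometric with ratio 2^(\<sigma> - \<tau>), and the three regimes
  are this ratio above, below or equal to 1.\<close>

lemma dyadic_terms:
  fixes \<tau> \<sigma> lam :: real
  assumes "lam > 0"
  shows "(\<Sum>j\<le>n. (2 powr - \<tau>) ^ j * (lam / 2 ^ j) powr - \<sigma>) = lam powr - \<sigma> * (\<Sum>j\<le>n. (2 powr (\<sigma> - \<tau>)) ^ j)"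
proof -
  have "(2 powr - \<tau>) ^ j * (lam / 2 ^ j) powr - \<sigma> = lam powr - \<sigma> * (2 powr (\<sigma> - \<tau>)) ^ j" for j
  proof -
    have "(2 powr - \<tau>) ^ j = 2 powr (- \<tau> * j)" "(2 powr (\<sigma> - \<tau>)) ^ j = 2 powr ((\<sigma> - \<tau>) * j)"
      by (simp_all add: powr_realpow[symmetric] powr_powr)
    moreover have "(lam / 2 ^ j) powr - \<sigma> = lam powr - \<sigma> * 2 powr (\<sigma> * j)"
      using assms by (simp add: powr_divide powr_realpow[symmetric] powr_powr powr_minus_divide mult.commute)
    ultimately show ?thesis by (simp add: powr_add[symmetric] algebra_simps)
  qed
  then show ?thesis by (simp add: sum_distrib_left)
qed

lemma dyadic_sum_subcritical:
  fixes \<tau> \<sigma> :: real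
  assumes \<tau>: "\<tau> > 0" and \<sigma>: "\<sigma> > \<tau>"
  shows "\<exists>D\<ge>0. \<forall>n lam. 2 ^ n \<le> lam \<and> lam < 2 ^ Suc n \<longrightarrow>
    (\<Sum>j\<le>n. (2 powr - \<tau>) ^ j * (lam / 2 ^ j) powr - \<sigma>) + (2 powr - \<tau>) ^ Suc n \<le> D * lam powr - \<tau>"
proof -
  define q where "q = (2 :: real) powr (\<sigma> - \<tau>)"
  have "2 powr 0 < q" unfolding q_def using \<sigma> by (intro powr_less_mono) auto
  then have q: "q > 1" by simp
  have "(\<Sum>j\<le>n. (2 powr - \<tau>) ^ j * (lam / 2 ^ j) powr - \<sigma>) + (2 powr - \<tau>) ^ Suc n \<le> (q / (q - 1) + 1) * lam powr - \<tau>"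
    if lam: "2 ^ n \<le> lam" "lam < 2 ^ Suc n" for n and lam :: real
  proof -
    have lam0: "lam > 0" using lam(1) by (rule less_le_trans[rotated]) simp
    have "(\<Sum>j\<le>n. q ^ j) = (q ^ Suc n - 1) / (q - 1)"
      using q by (simp add: sum_gp0 divide_simps) (simp add: algebra_simps)
    also have "\<dots> \<le> q ^ Suc n / (q - 1)" using q by (intro divide_right_mono) auto
    also have "\<dots> = q / (q - 1) * q ^ n" by simp
    also have "\<dots> \<le> q / (q - 1) * lam powr (\<sigma> - \<tau>)"
    proof (rule mult_left_mono)
      have "q ^ n = (2 ^ n) powr (\<sigma> - \<tau>)"
        by (simp only: q_def powr_realpow[symmetric] zero_less_numeral powr_gt_zero powr_powr mult.commute)
      also have "\<dots> \<le> lam powr (\<sigma> - \<tau>)" using lam \<sigma> by (intro powr_mono2) auto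
      finally show "q ^ n \<le> lam powr (\<sigma> - \<tau>)" .
    qed (use q in auto)
    finally have "(\<Sum>j\<le>n. q ^ j) \<le> q / (q - 1) * lam powr (\<sigma> - \<tau>)" .
    then have "lam powr - \<sigma> * (\<Sum>j\<le>n. q ^ j) \<le> lam powr - \<sigma> * (q / (q - 1) * lam powr (\<sigma> - \<tau>))"
      by (intro mult_left_mono) auto
    also have "\<dots> = q / (q - 1) * (lam powr - \<sigma> * lam powr (\<sigma> - \<tau>))" by (simp only: mult_ac)
    also have "lam powr - \<sigma> * lam powr (\<sigma> - \<tau>) = lam powr - \<tau>" by (simp add: powr_add[symmetric])
    finally show ?thesis
      using dyadic_tail_le[OF \<tau> lam0 lam(2)] unfolding dyadic_terms[OF lam0] q_def[symmetric]
      by (simp only: distrib_right mult_1_left add_mono)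
  qed
  then show ?thesis using q by (intro exI[of _ "q / (q - 1) + 1"]) auto
qed

lemma dyadic_sum_supercritical:
  fixes \<tau> \<sigma> :: real
  assumes \<sigma>: "\<sigma> > 0" "\<sigma> < \<tau>"
  shows "\<exists>D\<ge>0. \<forall>n lam. 2 ^ n \<le> lam \<and> lam < 2 ^ Suc n \<longrightarrow>
    (\<Sum>j\<le>n. (2 powr - \<tau>) ^ j * (lam / 2 ^ j) powr - \<sigma>) + (2 powr - \<tau>) ^ Suc n \<le> D * lam powr - \<sigma>"
proof -
  define q where "q = (2 :: real) powr (\<sigma> - \<tau>)"
  have "q < 2 powr 0" unfolding q_def using \<sigma> by (intro powr_less_mono) auto
  then have q: "0 < q" "q < 1" by (auto simp: q_def)
  have "(\<Sum>j\<le>n. (2 powr - \<tau>) ^ j * (lam / 2 ^ j) powr - \<sigma>) + (2 powr - \<tau>) ^ Suc n \<le> (1 / (1 - q) + 1) * lam powr - \<sigma>"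
    if lam: "2 ^ n \<le> lam" "lam < 2 ^ Suc n" for n and lam :: real
  proof -
    have lam1: "lam \<ge> 1" using lam(1) by (rule order_trans[rotated]) simp
    have "(\<Sum>j\<le>n. q ^ j) = (1 - q ^ Suc n) / (1 - q)"
      using q by (simp add: sum_gp0)
    also have "\<dots> \<le> 1 / (1 - q)" using q by (intro divide_right_mono) auto
    finally have "lam powr - \<sigma> * (\<Sum>j\<le>n. q ^ j) \<le> lam powr - \<sigma> * (1 / (1 - q))"
      by (intro mult_left_mono) auto
    moreover have "(2 powr - \<tau>) ^ Suc n \<le> lam powr - \<sigma>"
      using dyadic_tail_le[of \<tau> lam n] powr_mono[of "- \<tau>" "- \<sigma>" lam] lam lam1 \<sigma> by linarith
    ultimately show ?thesis
      unfolding dyadic_terms[OF less_le_trans[OF zero_less_one lam1]] q_def[symmetric] by (simp add: algebra_simps)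
  qed
  then show ?thesis using q by (intro exI[of _ "1 / (1 - q) + 1"]) auto
qed

lemma dyadic_sum_critical:
  fixes \<tau> :: real
  assumes \<tau>: "\<tau> > 0"
  shows "\<exists>D\<ge>0. \<forall>n lam. lam \<ge> 3 \<and> 2 ^ n \<le> lam \<and> lam < 2 ^ Suc n \<longrightarrow>
    (\<Sum>j\<le>n. (2 powr - \<tau>) ^ j * (lam / 2 ^ j) powr - \<tau>) + (2 powr - \<tau>) ^ Suc n \<le> D * (lam powr - \<tau> * ln lam)"
proof -
  have "(\<Sum>j\<le>n. (2 powr - \<tau>) ^ j * (lam / 2 ^ j) powr - \<tau>) + (2 powr - \<tau>) ^ Suc n \<le> (1 / ln 2 + 2) * (lam powr - \<tau> * ln lam)"
    if lam3: "lam \<ge> 3" and lam: "2 ^ n \<le> lam" "lam < 2 ^ Suc n" for n and lam :: real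
  proof -
    have lam0: "lam > 0" using lam3 by simp
    have "exp 1 \<le> lam" using exp_le lam3 by linarith
    then have ln1: "ln lam \<ge> 1" using lam0 by (simp add: ln_ge_iff)
    have "ln (2 ^ n) \<le> ln lam" using lam lam0 by (intro ln_mono) auto
    then have "real n \<le> 1 / ln 2 * ln lam" by (simp add: ln_realpow field_simps)
    \<comment> \<open>The n + 1 equal terms and the tail give n + 2; the 2 is absorbed because lam
      \<ge> 3 forces ln lam \<ge> 1.\<close>
    then have "real n + 2 \<le> (1 / ln 2 + 2) * ln lam" using ln1 by (simp add: distrib_right)
    then have "lam powr - \<tau> * (real n + 2) \<le> lam powr - \<tau> * ((1 / ln 2 + 2) * ln lam)"
      by (intro mult_left_mono) auto
    then show ?thesis
      using dyadic_tail_le[OF \<tau> lam0 lam(2)] unfolding dyadic_terms[OF lam0] by (simp add: algebra_simps)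
  qed
  moreover have "1 / ln 2 + 2 \<ge> (0 :: real)" by simp
  ultimately show ?thesis by (intro exI[of _ "1 / ln 2 + 2"]) auto
qed

section \<open>From dyadic scales to all large frequencies\<close>

lemma dyadic_scale:
  assumes "lam \<ge> (1 :: real)"
  shows "\<exists>n. 2 ^ n \<le> lam \<and> lam < 2 ^ Suc n"
proof -
  define n where "n = nat \<lfloor>log 2 lam\<rfloor>"
  have "log 2 lam \<ge> 0" using assms by simp
  then have n: "real n \<le> log 2 lam" "log 2 lam < real (Suc n)" by (auto simp: n_def; linarith)+
  have "2 powr real n \<le> lam" "lam < 2 powr real (Suc n)"
    using n assms by (auto simp: le_log_iff log_less_iff simp del: of_nat_Suc)
  then show ?thesis by (auto simp only: powr_realpow zero_less_numeral)
qed

text \<open>The scale n is the one with 2^n \<le> lam < 2^(n+1), and lam \<ge> 2^j0 makes it at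
  least j0. The added 1 turns the estimate into a strict one, because h is positive.\<close>

lemma eventually_bound_of_dyadic:
  fixes N h :: "real \<Rightarrow> real" and g :: "nat \<Rightarrow> real \<Rightarrow> real"
  assumes N: "\<And>n lam. n \<ge> j0 \<Longrightarrow> lam \<ge> 2 ^ n \<Longrightarrow> N lam \<le> C * g n lam" and C: "C \<ge> 0"
    and g: "\<And>n lam. lam \<ge> 3 \<Longrightarrow> 2 ^ n \<le> lam \<Longrightarrow> lam < 2 ^ Suc n \<Longrightarrow> g n lam \<le> D * h lam"
    and h: "\<And>lam. lam \<ge> 3 \<Longrightarrow> h lam > 0"
  shows "\<forall>\<^sub>F lam in at_top. N lam < (C * D + 1) * h lam"
  using eventually_ge_at_top[of "max 3 (2 ^ j0)"]
proof eventually_elim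
  case (elim lam)
  then have lam: "lam \<ge> 3" "2 ^ j0 \<le> lam" by auto
  obtain n where n: "2 ^ n \<le> lam" "lam < 2 ^ Suc n" using dyadic_scale[of lam] lam by auto
  have "(2 :: real) ^ j0 < 2 ^ Suc n" using lam n by linarith
  then have "j0 < Suc n" by (simp only: power_strict_increasing_iff one_less_numeral_iff semiring_norm)
  then have "N lam \<le> C * g n lam" using n by (intro N) auto
  also have "\<dots> \<le> C * (D * h lam)" using g[OF lam(1) n] C by (intro mult_left_mono)
  also have "\<dots> < (C * D + 1) * h lam" using h[OF lam(1)] by (simp add: algebra_simps)
  finally show ?case .
qed

text \<open>V is chosen before \<phi> and C after it: a sufficiently small support is one condition
  for all cutoffs, while the constant may depend on the cutoff.\<close>

definition local_decay :: "(real \<times> real) set \<Rightarrow> (real \<times> real \<Rightarrow> real) \<Rightarrow> (real \<Rightarrow> real) \<Rightarrow> bool" where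
  "local_decay U S h \<longleftrightarrow> (\<exists>V. open V \<and> (0, 0) \<in> V \<and> V \<subseteq> U \<and> (\<forall>\<phi>. smooth_on UNIV \<phi> \<and> supp \<phi> \<subseteq> V \<longrightarrow>
     (\<exists>C. \<forall>\<^sub>F lam in at_top. norm (osc_integral S \<phi> lam) < C * h lam)))"

lemma local_decay_of_weights:
  fixes \<kappa> \<nu> :: real and K :: nat
  assumes U: "open U" and p: "(0, 0) \<in> U" and S: "smooth_on U S"
    and \<kappa>: "\<kappa> > 0" and \<nu>: "\<nu> > 0"
    and supp: "\<And>a b. taylor_coeff S a b \<noteq> 0 \<Longrightarrow> \<kappa> * real a + \<nu> * real b \<ge> 1"
    and K: "K \<ge> 1"
    and nondeg: "\<And>x y. (x, y) \<noteq> (0, 0) \<Longrightarrow>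
        \<exists>k\<le>K. principal_x \<kappa> \<nu> S k x y \<noteq> 0 \<or> principal_y \<kappa> \<nu> S k x y \<noteq> 0"
  shows "1 / K > \<kappa> + \<nu> \<Longrightarrow> local_decay U S (\<lambda>lam. lam powr - (\<kappa> + \<nu>))"
    and "1 / K < \<kappa> + \<nu> \<Longrightarrow> local_decay U S (\<lambda>lam. lam powr - (1 / K))"
    and "1 / K = \<kappa> + \<nu> \<Longrightarrow> local_decay U S (\<lambda>lam. lam powr - (1 / K) * ln lam)"
proof -
  let ?g = "\<lambda>n lam. (\<Sum>j\<le>n. (2 powr - (\<kappa> + \<nu>)) ^ j * (lam / 2 ^ j) powr - (1 / K)) + (2 powr - (\<kappa> + \<nu>)) ^ Suc n"
  obtain V where V: "open V" "(0, 0) \<in> V" "V \<subseteq> U" and est: "\<And>\<phi>. smooth_on UNIV \<phi> \<and> supp \<phi> \<subseteq> V \<Longrightarrow>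
    \<exists>C\<ge>0. \<exists>j0. \<forall>n\<ge>j0. \<forall>lam\<ge>2 ^ n. norm (osc_integral S \<phi> lam) \<le> C * ?g n lam"
    using dyadic_estimate[OF U p S \<kappa> \<nu> supp K nondeg] by auto
  have conclude: "local_decay U S h"
    if D: "\<forall>n lam. lam \<ge> 3 \<and> 2 ^ n \<le> lam \<and> lam < 2 ^ Suc n \<longrightarrow> ?g n lam \<le> D * h lam"
      and h: "\<And>lam. lam \<ge> 3 \<Longrightarrow> h lam > 0" for D and h :: "real \<Rightarrow> real"
    unfolding local_decay_def
  proof (intro exI[of _ V] conjI V allI impI)
    fix \<phi> assume "smooth_on UNIV \<phi> \<and> supp \<phi> \<subseteq> V"
    from est[OF this] obtain C j0 where C: "C \<ge> 0"
      and N: "\<And>n lam. n \<ge> j0 \<Longrightarrow> lam \<ge> 2 ^ n \<Longrightarrow> norm (osc_integral S \<phi> lam) \<le> C * ?g n lam" by blast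
    have "\<forall>\<^sub>F lam in at_top. norm (osc_integral S \<phi> lam) < (C * D + 1) * h lam"
      by (rule eventually_bound_of_dyadic[where g="?g" and ?j0.0=j0]) (use N C D h in blast)+
    then show "\<exists>C. \<forall>\<^sub>F lam in at_top. norm (osc_integral S \<phi> lam) < C * h lam" by blast
  qed
  have \<tau>: "\<kappa> + \<nu> > 0" and \<sigma>: "1 / real K > 0" using \<kappa> \<nu> K by auto
  show "local_decay U S (\<lambda>lam. lam powr - (\<kappa> + \<nu>))" if cmp: "1 / K > \<kappa> + \<nu>"
  proof -
    obtain D where "\<forall>n lam. 2 ^ n \<le> lam \<and> lam < 2 ^ Suc n \<longrightarrow> ?g n lam \<le> D * lam powr - (\<kappa> + \<nu>)"
      using dyadic_sum_subcritical[OF \<tau> cmp] by blast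
    then show ?thesis by (intro conclude[of D]) auto
  qed
  show "local_decay U S (\<lambda>lam. lam powr - (1 / K))" if cmp: "1 / K < \<kappa> + \<nu>"
  proof -
    obtain D where "\<forall>n lam. 2 ^ n \<le> lam \<and> lam < 2 ^ Suc n \<longrightarrow> ?g n lam \<le> D * lam powr - (1 / K)"
      using dyadic_sum_supercritical[OF \<sigma> cmp] by blast
    then show ?thesis by (intro conclude[of D]) auto
  qed
  show "local_decay U S (\<lambda>lam. lam powr - (1 / K) * ln lam)" if eq: "1 / K = \<kappa> + \<nu>"
  proof -
    obtain D where "\<forall>n lam. lam \<ge> 3 \<and> 2 ^ n \<le> lam \<and> lam < 2 ^ Suc n \<longrightarrow> ?g n lam \<le> D * (lam powr - (1 / K) * ln lam)"
      using dyadic_sum_critical[OF \<tau>] unfolding eq by blast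
    then show ?thesis by (intro conclude[of D]) auto
  qed
qed

subsection \<open>The Newton polygon\<close>

lemma newton_polygon_convex: "convex (newton_polygon S)"
  by (simp add: newton_polygon_def convex_convex_hull)

lemma quadrant_subset_newton_polygon:
  assumes "taylor_coeff S a b \<noteq> 0" "real a \<le> u" "real b \<le> v"
  shows "(u, v) \<in> newton_polygon S"
  unfolding newton_polygon_def using assms by (intro hull_inc) auto

lemma newton_polygon_minimal:
  assumes "convex A" "\<And>a b u v. taylor_coeff S a b \<noteq> 0 \<Longrightarrow> real a \<le> u \<Longrightarrow> real b \<le> v \<Longrightarrow> (u, v) \<in> A"
  shows "newton_polygon S \<subseteq> A"
  unfolding newton_polygon_def using assms by (intro hull_minimal) auto

text \<open>The translate N - (s, t) of the polygon N is convex and contains all generating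
  quadrants, hence N itself.\<close>

lemma newton_polygon_upward:
  assumes "(u, v) \<in> newton_polygon S" "s \<ge> 0" "t \<ge> 0"
  shows "(u + s, v + t) \<in> newton_polygon S"
proof -
  have "newton_polygon S \<subseteq> (\<lambda>p. p - (s, t)) ` newton_polygon S"
  proof (rule newton_polygon_minimal)
    show "convex ((\<lambda>p. p - (s, t)) ` newton_polygon S)"
      by (intro convex_translation_subtract newton_polygon_convex)
    fix a b u v assume "taylor_coeff S a b \<noteq> 0" "real a \<le> u" "real b \<le> v"
    then have "(u + s, v + t) \<in> newton_polygon S"
      using assms by (intro quadrant_subset_newton_polygon) auto
    then show "(u, v) \<in> (\<lambda>p. p - (s, t)) ` newton_polygon S"
      by (intro image_eqI[of _ _ "(u + s, v + t)"]) auto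
  qed
  then obtain q where "q \<in> newton_polygon S" "(u, v) = q - (s, t)" using assms(1) by blast
  then show ?thesis by (cases q) auto
qed

lemma newton_polygon_nonneg:
  assumes "(u, v) \<in> newton_polygon S"
  shows "u \<ge> 0" "v \<ge> 0"
proof -
  have "convex {p :: real \<times> real. fst p \<ge> 0 \<and> snd p \<ge> 0}"
    by (auto simp: convex_def intro!: add_nonneg_nonneg)
  then have "newton_polygon S \<subseteq> {p. fst p \<ge> 0 \<and> snd p \<ge> 0}"
    by (rule newton_polygon_minimal) (auto intro: order_trans[OF of_nat_0_le_iff])
  then show "u \<ge> 0" "v \<ge> 0" using assms by auto
qed

text \<open>Finds a true exponent of \<open>S\<close> on the part of a supporting line where a
  second linear form is small. Otherwise all quadrants lie in a lexicographic half-plane: above the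
  line, or on it with the second form at least d. This set is convex, so it contains the polygon,
  and the given point contradicts that.\<close>

lemma exponent_on_supporting_line:
  fixes \<kappa> \<nu> \<xi> \<eta> c d :: real
  assumes nonneg: "\<kappa> \<ge> 0" "\<nu> \<ge> 0" "\<xi> \<ge> 0" "\<eta> \<ge> 0"
    and supp: "\<And>a b. taylor_coeff S a b \<noteq> 0 \<Longrightarrow> \<kappa> * real a + \<nu> * real b \<ge> c"
    and p: "(u, v) \<in> newton_polygon S" "\<kappa> * u + \<nu> * v = c" "\<xi> * u + \<eta> * v < d"
  shows "\<exists>a b. taylor_coeff S a b \<noteq> 0 \<and> \<kappa> * real a + \<nu> * real b = c \<and> \<xi> * real a + \<eta> * real b < d"
proof (rule ccontr)
  assume none: "\<not> ?thesis"
  define L M where "L = (\<lambda>p :: real \<times> real. (\<kappa>, \<nu>) \<bullet> p)" and "M = (\<lambda>p :: real \<times> real. (\<xi>, \<eta>) \<bullet> p)"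
  define A where "A = {p. L p > c \<or> L p = c \<and> M p \<ge> d}"
  have "convex A"
  proof (rule convexI)
    fix p q s t assume pq: "p \<in> A" "q \<in> A" and st: "0 \<le> s" "0 \<le> t" "s + t = (1 :: real)"
    have Lc: "L (s *\<^sub>R p + t *\<^sub>R q) = s * L p + t * L q" by (simp add: L_def inner_add_right)
    have Mc: "M (s *\<^sub>R p + t *\<^sub>R q) = s * M p + t * M q" by (simp add: M_def inner_add_right)
    have ge: "L p \<ge> c" "L q \<ge> c" using pq by (auto simp: A_def)
    have dec: "s * L p + t * L q - c = s * (L p - c) + t * (L q - c)" "s * M p + t * M q - d = s * (M p - d) + t * (M q - d)"
      using st(3) by (simp_all add: algebra_simps flip: distrib_left)
    show "s *\<^sub>R p + t *\<^sub>R q \<in> A"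
    \<comment> \<open>The first form decides unless both weighted excesses vanish; then each
      endpoint with positive weight lies on the line, and the second form decides.\<close>
    proof (cases "s * (L p - c) + t * (L q - c) = 0")
      case False
      have "0 \<le> s * (L p - c) + t * (L q - c)" using ge st by (intro add_nonneg_nonneg mult_nonneg_nonneg) auto
      then show ?thesis using False dec(1) by (simp add: A_def Lc)
    next
      case True
      have z: "s * (L p - c) \<ge> 0" "t * (L q - c) \<ge> 0" using ge st by auto
      with True have "s * (L p - c) = 0" "t * (L q - c) = 0" by linarith+
      then have "s * (M p - d) \<ge> 0" "t * (M q - d) \<ge> 0" using pq st by (auto simp: A_def)
      then show ?thesis using True dec by (simp add: A_def Lc Mc)
    qed
  qed
  then have "newton_polygon S \<subseteq> A"
  proof (rule newton_polygon_minimal)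
    fix a b u v assume s: "taylor_coeff S a b \<noteq> 0" and uv: "real a \<le> u" "real b \<le> v"
    have mono: "\<kappa> * real a \<le> \<kappa> * u" "\<nu> * real b \<le> \<nu> * v" "\<xi> * real a \<le> \<xi> * u" "\<eta> * real b \<le> \<eta> * v"
      using uv nonneg by (auto intro: mult_left_mono)
    show "(u, v) \<in> A"
    proof (cases "\<kappa> * real a + \<nu> * real b = c")
      case True
      then have "\<not> \<xi> * real a + \<eta> * real b < d" using none s by blast
      then show ?thesis using mono True by (auto simp: A_def L_def M_def)
    next
      case False
      then show ?thesis using mono supp[OF s] by (auto simp: A_def L_def)
    qed
  qed
  then show False using p by (auto simp: A_def L_def M_def)
qed

lemma principal_single:
  assumes fin: "\<kappa> > 0" "\<nu> > 0" and ab: "(a, b) \<in> weight_line \<kappa> \<nu>"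
    and single: "\<And>a' b'. (a', b') \<in> weight_line \<kappa> \<nu> \<Longrightarrow> taylor_coeff S a' b' \<noteq> 0 \<Longrightarrow> a' = a \<and> b' = b"
  shows "principal_x \<kappa> \<nu> S k x y = taylor_coeff S a b * real (a choose k) * x ^ (a - k) * y ^ b"
    and "principal_y \<kappa> \<nu> S k x y = taylor_coeff S a b * real (b choose k) * x ^ a * y ^ (b - k)"
proof -
  have "(\<Sum>(a, b)\<in>weight_line \<kappa> \<nu>. taylor_coeff S a b * real (a choose k) * x ^ (a - k) * y ^ b)
    = (\<Sum>(a, b)\<in>{(a, b)}. taylor_coeff S a b * real (a choose k) * x ^ (a - k) * y ^ b)"
    using finite_weight_line[OF fin] ab single by (intro sum.mono_neutral_right) fastforce+
  then show "principal_x \<kappa> \<nu> S k x y = taylor_coeff S a b * real (a choose k) * x ^ (a - k) * y ^ b"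
    by (simp add: principal_x_def)
  have "(\<Sum>(a, b)\<in>weight_line \<kappa> \<nu>. taylor_coeff S a b * real (b choose k) * x ^ a * y ^ (b - k))
    = (\<Sum>(a, b)\<in>{(a, b)}. taylor_coeff S a b * real (b choose k) * x ^ a * y ^ (b - k))"
    using finite_weight_line[OF fin] ab single by (intro sum.mono_neutral_right) fastforce+
  then show "principal_y \<kappa> \<nu> S k x y = taylor_coeff S a b * real (b choose k) * x ^ a * y ^ (b - k)"
    by (simp add: principal_y_def)
qed

text \<open>The line through (a, b) with weights r and s meets the exponents of \<open>S\<close>
  only there, so after division by its value the principal part is one monomial. Where x is nonzero
  its b-th y-derivative does not vanish, and where x = 0, away from the origin, its a-th
  x-derivative. The two conclusions correspond to (D, D) lying above the line and on it.\<close>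

lemma local_decay_isolated_exponent:
  fixes r s :: real
  assumes U: "open U" and p: "(0, 0) \<in> U" and S: "smooth_on U S"
    and coeff: "taylor_coeff S a b \<noteq> 0" and rs: "r > 0" "s > 0"
    and strict: "\<And>a' b'. taylor_coeff S a' b' \<noteq> 0 \<Longrightarrow> (a', b') \<noteq> (a, b) \<Longrightarrow>
          r * real a' + s * real b' > r * real a + s * real b"
    and D: "a \<le> D" "b \<le> D" and w0: "r * real a + s * real b > 0"
  shows "r * real a + s * real b < (r + s) * real D \<Longrightarrow> local_decay U S (\<lambda>lam. lam powr - (1 / D))"
    and "r * real a + s * real b = (r + s) * real D \<Longrightarrow> local_decay U S (\<lambda>lam. lam powr - (1 / D) * ln lam)"
proof -
  define w where "w = r * real a + s * real b"
  define \<kappa> \<nu> where "\<kappa> = r / w" and "\<nu> = s / w"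
  have w: "w > 0" using w0 by (simp add: w_def)
  have pos: "\<kappa> > 0" "\<nu> > 0" using w rs by (auto simp: \<kappa>_def \<nu>_def)
  have val: "\<kappa> * real a' + \<nu> * real b' = (r * real a' + s * real b') / w" for a' b'
    by (simp add: \<kappa>_def \<nu>_def add_divide_distrib)
  have ab: "\<kappa> * real a + \<nu> * real b = 1" unfolding val w_def[symmetric] using w by simp
  have gt: "\<kappa> * real a' + \<nu> * real b' > 1" if "taylor_coeff S a' b' \<noteq> 0" "(a', b') \<noteq> (a, b)" for a' b'
    unfolding val using strict[OF that] w by (simp add: less_divide_eq w_def)
  have supp: "\<kappa> * real a' + \<nu> * real b' \<ge> 1" if "taylor_coeff S a' b' \<noteq> 0" for a' b'
    using gt[OF that] ab by (cases "(a', b') = (a, b)") auto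
  have line: "(a, b) \<in> weight_line \<kappa> \<nu>" using ab by (simp add: weight_line_def)
  have single: "a' = a \<and> b' = b" if "(a', b') \<in> weight_line \<kappa> \<nu>" "taylor_coeff S a' b' \<noteq> 0" for a' b'
    using gt[OF that(2)] that(1) by (fastforce simp: weight_line_def)
  note princ = principal_single[OF pos line single]
  have nondeg: "\<exists>k\<le>D. principal_x \<kappa> \<nu> S k x y \<noteq> 0 \<or> principal_y \<kappa> \<nu> S k x y \<noteq> 0" if "(x, y) \<noteq> (0, 0)" for x y
  proof (cases "x = 0")
    case True
    then show ?thesis using that coeff D by (intro exI[of _ a]) (auto simp: princ)
  next
    case False
    then show ?thesis using coeff D by (intro exI[of _ b]) (auto simp: princ)
  qed
  have D1: "D \<ge> 1" using D w0 by (cases D) auto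
  have sum: "\<kappa> + \<nu> = (r + s) / w" by (simp add: \<kappa>_def \<nu>_def add_divide_distrib)
  show "local_decay U S (\<lambda>lam. lam powr - (1 / D))" if "r * real a + s * real b < (r + s) * real D"
  proof -
    have lt: "1 / real D < \<kappa> + \<nu>" unfolding sum using that w D1 by (simp add: w_def[symmetric] field_simps)
    show ?thesis by (rule local_decay_of_weights(2)[OF U p S pos supp D1 nondeg]) (use lt in auto)
  qed
  show "local_decay U S (\<lambda>lam. lam powr - (1 / D) * ln lam)" if "r * real a + s * real b = (r + s) * real D"
  proof -
    have eq: "1 / real D = \<kappa> + \<nu>" unfolding sum using that w D1 by (simp add: w_def[symmetric] field_simps)
    show ?thesis by (rule local_decay_of_weights(3)[OF U p S pos supp D1 nondeg]) (use eq in auto)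
  qed
qed

subsection \<open>The bisectrix meets a vertex\<close>

lemma open_segmentI:
  fixes a b x :: "'a::real_vector"
  assumes "a \<noteq> b" "0 < u" "u < 1" "x = (1 - u) *\<^sub>R a + u *\<^sub>R b"
  shows "x \<in> open_segment a b"
  unfolding in_segment using assms by blast

text \<open>The task is a line x + s y = const that touches the exponents only at the vertex.
  Exponents to the left of it bound s from below, those under it bound s from above, and convexity
  makes the bounds compatible. Only the finitely many columns a < D and rows b < D matter, and in
  each the least exponent.\<close>

lemma local_decay_vertex:
  assumes U: "open U" and p: "(0, 0) \<in> U" and S: "smooth_on U S"
    and d: "newton_distance S > 1" and vertex: "bisectrix_at_vertex S"
  shows "local_decay U S (\<lambda>lam. lam powr (- 1 / newton_distance S) * ln lam)"
proof -
  define d where "d = newton_distance S"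
  have extreme: "(d, d) extreme_point_of newton_polygon S"
    using vertex by (simp add: bisectrix_at_vertex_def bisectrix_point_def d_def)
  have noseg: "(d, d) \<notin> open_segment q r" if "q \<in> newton_polygon S" "r \<in> newton_polygon S" for q r
    using extreme that by (auto simp: extreme_point_of_def)
  \<comment> \<open>Otherwise the vertex would be the midpoint of the exponent and its reflection in
    the vertex, which lies in the quadrant of that exponent.\<close>
  have below: "real a = d \<and> real b = d" if s: "taylor_coeff S a b \<noteq> 0" and le: "real a \<le> d" "real b \<le> d" for a b
  proof (rule ccontr)
    assume ne: "\<not> ?thesis"
    have q: "(real a, real b) \<in> newton_polygon S" using s by (intro quadrant_subset_newton_polygon) auto
    have r: "(2 * d - real a, 2 * d - real b) \<in> newton_polygon S" using s le by (intro quadrant_subset_newton_polygon) auto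
    have "(d, d) \<in> open_segment (real a, real b) (2 * d - real a, 2 * d - real b)"
      by (rule open_segmentI[where u="1/2"]) (use ne in \<open>auto simp: field_simps\<close>)
    then show False using noseg[OF q r] by blast
  qed
  obtain D where coeff: "taylor_coeff S D D \<noteq> 0" and D: "real D = d"
  proof -
    have "(d, d) \<in> (\<Union>(a, b) \<in> {(a, b). taylor_coeff S a b \<noteq> 0}. {(t1, t2). t1 \<ge> real a \<and> t2 \<ge> real b})"
      using extreme unfolding newton_polygon_def by (rule extreme_point_of_convex_hull)
    then obtain a b where ab: "taylor_coeff S a b \<noteq> 0" "real a \<le> d" "real b \<le> d" by auto
    have "a = b" "real a = d" using below[OF ab] by auto
    then show ?thesis using ab that by blast
  qed
  have left_above: "b > D" if "taylor_coeff S a b \<noteq> 0" "a < D" for a b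
    using below[OF that(1)] that(2) D by (cases "b \<le> D") auto
  have right_above: "a > D" if "taylor_coeff S a b \<noteq> 0" "b < D" for a b
    using below[OF that(1)] that(2) D by (cases "a \<le> D") auto
  have cross: "(real D - real a) * (real D - real b') < (real a' - real D) * (real b - real D)"
    if l: "taylor_coeff S a b \<noteq> 0" "a < D" and r: "taylor_coeff S a' b' \<noteq> 0" "b' < D" for a b a' b'
  proof (rule ccontr)
    assume "\<not> ?thesis"
    then have le: "(real a' - real D) * (real b - real D) \<le> (real D - real a) * (real D - real b')" by simp
    have pos: "real D - real a > 0" "real b - real D > 0" "real a' - real D > 0" "real D - real b' > 0"
      using l r left_above[OF l] right_above[OF r] by auto
    \<comment> \<open>The height at abscissa a' of the line through (a, b) and the vertex. If the
      bounds on s were incompatible, (a', y) would lie in the quadrant of (a', b'), and the vertex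
      strictly inside a segment of the polygon.\<close>
    define y where "y = real D - (real a' - real D) * (real b - real D) / (real D - real a)"
    have "(real a' - real D) * (real b - real D) / (real D - real a) \<le> real D - real b'"
      using le pos by (simp add: pos_divide_le_eq mult.commute)
    then have y: "y \<ge> real b'" by (simp add: y_def)
    have q1: "(real a, real b) \<in> newton_polygon S" using l by (intro quadrant_subset_newton_polygon) auto
    have q2: "(real a', y) \<in> newton_polygon S" using r y by (intro quadrant_subset_newton_polygon) auto
    define u where "u = (real D - real a) / (real a' - real a)"
    have u: "0 < u" "u < 1" using pos by (auto simp: u_def divide_simps)
    have u1: "(1 - u) * real a + u * real a' = real D"
    proof -
      have "(1 - u) * real a + u * real a' = real a + u * (real a' - real a)" by (simp add: algebra_simps)
      then show ?thesis using pos by (simp add: u_def)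
    qed
    have "u * (real D - y) = (1 - u) * (real b - real D)"
    proof -
      have 1: "1 - u = (real a' - real D) / (real a' - real a)" using pos by (simp add: u_def field_simps)
      show ?thesis unfolding 1 using pos by (simp add: u_def y_def)
    qed
    then have "(1 - u) * real b + u * y = real D" by (simp add: algebra_simps)
    then have eq: "(d, d) = (1 - u) *\<^sub>R (real a, real b) + u *\<^sub>R (real a', y)" using u1 D by simp
    have "(real a, real b) \<noteq> (real a', y)" using pos by auto
    from open_segmentI[OF this u eq] show False using noseg[OF q1 q2] by simp
  qed
  define B where "B = (\<lambda>a. LEAST b. taylor_coeff S a b \<noteq> 0)"
  define A where "A = (\<lambda>b. LEAST a. taylor_coeff S a b \<noteq> 0)"
  \<comment> \<open>The inserted 0 makes s positive, and \<open>Max lo + 1\<close> in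
    \<open>hi\<close> keeps that set nonempty when no exponent lies below the vertex.\<close>
  define lo where "lo = insert 0 ((\<lambda>a. (real D - real a) / (real (B a) - real D)) ` {a. a < D \<and> (\<exists>b. taylor_coeff S a b \<noteq> 0)})"
  define hi where "hi = insert (Max lo + 1) ((\<lambda>b. (real (A b) - real D) / (real D - real b)) ` {b. b < D \<and> (\<exists>a. taylor_coeff S a b \<noteq> 0)})"
  have B: "taylor_coeff S a (B a) \<noteq> 0" "B a \<le> b" if "taylor_coeff S a b \<noteq> 0" for a b
    using LeastI[of "\<lambda>b. taylor_coeff S a b \<noteq> 0" b] Least_le[of "\<lambda>b. taylor_coeff S a b \<noteq> 0" b] that by (simp_all add: B_def)
  have A: "taylor_coeff S (A b) b \<noteq> 0" "A b \<le> a" if "taylor_coeff S a b \<noteq> 0" for a b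
    using LeastI[of "\<lambda>a. taylor_coeff S a b \<noteq> 0" a] Least_le[of "\<lambda>a. taylor_coeff S a b \<noteq> 0" a] that by (simp_all add: A_def)
  have fin: "finite lo" "finite hi" by (auto simp: lo_def hi_def)
  have ne: "lo \<noteq> {}" "hi \<noteq> {}" by (auto simp: lo_def hi_def)
  have gap: "l < h" if l: "l \<in> lo" and h: "h \<in> hi" for l h
  proof (cases "h = Max lo + 1")
    case True
    then show ?thesis using Max_ge[OF fin(1) l] by simp
  next
    case False
    then obtain b' a'' where b': "b' < D" "taylor_coeff S a'' b' \<noteq> 0" and h_eq: "h = (real (A b') - real D) / (real D - real b')"
      using h by (auto simp: hi_def)
    note r = A(1)[OF b'(2)]
    have rpos: "A b' > D" using right_above[OF r b'(1)] .
    show ?thesis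
    proof (cases "l = 0")
      case True
      then show ?thesis using h_eq rpos b'(1) by simp
    next
      case False
      then obtain a b'' where a: "a < D" "taylor_coeff S a b'' \<noteq> 0" and l_eq: "l = (real D - real a) / (real (B a) - real D)"
        using l by (auto simp: lo_def)
      note l' = B(1)[OF a(2)]
      have lpos: "B a > D" using left_above[OF l' a(1)] .
      show ?thesis using cross[OF l' a(1) r b'(1)] lpos b'(1) unfolding l_eq h_eq
        by (simp add: divide_less_eq less_divide_eq pos_divide_less_eq pos_less_divide_eq mult.commute)
    qed
  qed
  define s where "s = (Max lo + Min hi) / 2"
  have "Max lo < Min hi" using gap fin ne by simp
  then have s: "Max lo < s" "s < Min hi" by (auto simp: s_def)
  have s0: "s > 0" using s(1) Max_ge[OF fin(1), of 0] by (simp add: lo_def)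
  have strict: "real a + s * real b > (1 + s) * real D" if ab: "taylor_coeff S a b \<noteq> 0" "(a, b) \<noteq> (D, D)" for a b
  proof -
    consider "a < D" | "b < D" | "a \<ge> D" "b \<ge> D" by linarith
    then show ?thesis
    proof cases
      case 1
      have Ba: "B a > D" "B a \<le> b" using left_above[OF B(1)[OF ab(1)] 1] B(2)[OF ab(1)] by auto
      have "(real D - real a) / (real (B a) - real D) \<in> lo" using 1 ab by (auto simp: lo_def)
      then have "(real D - real a) / (real (B a) - real D) < s" using Max_ge[OF fin(1)] s(1) by force
      then have "real D - real a < s * (real (B a) - real D)" using Ba by (simp add: pos_divide_less_eq)
      also have "\<dots> \<le> s * (real b - real D)" using Ba s0 by (intro mult_left_mono) auto
      finally show ?thesis by (simp add: algebra_simps)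
    next
      case 2
      have Ab: "A b > D" "A b \<le> a" using right_above[OF A(1)[OF ab(1)] 2] A(2)[OF ab(1)] by auto
      have "(real (A b) - real D) / (real D - real b) \<in> hi" using 2 ab by (auto simp: hi_def)
      then have "s < (real (A b) - real D) / (real D - real b)" using Min_le[OF fin(2)] s(2) by force
      then have "s * (real D - real b) < real (A b) - real D" using 2 by (simp add: pos_less_divide_eq)
      also have "\<dots> \<le> real a - real D" using Ab by simp
      finally show ?thesis by (simp add: algebra_simps)
    next
      case 3
      then have "a > D \<or> b > D" using ab(2) by auto
      then show ?thesis
      proof
        assume "a > D"
        then have "real a > real D" "s * real b \<ge> s * real D" using 3 s0 by auto
        then show ?thesis by (simp add: distrib_right)
      next
        assume "b > D"
        then have "real a \<ge> real D" "s * real b > s * real D" using 3 s0 by auto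
        then show ?thesis by (simp add: distrib_right)
      qed
    qed
  qed
  have D1: "D \<ge> 1" using D d by (simp add: d_def)
  have "local_decay U S (\<lambda>lam. lam powr - (1 / D) * ln lam)"
    by (rule local_decay_isolated_exponent(2)[OF U p S coeff zero_less_one s0, where D=D])
      (use strict D1 s0 in \<open>auto simp: distrib_right intro!: add_pos_pos\<close>)
  then show ?thesis using D by (simp add: d_def)
qed

subsection \<open>The bisectrix meets an unbounded ray\<close>

text \<open>The horizontal line is tilted about its leftmost exponent (a0, D): with weights 1 and a0
  + 1, one step up outweighs all a0 steps to the left, so the tilted line touches only there. As a0
  < D, the point (D, D) is strictly above it.\<close>

lemma local_decay_horizontal:
  fixes D :: nat
  assumes U: "open U" and p: "(0, 0) \<in> U" and S: "smooth_on U S"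
    and above: "\<And>a b. taylor_coeff S a b \<noteq> 0 \<Longrightarrow> b \<ge> D"
    and ex: "taylor_coeff S a D \<noteq> 0" "a < D"
  shows "local_decay U S (\<lambda>lam. lam powr - (1 / D))"
proof -
  define a0 where "a0 = (LEAST a. taylor_coeff S a D \<noteq> 0)"
  have coeff: "taylor_coeff S a0 D \<noteq> 0" and least: "\<And>a. taylor_coeff S a D \<noteq> 0 \<Longrightarrow> a0 \<le> a"
    unfolding a0_def by (rule LeastI[of _ a], rule ex) (rule Least_le)
  have a0: "a0 < D" using least[OF ex(1)] ex(2) by simp
  have gt: "1 * real a + (real a0 + 1) * real b > 1 * real a0 + (real a0 + 1) * real D"
    if "taylor_coeff S a b \<noteq> 0" "(a, b) \<noteq> (a0, D)" for a b
  proof (cases "b = D")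
    case True
    then show ?thesis using least[of a] that by auto
  next
    case False
    then have "real D + 1 \<le> real b" using above[OF that(1)] by simp
    then have "(real a0 + 1) * (real D + 1) \<le> (real a0 + 1) * real b" by (intro mult_left_mono) auto
    then show ?thesis by (simp add: algebra_simps)
  qed
  have w0: "1 * real a0 + (real a0 + 1) * real D > 0"
    using a0 by (intro add_nonneg_pos mult_pos_pos) auto
  have s0: "real a0 + 1 > 0" and "a0 \<le> D" using a0 by auto
  from local_decay_isolated_exponent(1)[OF U p S coeff zero_less_one s0 gt this(2) order_refl w0]
  show ?thesis using a0 by (simp add: algebra_simps)
qed

lemma local_decay_vertical:
  fixes D :: nat
  assumes U: "open U" and p: "(0, 0) \<in> U" and S: "smooth_on U S"
    and above: "\<And>a b. taylor_coeff S a b \<noteq> 0 \<Longrightarrow> a \<ge> D"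
    and ex: "taylor_coeff S D b \<noteq> 0" "b < D"
  shows "local_decay U S (\<lambda>lam. lam powr - (1 / D))"
proof -
  define b0 where "b0 = (LEAST b. taylor_coeff S D b \<noteq> 0)"
  have coeff: "taylor_coeff S D b0 \<noteq> 0" and least: "\<And>b. taylor_coeff S D b \<noteq> 0 \<Longrightarrow> b0 \<le> b"
    unfolding b0_def by (rule LeastI[of _ b], rule ex) (rule Least_le)
  have b0: "b0 < D" using least[OF ex(1)] ex(2) by simp
  have gt: "(real b0 + 1) * real a + 1 * real b > (real b0 + 1) * real D + 1 * real b0"
    if "taylor_coeff S a b \<noteq> 0" "(a, b) \<noteq> (D, b0)" for a b
  proof (cases "a = D")
    case True
    then show ?thesis using least[of b] that by auto
  next
    case False
    then have "real D + 1 \<le> real a" using above[OF that(1)] by simp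
    then have "(real b0 + 1) * (real D + 1) \<le> (real b0 + 1) * real a" by (intro mult_left_mono) auto
    then show ?thesis by (simp add: algebra_simps)
  qed
  have w0: "(real b0 + 1) * real D + 1 * real b0 > 0"
    using b0 by (intro add_pos_nonneg[OF mult_pos_pos]) auto
  have s0: "real b0 + 1 > 0" and "b0 \<le> D" using b0 by auto
  from local_decay_isolated_exponent(1)[OF U p S coeff s0 zero_less_one gt order_refl this(2) w0]
  show ?thesis using b0 by (simp add: algebra_simps)
qed

subsection \<open>The bisectrix meets the interior of a compact edge\<close>

lemma weight_line_inj:
  assumes "\<kappa> > 0" "\<nu> > 0" "(a, b) \<in> weight_line \<kappa> \<nu>" "(a', b') \<in> weight_line \<kappa> \<nu>" "(a, b) \<noteq> (a', b')"
  shows "a \<noteq> a'" "b \<noteq> b'"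
proof -
  have eq: "\<kappa> * real a + \<nu> * real b = \<kappa> * real a' + \<nu> * real b'"
    using assms(3,4) by (simp add: weight_line_def)
  show "a \<noteq> a'" using eq assms(2,5) by auto
  show "b \<noteq> b'" using eq assms(1,5) by auto
qed

text \<open>Quasi-homogeneity: for (x, y) = (sgn x u^\<kappa>, u^\<nu> t) every monomial on the line
  scales by u, and k derivatives in y take off u^(\<nu> k). This moves every point with x \<noteq> 0
  to x = 1 or x = -1, where superadaptedness applies.\<close>

lemma principal_y_rescale:
  assumes \<kappa>: "\<kappa> > 0" and x: "x \<noteq> 0"
  defines "u \<equiv> \<bar>x\<bar> powr (1 / \<kappa>)"
  shows "principal_y \<kappa> \<nu> S k x y = u powr (1 - \<nu> * real k) * principal_y \<kappa> \<nu> S k (sgn x) (y / u powr \<nu>)"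
proof -
  have u: "u > 0" using x by (simp add: u_def)
  have xu: "x = sgn x * u powr \<kappa>"
    using x \<kappa> by (simp add: u_def powr_powr sgn_mult_abs)
  define t where "t = y / u powr \<nu>"
  have yu: "y = u powr \<nu> * t" using u by (simp add: t_def)
  have "taylor_coeff S a b * real (b choose k) * x ^ a * y ^ (b - k)
      = u powr (1 - \<nu> * real k) * (taylor_coeff S a b * real (b choose k) * sgn x ^ a * t ^ (b - k))"
    if ab: "(a, b) \<in> weight_line \<kappa> \<nu>" for a b
  proof (cases "k \<le> b")
    case True
    have "x ^ a * y ^ (b - k) = (sgn x * u powr \<kappa>) ^ a * (u powr \<nu> * t) ^ (b - k)"
      using xu yu by simp
    also have "\<dots> = sgn x ^ a * t ^ (b - k) * ((u powr \<kappa>) ^ a * (u powr \<nu>) ^ (b - k))"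
      by (simp add: power_mult_distrib)
    also have "(u powr \<kappa>) ^ a * (u powr \<nu>) ^ (b - k) = u powr (\<kappa> * real a + \<nu> * real (b - k))"
      using u by (simp add: powr_realpow[symmetric] powr_powr powr_add)
    also have "\<kappa> * real a + \<nu> * real (b - k) = 1 - \<nu> * real k"
      using ab True by (simp add: weight_line_def of_nat_diff algebra_simps)
    finally show ?thesis by (simp add: mult_ac)
  qed auto
  then show ?thesis
    unfolding principal_y_def sum_distrib_left t_def[symmetric] by (intro sum.cong) auto
qed

lemma local_decay_edge:
  fixes \<kappa> \<nu> d :: real
  assumes U: "open U" and p: "(0, 0) \<in> U" and S: "smooth_on U S"
    and pos: "\<kappa> > 0" "\<nu> > 0" and d: "d > 1" "\<kappa> * d + \<nu> * d = 1"
    and supp: "\<And>a b. taylor_coeff S a b \<noteq> 0 \<Longrightarrow> \<kappa> * real a + \<nu> * real b \<ge> 1"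
    and low: "(a1, b1) \<in> weight_line \<kappa> \<nu>" "taylor_coeff S a1 b1 \<noteq> 0" "real b1 < d"
    and left: "(a2, b2) \<in> weight_line \<kappa> \<nu>" "taylor_coeff S a2 b2 \<noteq> 0" "real a2 < d"
    and roots: "\<And>\<sigma> t. \<sigma> \<in> {1, -1} \<Longrightarrow> t \<noteq> 0 \<Longrightarrow> \<exists>k. real k < d \<and> principal_y \<kappa> \<nu> S k \<sigma> t \<noteq> 0"
  shows "local_decay U S (\<lambda>lam. lam powr - (1 / d))"
proof -
  note fin = finite_weight_line[OF pos]
  \<comment> \<open>The greatest integer strictly below d, which is d - 1 for integral d; strictness
    makes 1 / K exceed \<kappa> + \<nu> = 1 / d, so no logarithm appears.\<close>
  define K where "K = nat (\<lceil>d\<rceil> - 1)"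
  have K1: "K \<ge> 1" and Kd: "real K < d" and Kmax: "\<And>k. real k < d \<Longrightarrow> k \<le> K"
    using d(1) unfolding K_def by linarith+
  have eqd: "\<kappa> + \<nu> = 1 / d" using d by (simp add: field_simps)
  \<comment> \<open>At y = 0, exponents with b < b1 are killed by the binomial coefficient and those
    with b > b1 by the power of 0. Since both weights are positive, (a1, b1) is the only exponent on
    the line with b = b1.\<close>
  have y_axis: "principal_y \<kappa> \<nu> S b1 x 0 = taylor_coeff S a1 b1 * x ^ a1" for x
  proof -
    have "(\<Sum>(a, b)\<in>weight_line \<kappa> \<nu>. taylor_coeff S a b * real (b choose b1) * x ^ a * 0 ^ (b - b1))
      = (\<Sum>(a, b)\<in>{(a1, b1)}. taylor_coeff S a b * real (b choose b1) * x ^ a * 0 ^ (b - b1))"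
    proof (intro sum.mono_neutral_right fin ballI)
      fix q assume q: "q \<in> weight_line \<kappa> \<nu> - {(a1, b1)}"
      obtain a b where ab: "q = (a, b)" by (cases q)
      have "b \<noteq> b1" using q weight_line_inj(2)[OF pos _ low(1)] unfolding ab by blast
      then show "(case q of (a, b) \<Rightarrow> taylor_coeff S a b * real (b choose b1) * x ^ a * 0 ^ (b - b1)) = 0"
        by (cases "b < b1") (auto simp: ab)
    qed (use low in auto)
    then show ?thesis by (simp add: principal_y_def)
  qed
  have x_axis: "principal_x \<kappa> \<nu> S a2 0 y = taylor_coeff S a2 b2 * y ^ b2" for y
  proof -
    have "(\<Sum>(a, b)\<in>weight_line \<kappa> \<nu>. taylor_coeff S a b * real (a choose a2) * 0 ^ (a - a2) * y ^ b)
      = (\<Sum>(a, b)\<in>{(a2, b2)}. taylor_coeff S a b * real (a choose a2) * 0 ^ (a - a2) * y ^ b)"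
    proof (intro sum.mono_neutral_right fin ballI)
      fix q assume q: "q \<in> weight_line \<kappa> \<nu> - {(a2, b2)}"
      obtain a b where ab: "q = (a, b)" by (cases q)
      have "a \<noteq> a2" using q weight_line_inj(1)[OF pos _ left(1)] unfolding ab by blast
      then show "(case q of (a, b) \<Rightarrow> taylor_coeff S a b * real (a choose a2) * 0 ^ (a - a2) * y ^ b) = 0"
        by (cases "a < a2") (auto simp: ab)
    qed (use left in auto)
    then show ?thesis by (simp add: principal_x_def)
  qed
  have nondeg: "\<exists>k\<le>K. principal_x \<kappa> \<nu> S k x y \<noteq> 0 \<or> principal_y \<kappa> \<nu> S k x y \<noteq> 0" if xy: "(x, y) \<noteq> (0, 0)" for x y
  proof -
    consider "y = 0" "x \<noteq> 0" | "x = 0" "y \<noteq> 0" | "x \<noteq> 0" "y \<noteq> 0" using xy by auto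
    then show ?thesis
    proof cases
      case 1
      then show ?thesis using Kmax[OF low(3)] low(2) y_axis[of x] by (intro exI[of _ b1]) auto
    next
      case 2
      then show ?thesis using Kmax[OF left(3)] left(2) x_axis[of y] by (intro exI[of _ a2]) auto
    next
      case 3
      define u where "u = \<bar>x\<bar> powr (1 / \<kappa>)"
      have u: "u > 0" using 3 by (simp add: u_def)
      have "sgn x \<in> {1, -1}" "y / u powr \<nu> \<noteq> 0" using 3 u by (auto simp: sgn_if)
      from roots[OF this] obtain k where k: "real k < d" "principal_y \<kappa> \<nu> S k (sgn x) (y / u powr \<nu>) \<noteq> 0"
        by blast
      then have "principal_y \<kappa> \<nu> S k x y \<noteq> 0"
        using principal_y_rescale[OF pos(1) 3(1), of \<nu> S k y] u by (simp add: u_def)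
      then show ?thesis using Kmax[OF k(1)] by blast
    qed
  qed
  have lt: "1 / real K > \<kappa> + \<nu>" unfolding eqd using Kd K1 d(1) by (simp add: frac_less2)
  have "local_decay U S (\<lambda>lam. lam powr - (\<kappa> + \<nu>))"
    by (rule local_decay_of_weights(1)[OF U p S pos supp K1 nondeg]) (use lt in auto)
  then show ?thesis by (simp add: eqd)
qed

text \<open>Coefficients of p(t + y) are derivatives of p at t divided by factorials, the
  normalisation of \<open>principal_y\<close>; this links orders of zeros to nonvanishing
  derivatives.\<close>

lemma pcompose_monom_linear:
  "coeff (pcompose (monom c b) [:t, 1:]) k = c * real (b choose k) * t ^ (b - k)" for c t :: real
proof -
  have "pcompose (monom c b) q = smult c (q ^ b)" for q :: "real poly"
    by (induction b) (simp_all add: monom_0 monom_Suc pcompose_pCons pcompose_const)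
  moreover have "coeff ([:t, 1:] ^ b) k = real (b choose k) * t ^ (b - k)"
  proof (cases "k \<le> b")
    case False
    have "degree ([:t, 1:] ^ b) \<le> b" using degree_power_le[of "[:t, 1:]" b] by simp
    then show ?thesis using False by (simp add: coeff_eq_0)
  qed (simp add: coeff_linear_poly_power)
  ultimately show ?thesis by simp
qed

text \<open>If all coefficients up to the order vanished, a power of y one above the order would
  divide p(t + y); shifting back gives a forbidden power of y - t dividing p.\<close>

lemma taylor_shift_nonzero:
  fixes p :: "real poly"
  assumes "p \<noteq> 0"
  shows "\<exists>k\<le>order t p. coeff (pcompose p [:t, 1:]) k \<noteq> 0"
proof (rule ccontr)
  assume "\<not> ?thesis"
  then have "monom 1 (Suc (order t p)) dvd pcompose p [:t, 1:]"
    by (auto simp: monom_1_dvd_iff' less_Suc_eq_le)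
  then obtain r where r: "pcompose p [:t, 1:] = [:0, 1:] ^ Suc (order t p) * r"
    by (auto simp: monom_altdef elim: dvdE)
  have pow: "pcompose (q ^ n) s = pcompose q s ^ n" for q s :: "real poly" and n
    by (induction n) (simp_all add: pcompose_mult pcompose_1)
  have "p = pcompose (pcompose p [:t, 1:]) [:-t, 1:]"
    by (simp add: pcompose_assoc[symmetric] pcompose_pCons)
  also have "\<dots> = [:-t, 1:] ^ Suc (order t p) * pcompose r [:-t, 1:]"
    unfolding r pcompose_mult pow by (simp add: pcompose_pCons)
  finally have "[:-t, 1:] ^ Suc (order t p) dvd p" by (metis dvd_triv_left)
  then show False using assms by (simp add: order_divides del: power_Suc)
qed

text \<open>The hypotheses say that the edge and the line carry the same exponents of
  \<open>S\<close>; a lattice point of the line outside the edge has coefficient 0.\<close>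

lemma edge_poly_principal:
  assumes pos: "\<kappa> > 0" "\<nu> > 0"
    and sub: "edge_exponents e \<subseteq> weight_line \<kappa> \<nu>"
    and sup: "\<And>a b. (a, b) \<in> weight_line \<kappa> \<nu> \<Longrightarrow> taylor_coeff S a b \<noteq> 0 \<Longrightarrow> (a, b) \<in> edge_exponents e"
  shows "coeff (pcompose (edge_poly S e \<sigma>) [:t, 1:]) k = principal_y \<kappa> \<nu> S k \<sigma> t"
proof -
  have "edge_poly S e \<sigma> = (\<Sum>(a, b)\<in>weight_line \<kappa> \<nu>. monom (taylor_coeff S a b * \<sigma> ^ a) b)"
    unfolding edge_poly_def using finite_weight_line[OF pos] sub sup
    by (intro sum.mono_neutral_left) auto
  then show ?thesis
    by (simp add: pcompose_sum coeff_sum case_prod_beta pcompose_monom_linear principal_y_def mult_ac)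
qed

lemma superadapted_roots:
  assumes pos: "\<kappa> > 0" "\<nu> > 0" and d: "newton_distance S > 0"
    and sa: "superadapted S" and e: "compact_edge S e" "bisectrix_point S \<in> e"
    and sub: "edge_exponents e \<subseteq> weight_line \<kappa> \<nu>"
    and sup: "\<And>a b. (a, b) \<in> weight_line \<kappa> \<nu> \<Longrightarrow> taylor_coeff S a b \<noteq> 0 \<Longrightarrow> (a, b) \<in> edge_exponents e"
    and ex: "(a1, b1) \<in> weight_line \<kappa> \<nu>" "taylor_coeff S a1 b1 \<noteq> 0"
    and \<sigma>: "\<sigma> \<in> {1, -1}" and t: "t \<noteq> 0"
  shows "\<exists>k. real k < newton_distance S \<and> principal_y \<kappa> \<nu> S k \<sigma> t \<noteq> 0"
proof -
  let ?p = "edge_poly S e \<sigma>"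
  note eq = edge_poly_principal[OF pos sub sup]
  \<comment> \<open>The edge polynomial is nonzero, without which its \<open>order\<close> means
    nothing: different exponents on the line have different powers of y, and so no cancellation
    occurs in the coefficient of y^b1.\<close>
  have "coeff ?p b1 = (\<Sum>(a, b)\<in>edge_exponents e. if b = b1 then taylor_coeff S a b * \<sigma> ^ a else 0)"
    by (simp add: edge_poly_def coeff_sum case_prod_beta)
  also have "\<dots> = (\<Sum>(a, b)\<in>{(a1, b1)}. if b = b1 then taylor_coeff S a b * \<sigma> ^ a else 0)"
  proof (intro sum.mono_neutral_right ballI)
    show "finite (edge_exponents e)" using finite_weight_line[OF pos] sub by (rule rev_finite_subset)
    show "{(a1, b1)} \<subseteq> edge_exponents e" using sup[OF ex] by simp
    fix q assume q: "q \<in> edge_exponents e - {(a1, b1)}"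
    obtain a b where ab: "q = (a, b)" by (cases q)
    have "(a, b) \<in> weight_line \<kappa> \<nu>" "(a, b) \<noteq> (a1, b1)" using q sub ab by auto
    then have "b \<noteq> b1" using weight_line_inj(2)[OF pos _ ex(1)] by blast
    then show "(case q of (a, b) \<Rightarrow> if b = b1 then taylor_coeff S a b * \<sigma> ^ a else 0) = 0" by (simp add: ab)
  qed
  finally have "coeff ?p b1 \<noteq> 0" using ex(2) \<sigma> by auto
  then have p0: "?p \<noteq> 0" by auto
  have "real (order t ?p) < newton_distance S"
  proof (cases "poly ?p t = 0")
    case True
    have "\<not> (\<exists>y. y \<noteq> 0 \<and> poly ?p y = 0 \<and> newton_distance S \<le> real (order y ?p))"
      using sa e \<sigma> unfolding superadapted_def by blast
    then show ?thesis using True t by (meson not_le)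
  qed (use d in \<open>simp add: order_0I\<close>)
  moreover obtain k where "k \<le> order t ?p" "principal_y \<kappa> \<nu> S k \<sigma> t \<noteq> 0"
    using taylor_shift_nonzero[OF p0, of t] by (auto simp: eq)
  ultimately show ?thesis by (intro exI[of _ k]) auto
qed

text \<open>The edge has dimension 1 and the polygon dimension 2, so the edge is a proper face and
  (d, d) a relative boundary point, which has a supporting line. The weights are nonnegative because
  the polygon is closed under moving right and up.\<close>

lemma edge_supporting_line:
  assumes e: "e edge_of newton_polygon S" and m: "(d, d) \<in> rel_interior e"
  shows "\<exists>\<kappa> \<nu>. \<kappa> \<ge> 0 \<and> \<nu> \<ge> 0 \<and> (\<kappa>, \<nu>) \<noteq> (0, 0) \<and>
    (\<forall>(u, v)\<in>newton_polygon S. \<kappa> * u + \<nu> * v \<ge> \<kappa> * d + \<nu> * d) \<and> (\<forall>(u, v)\<in>e. \<kappa> * u + \<nu> * v = \<kappa> * d + \<nu> * d)"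
proof -
  have face: "e face_of newton_polygon S" and dim: "aff_dim e = 1" using e by (auto simp: edge_of_def)
  have sub: "e \<subseteq> newton_polygon S" using face by (rule face_of_imp_subset)
  have me: "(d, d) \<in> e" using m rel_interior_subset by blast
  have mN: "(d, d) \<in> newton_polygon S" using me sub by blast
  have "box (d, d) (d + 1, d + 1) \<subseteq> newton_polygon S"
  proof
    fix q assume q: "q \<in> box (d, d) (d + 1, d + 1)"
    obtain u v where uv: "q = (u, v)" by (cases q)
    have "u \<ge> d" "v \<ge> d" using q uv box_subset_cbox[of "(d, d)" "(d + 1, d + 1)"] by (auto simp: cbox_Pair_eq)
    then show "q \<in> newton_polygon S" using newton_polygon_upward[OF mN, of "u - d" "v - d"] uv by simp
  qed
  then have "box (d, d) (d + 1, d + 1) \<subseteq> interior (newton_polygon S)" by (rule interior_maximal) (rule open_box)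
  moreover have "(d + 1/2, d + 1/2) \<in> box (d, d) (d + 1, d + 1)" by (auto simp: box_def Basis_prod_def)
  ultimately have "aff_dim (newton_polygon S) = 2" using aff_dim_nonempty_interior[of "newton_polygon S"] by auto
  then have "e \<noteq> newton_polygon S" using dim by auto
  then have "(d, d) \<notin> rel_interior (newton_polygon S)"
    using face_of_disjoint_rel_interior[OF face] me by blast
  then obtain n where n: "n \<noteq> 0" and ge: "\<And>q. q \<in> newton_polygon S \<Longrightarrow> n \<bullet> (d, d) \<le> n \<bullet> q"
    using supporting_hyperplane_rel_boundary[OF newton_polygon_convex mN] by metis
  obtain \<kappa> \<nu> where nk: "n = (\<kappa>, \<nu>)" by (cases n)
  have "\<kappa> \<ge> 0" using ge[OF newton_polygon_upward[OF mN, of 1 0]] by (simp add: nk algebra_simps)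
  moreover have "\<nu> \<ge> 0" using ge[OF newton_polygon_upward[OF mN, of 0 1]] by (simp add: nk algebra_simps)
  moreover have "\<kappa> * u + \<nu> * v = \<kappa> * d + \<nu> * d" if q: "(u, v) \<in> e" for u v
  proof -
    have "convex e" "e \<noteq> {}" using face me face_of_imp_convex by auto
    \<comment> \<open>The edge extends a little beyond (d, d) on the side away from (u, v). A larger
      value of the linear form at (u, v) would make it drop below its minimum there.\<close>
    then obtain c where c: "c > 1" "(1 - c) *\<^sub>R (u, v) + c *\<^sub>R (d, d) \<in> e"
      using m q convex_rel_interior_iff by blast
    then have "n \<bullet> (d, d) \<le> n \<bullet> ((1 - c) *\<^sub>R (u, v) + c *\<^sub>R (d, d))" using ge sub by blast
    also have "\<dots> = (1 - c) * (n \<bullet> (u, v)) + c * (n \<bullet> (d, d))" by (simp only: inner_add_right inner_scaleR_right)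
    finally have "(c - 1) * (n \<bullet> (u, v)) \<le> (c - 1) * (n \<bullet> (d, d))" by (simp add: algebra_simps)
    then have "n \<bullet> (u, v) \<le> n \<bullet> (d, d)" using c(1) by simp
    then show ?thesis using ge[of "(u, v)"] q sub by (auto simp: nk)
  qed
  ultimately show ?thesis using n ge by (intro exI[of _ \<kappa>] exI[of _ \<nu>]) (auto simp: nk zero_prod_def)
qed

lemma edge_both_sides:
  fixes e :: "(real \<times> real) set"
  assumes "convex e" "aff_dim e = 1" "m \<in> rel_interior e"
  shows "\<exists>w t. w \<noteq> 0 \<and> t > 0 \<and> m + w \<in> e \<and> m - t *\<^sub>R w \<in> e"
proof -
  have "e \<noteq> {m}" using assms(2) by auto
  moreover have "m \<in> e" using assms(3) rel_interior_subset by blast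
  ultimately obtain q where q: "q \<in> e" "q \<noteq> m" by blast
  then obtain c where c: "c > 1" "(1 - c) *\<^sub>R q + c *\<^sub>R m \<in> e"
    using convex_rel_interior_iff[OF assms(1)] assms(3) by blast
  have "(1 - c) *\<^sub>R q + c *\<^sub>R m = m - (c - 1) *\<^sub>R (q - m)" by (simp add: algebra_simps)
  then show ?thesis using q c by (intro exI[of _ "q - m"] exI[of _ "c - 1"]) auto
qed

text \<open>Compact edges and rays are treated together; the weights of the supporting line tell
  them apart. A vanishing weight is a horizontal or vertical line, and two positive weights confine
  the edge to a bounded box, so that it is compact.\<close>

lemma local_decay_edge_interior:
  assumes U: "open U" and p: "(0, 0) \<in> U" and S: "smooth_on U S"
    and sa: "superadapted S" and d1: "newton_distance S > 1"
    and e: "e edge_of newton_polygon S" and m: "bisectrix_point S \<in> rel_interior e"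
    and cpt: "compact e \<or> \<not> bounded e"
  shows "local_decay U S (\<lambda>lam. lam powr (- 1 / newton_distance S))"
proof -
  define d where "d = newton_distance S"
  have m': "(d, d) \<in> rel_interior e" using m by (simp add: bisectrix_point_def d_def)
  have face: "e face_of newton_polygon S" and dim: "aff_dim e = 1" using e by (auto simp: edge_of_def)
  have sub: "e \<subseteq> newton_polygon S" using face by (rule face_of_imp_subset)
  have me: "(d, d) \<in> e" using m' rel_interior_subset by blast
  obtain \<kappa>' \<nu>' where nonneg: "\<kappa>' \<ge> 0" "\<nu>' \<ge> 0" and nz: "(\<kappa>', \<nu>') \<noteq> (0, 0)"
    and ge': "\<And>u v. (u, v) \<in> newton_polygon S \<Longrightarrow> \<kappa>' * u + \<nu>' * v \<ge> \<kappa>' * d + \<nu>' * d"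
    and on': "\<And>u v. (u, v) \<in> e \<Longrightarrow> \<kappa>' * u + \<nu>' * v = \<kappa>' * d + \<nu>' * d"
    using edge_supporting_line[OF e m'] by blast
  \<comment> \<open>Normalisation to \<kappa> u + \<nu> v = 1 on the edge; c > 0 since the weights
    are nonnegative and not both 0.\<close>
  define c where "c = (\<kappa>' + \<nu>') * d"
  have c: "c > 0" using nonneg nz d1 by (auto simp: c_def d_def intro!: mult_pos_pos)
  define \<kappa> \<nu> where "\<kappa> = \<kappa>' / c" and "\<nu> = \<nu>' / c"
  have norm: "\<kappa> * d + \<nu> * d = 1" using c by (simp add: \<kappa>_def \<nu>_def c_def add_divide_distrib[symmetric] distrib_right)
  have L: "\<kappa> * u + \<nu> * v = (\<kappa>' * u + \<nu>' * v) / c" for u v by (simp add: \<kappa>_def \<nu>_def add_divide_distrib)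
  have ge: "\<kappa> * u + \<nu> * v \<ge> 1" if "(u, v) \<in> newton_polygon S" for u v
    unfolding L using ge'[OF that] c by (simp add: c_def distrib_right)
  have on: "\<kappa> * u + \<nu> * v = 1" if "(u, v) \<in> e" for u v
    unfolding L using on'[OF that] c by (simp add: c_def distrib_right)
  have supp: "\<kappa> * real a + \<nu> * real b \<ge> 1" if "taylor_coeff S a b \<noteq> 0" for a b
    using that by (intro ge quadrant_subset_newton_polygon) auto
  have nn: "\<kappa> \<ge> 0" "\<nu> \<ge> 0" using nonneg c by (auto simp: \<kappa>_def \<nu>_def)
  obtain w t where w: "w \<noteq> 0" "t > 0" "(d, d) + w \<in> e" "(d, d) - t *\<^sub>R w \<in> e"
    using edge_both_sides[OF face_of_imp_convex[OF face] dim m'] by blast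
  obtain w1 w2 where w12: "w = (w1, w2)" by (cases w)
  have dir: "\<kappa> * w1 + \<nu> * w2 = 0" using on[of "d + w1" "d + w2"] w(3) norm by (simp add: w12 algebra_simps)
  have horiz: "\<exists>u v u' v'. (u, v) \<in> e \<and> u < d \<and> (u', v') \<in> e \<and> d < u'" if "\<nu> > 0"
  proof -
    have "w1 \<noteq> 0" using dir that w(1) w12 by (auto simp: zero_prod_def)
    then consider "w1 < 0" | "w1 > 0" by linarith
    then show ?thesis
    proof cases
      case 1
      then show ?thesis using w by (intro exI[of _ "d + w1"] exI[of _ "d + w2"] exI[of _ "d - t * w1"] exI[of _ "d - t * w2"]) (auto simp: w12 mult_less_0_iff)
    next
      case 2
      then show ?thesis using w by (intro exI[of _ "d - t * w1"] exI[of _ "d - t * w2"] exI[of _ "d + w1"] exI[of _ "d + w2"]) (auto simp: w12)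
    qed
  qed
  have vert: "\<exists>u v. (u, v) \<in> e \<and> v < d" if "\<kappa> > 0"
  proof -
    have "w2 \<noteq> 0" using dir that w(1) w12 by (auto simp: zero_prod_def)
    then consider "w2 < 0" | "w2 > 0" by linarith
    then show ?thesis
    proof cases
      case 1
      then show ?thesis using w by (intro exI[of _ "d + w1"] exI[of _ "d + w2"]) (auto simp: w12)
    next
      case 2
      then show ?thesis using w by (intro exI[of _ "d - t * w1"] exI[of _ "d - t * w2"]) (auto simp: w12)
    qed
  qed
  have left: "\<exists>a b. taylor_coeff S a b \<noteq> 0 \<and> \<kappa> * real a + \<nu> * real b = 1 \<and> real a < d" if \<nu>: "\<nu> > 0"
  proof -
    obtain u v where uv: "(u, v) \<in> e" "u < d" using horiz[OF \<nu>] by blast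
    then have "(u, v) \<in> newton_polygon S" "\<kappa> * u + \<nu> * v = 1" "1 * u + 0 * v < d" using sub on by auto
    from exponent_on_supporting_line[OF nn _ _ supp this] show ?thesis by simp
  qed
  have low: "\<exists>a b. taylor_coeff S a b \<noteq> 0 \<and> \<kappa> * real a + \<nu> * real b = 1 \<and> real b < d" if \<kappa>: "\<kappa> > 0"
  proof -
    obtain u v where uv: "(u, v) \<in> e" "v < d" using vert[OF \<kappa>] by blast
    then have "(u, v) \<in> newton_polygon S" "\<kappa> * u + \<nu> * v = 1" "0 * u + 1 * v < d" using sub on by auto
    from exponent_on_supporting_line[OF nn _ _ supp this] show ?thesis by simp
  qed
  consider "\<kappa> = 0" "\<nu> > 0" | "\<nu> = 0" "\<kappa> > 0" | "\<kappa> > 0" "\<nu> > 0"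
    using nn norm by (cases "\<kappa> = 0"; cases "\<nu> = 0") auto
  then have "local_decay U S (\<lambda>lam. lam powr - (1 / d))"
  proof cases
    case 1
    obtain a D where aD: "taylor_coeff S a D \<noteq> 0" "\<nu> * real D = 1" "real a < d" using left[OF 1(2)] 1 by auto
    have "\<nu> * real D = \<nu> * d" using aD(2) norm 1(1) by simp
    then have D: "real D = d" using 1(2) by simp
    have "b \<ge> D" if "taylor_coeff S a' b \<noteq> 0" for a' b
    proof -
      have "\<nu> * real b \<ge> \<nu> * real D" using supp[OF that] 1 aD(2) by simp
      then show ?thesis using 1(2) by simp
    qed
    then have "local_decay U S (\<lambda>lam. lam powr - (1 / real D))"
      by (rule local_decay_horizontal[OF U p S _ aD(1)]) (use aD(3) D in auto)
    then show ?thesis by (simp add: D)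
  next
    case 2
    obtain D b where bD: "taylor_coeff S D b \<noteq> 0" "\<kappa> * real D = 1" "real b < d" using low[OF 2(2)] 2 by auto
    have "\<kappa> * real D = \<kappa> * d" using bD(2) norm 2(1) by simp
    then have D: "real D = d" using 2(2) by simp
    have "a \<ge> D" if "taylor_coeff S a b' \<noteq> 0" for a b'
    proof -
      have "\<kappa> * real a \<ge> \<kappa> * real D" using supp[OF that] 2 bD(2) by simp
      then show ?thesis using 2(2) by simp
    qed
    then have "local_decay U S (\<lambda>lam. lam powr - (1 / real D))"
      by (rule local_decay_vertical[OF U p S _ bD(1)]) (use bD(3) D in auto)
    then show ?thesis by (simp add: D)
  next
    case 3
    have "e \<subseteq> cbox (0, 0) (1 / \<kappa>, 1 / \<nu>)"
    proof
      fix q assume q: "q \<in> e"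
      obtain u v where q_eq: "q = (u, v)" by (cases q)
      then have uv: "(u, v) \<in> e" using q by simp
      then have "u \<ge> 0" "v \<ge> 0" using newton_polygon_nonneg sub by blast+
      moreover from this have "\<kappa> * u \<le> 1" "\<nu> * v \<le> 1" using on[OF uv] 3 mult_nonneg_nonneg[of \<kappa> u] mult_nonneg_nonneg[of \<nu> v] by linarith+
      ultimately show "q \<in> cbox (0, 0) (1 / \<kappa>, 1 / \<nu>)" using 3 by (simp add: q_eq cbox_Pair_eq field_simps)
    qed
    then have "bounded e" by (rule bounded_subset[OF bounded_cbox])
    then have ce: "compact_edge S e" using cpt e by (simp add: compact_edge_def)
    have be: "bisectrix_point S \<in> e" using me by (simp add: bisectrix_point_def d_def)
    obtain a1 b1 where low1: "(a1, b1) \<in> weight_line \<kappa> \<nu>" "taylor_coeff S a1 b1 \<noteq> 0" "real b1 < d"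
      using low[OF 3(1)] by (auto simp: weight_line_def)
    obtain a2 b2 where left2: "(a2, b2) \<in> weight_line \<kappa> \<nu>" "taylor_coeff S a2 b2 \<noteq> 0" "real a2 < d"
      using left[OF 3(2)] by (auto simp: weight_line_def)
    obtain u v u' v' where uv: "(u, v) \<in> e" "u < d" "(u', v') \<in> e" "d < u'" using horiz[OF 3(2)] by blast
    have between: "(d, d) \<in> open_segment (x1, y1) (x2, y2)"
      if "\<kappa> * x1 + \<nu> * y1 = 1" "\<kappa> * x2 + \<nu> * y2 = 1" "x1 < d" "d < x2" for x1 y1 x2 y2
    proof (rule open_segmentI[where u="(d - x1) / (x2 - x1)"])
      have Y: "y = (1 - \<kappa> * x) / \<nu>" if "\<kappa> * x + \<nu> * y = 1" for x y using that 3(2) by (simp add: field_simps)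
      show "(x1, y1) \<noteq> (x2, y2)" "0 < (d - x1) / (x2 - x1)" "(d - x1) / (x2 - x1) < 1" using that by auto
      define s where "s = (d - x1) / (x2 - x1)"
      have X: "(1 - s) * x1 + s * x2 = d"
      proof -
        have "(1 - s) * x1 + s * x2 = x1 + s * (x2 - x1)" by (simp add: algebra_simps)
        then show ?thesis using that by (simp add: s_def)
      qed
      have "\<kappa> * ((1 - s) * x1 + s * x2) + \<nu> * ((1 - s) * y1 + s * y2)
          = (1 - s) * (\<kappa> * x1 + \<nu> * y1) + s * (\<kappa> * x2 + \<nu> * y2)" by (simp add: algebra_simps)
      then have "\<kappa> * d + \<nu> * ((1 - s) * y1 + s * y2) = \<kappa> * d + \<nu> * d" unfolding X that(1,2) norm by simp
      then have "(1 - s) * y1 + s * y2 = d" using 3(2) by simp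
      then show "(d, d) = (1 - (d - x1) / (x2 - x1)) *\<^sub>R (x1, y1) + ((d - x1) / (x2 - x1)) *\<^sub>R (x2, y2)"
        using X by (simp add: s_def)
    qed
    have sub': "edge_exponents e \<subseteq> weight_line \<kappa> \<nu>"
      using on by (auto simp: edge_exponents_def weight_line_def)
    \<comment> \<open>An exponent on the line with abscissa other than d forms, with a point of the
      edge on the other side, a segment with (d, d) in its interior; as the edge is a face, it
      contains the exponent.\<close>
    have sup: "(a, b) \<in> edge_exponents e" if ab: "(a, b) \<in> weight_line \<kappa> \<nu>" "taylor_coeff S a b \<noteq> 0" for a b
    proof -
      have line: "\<kappa> * real a + \<nu> * real b = 1" using ab by (simp add: weight_line_def)
      have N: "(real a, real b) \<in> newton_polygon S" using ab by (intro quadrant_subset_newton_polygon) auto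
      have "(real a, real b) \<in> e"
      proof (cases "real a" d rule: linorder_cases)
        case less
        have "(d, d) \<in> open_segment (real a, real b) (u', v')" using line on[OF uv(3)] less uv(4) by (rule between)
        then show ?thesis using face_ofD[OF face] N uv(3) sub me by blast
      next
        case equal
        have "\<nu> * real b = \<nu> * d" using line norm unfolding equal by linarith
        then have "real b = d" using 3(2) by simp
        then show ?thesis using equal me by simp
      next
        case greater
        have "(d, d) \<in> open_segment (u, v) (real a, real b)" using on[OF uv(1)] line uv(2) greater by (rule between)
        then show ?thesis using face_ofD[OF face] N uv(1) sub me by blast
      qed
      then show ?thesis by (simp add: edge_exponents_def)
    qed
    have d0: "newton_distance S > 0" using d1 by simp
    have roots: "\<exists>k. real k < d \<and> principal_y \<kappa> \<nu> S k \<sigma> t \<noteq> 0" if "\<sigma> \<in> {1, -1}" "t \<noteq> 0" for \<sigma> t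
      unfolding d_def by (rule superadapted_roots[OF 3 d0 sa ce be sub' sup low1(1,2) that])
    have "d > 1" using d1 by (simp add: d_def)
    from local_decay_edge[OF U p S 3 this norm supp low1 left2 roots] show ?thesis .
  qed
  then show ?thesis by (simp add: d_def)
qed

text \<open>Such a point is strictly inside a segment of the edge, with 1 / (1 + t) as the parameter
  that balances w against -t w. Hence at most one of the two estimates of the theorem is ever
  demanded.\<close>

lemma edge_interior_not_vertex:
  assumes e: "e edge_of newton_polygon S" and m: "bisectrix_point S \<in> rel_interior e"
  shows "\<not> bisectrix_at_vertex S"
proof -
  let ?m = "bisectrix_point S"
  have face: "e face_of newton_polygon S" and dim: "aff_dim e = 1" using e by (auto simp: edge_of_def)
  obtain w t where w: "w \<noteq> 0" "t > 0" "?m + w \<in> e" "?m - t *\<^sub>R w \<in> e"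
    using edge_both_sides[OF face_of_imp_convex[OF face] dim m] by blast
  have "?m \<in> open_segment (?m + w) (?m - t *\<^sub>R w)"
  proof (rule open_segmentI[where u="1 / (1 + t)"])
    have "?m + w \<noteq> ?m - t *\<^sub>R w \<longleftrightarrow> (1 + t) *\<^sub>R w \<noteq> 0" by (auto simp: algebra_simps add_eq_0_iff)
    then show "?m + w \<noteq> ?m - t *\<^sub>R w" using w by auto
    have "(1 - 1 / (1 + t)) *\<^sub>R w = (1 / (1 + t) * t) *\<^sub>R w" using w(2) by (simp add: field_simps)
    then show "?m = (1 - 1 / (1 + t)) *\<^sub>R (?m + w) + (1 / (1 + t)) *\<^sub>R (?m - t *\<^sub>R w)"
      by (simp add: scaleR_add_right scaleR_diff_right scaleR_left_diff_distrib)
  qed (use w in auto)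
  then show ?thesis
    using w face_of_imp_subset[OF face] by (auto simp: bisectrix_at_vertex_def extreme_point_of_def)
qed

section \<open>Decay of the oscillatory integral in the three cases\<close>

theorem theorem1:
  fixes S :: "real \<times> real \<Rightarrow> real" and U :: "(real \<times> real) set"
  assumes "open U" and "(0, 0) \<in> U" and "smooth_on U S"
    and "S (0, 0) = 0" and "GDERIV S (0, 0) :> (0, 0)"
    and "\<exists>a b. taylor_coeff S a b \<noteq> 0"
    and "superadapted S"
    and "newton_distance S > 1"
  shows "\<exists>V. open V \<and> (0, 0) \<in> V \<and> V \<subseteq> U \<and>
    (\<forall>\<phi> :: real \<times> real \<Rightarrow> real.
       smooth_on UNIV \<phi> \<and> compact (supp \<phi>) \<and> supp \<phi> \<subseteq> V \<longrightarrow>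
       (\<exists>C :: real.
          (bisectrix_in_edge S \<or> bisectrix_in_ray S \<longrightarrow>
             (\<forall>\<^sub>F lam in at_top. cmod (osc_integral S \<phi> lam)
                < C * lam powr (- 1 / newton_distance S))) \<and>
          (bisectrix_at_vertex S \<longrightarrow>
             (\<forall>\<^sub>F lam in at_top. cmod (osc_integral S \<phi> lam)
                < C * lam powr (- 1 / newton_distance S) * ln lam))))"
proof -
  consider (edge) e where "e edge_of newton_polygon S" "bisectrix_point S \<in> rel_interior e" "compact e \<or> \<not> bounded e"
    | (vertex) "\<not> (bisectrix_in_edge S \<or> bisectrix_in_ray S)" "bisectrix_at_vertex S"
    | (neither) "\<not> (bisectrix_in_edge S \<or> bisectrix_in_ray S)" "\<not> bisectrix_at_vertex S"
    unfolding bisectrix_in_edge_def bisectrix_in_ray_def compact_edge_def unbounded_ray_def by blast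
  then show ?thesis
  proof cases
    case edge
    have "\<not> bisectrix_at_vertex S" by (rule edge_interior_not_vertex[OF edge(1,2)])
    with local_decay_edge_interior[OF assms(1,2,3,7,8) edge] show ?thesis
      unfolding local_decay_def by (elim ex_forward conj_forward all_forward) auto
  next
    case vertex
    with local_decay_vertex[OF assms(1,2,3,8) vertex(2)] show ?thesis
      unfolding local_decay_def mult.assoc[symmetric] by (elim ex_forward conj_forward all_forward) auto
  next
    \<comment> \<open>Both implications are vacuous, so V = U will do.\<close>
    case neither
    then show ?thesis using assms(1,2) by blast
  qed
qed

end
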